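(* Let $f\in C(T)$. The following conditions are equivalent: (i) For every function $g\in C(T)$ there exists a homeomorphism $h$ of the circle $T$ onto itself such that $f\circ h\in W_2^{1/2}(T)$ and $g\circ h\in W_2^{1/2}(T)$. (ii) $f$ is of bounded variation on $T$.
   Context: $T=\mathbb{R}/2\pi\mathbb{Z}$ is the circle, and $C(T)$ is the class of continuous real-valued functions on $T$. The Fourier coefficients of an integrable function $x$ on $T$ are $\widehat{x}(k)=\frac{1}{2\pi}\int_T x(t)e^{-ikt}\,dt$, $k\in\mathbb{Z}$. $W_2^{1/2}(T)$ is the class of all functions $x$ on $T$ with $\sum_{k\in\mathbb{Z}}|\widehat{x}(k)|^2|k|<\infty$. *)

theory Defs
  imports "HOL-Analysis.Analysis"
begin

(* The circle T = R / 2 pi Z is identified with the unit circle in the complex plane through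
   t |-> cis t.  A function on T is a function complex => real of which only the values on the
   unit circle matter, and its value at the class of t is x (cis t). *)

abbreviation circle :: "complex set" where
  "circle \<equiv> sphere 0 1"

abbreviation C_T :: "(complex \<Rightarrow> real) set" where
  "C_T \<equiv> {x. continuous_on circle x}"

definition fourier_coeff :: "(complex \<Rightarrow> real) \<Rightarrow> int \<Rightarrow> complex" where
  "fourier_coeff x k =
     complex_of_real (1 / (2 * pi)) *
     (LINT t:{0..2 * pi}|lebesgue. complex_of_real (x (cis t)) * exp (- \<i> * of_int k * of_real t))"

(* Integrability on T is required so that the Fourier coefficients are meaningful
   (the Bochner integral of a non-integrable function is 0). *)
definition W_half :: "(complex \<Rightarrow> real) set" where
  "W_half = {x. set_integrable lebesgue {0..2 * pi} (\<lambda>t. x (cis t)) \<and>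
                (\<lambda>k::int. (cmod (fourier_coeff x k))\<^sup>2 * of_int \<bar>k\<bar>) summable_on UNIV}"

(* The partitions t 0 < ... < t n of T run exactly once around the circle, from an arbitrary
   starting point. *)
definition bounded_variation_T :: "(complex \<Rightarrow> real) \<Rightarrow> bool" where
  "bounded_variation_T x \<longleftrightarrow>
     (\<exists>B. \<forall>n (t :: nat \<Rightarrow> real).
        (\<forall>i<n. t i < t (Suc i)) \<and> t n = t 0 + 2 * pi \<longrightarrow>
        (\<Sum>i<n. \<bar>x (cis (t (Suc i))) - x (cis (t i))\<bar>) \<le> B)"

end

theory Submission
  imports Defs "HOL-Complex_Analysis.Complex_Analysis"
begin

text \<open>The seminorm of \<open>W_half\<close> is equivalent to the sum over \<open>n\<close> of \<open>2\<^sup>n\<close> times the mean square of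
  the increment of the function over the step \<open>\<pi> / 2\<^sup>n\<close>, so it is stable under Lipschitz maps.

  Necessity: if \<open>x\<close> and \<open>y\<close> are in \<open>W_half\<close>, the Fourier coefficients bound \<open>\<integral> y dx\<close>, a quantity that
  does not change under a homeomorphism. If \<open>f\<close> has unbounded variation, there are non-overlapping
  intervals on which \<open>f\<close> has variation at least \<open>4\<^sup>n\<close>; let \<open>g\<close> have amplitude \<open>2\<^sup>-\<^sup>n\<close> on the \<open>n\<close>-th one and
  follow there the signs of the increments of \<open>f\<close>. Soft thresholding is Lipschitz and cuts \<open>g\<close> down
  to finitely many intervals, while the integral against \<open>f\<close> remains unbounded.

  Sufficiency: a change of variable makes \<open>f\<close> Lipschitz. Map the disc conformally onto the star-shaped
  domain \<open>\<bar>w\<bar> < exp (g (w / \<bar>w\<bar>))\<close>, fixing \<open>0\<close>, and write the map as \<open>z exp (u + \<i> v)\<close>. On each circle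
  \<open>t + v\<close> is increasing, so \<open>\<integral> u dv\<close>, which is the energy of both \<open>u\<close> and \<open>v\<close>, is bounded. By the
  Courant--Lebesgue argument the functions \<open>t + v\<close> are equicontinuous, and a limit \<open>h\<close> of them at the
  boundary makes \<open>g \<circ> h\<close>, the limit of \<open>u\<close>, and every Lipschitz function of \<open>h\<close> have finite energy.\<close>

subsection \<open>Means and Fourier series on the circle\<close>

text \<open>Both halves estimate \<open>\<integral> y dx\<close>, which has no direct meaning for
  \<open>x\<close> in \<open>W_half\<close>. Hence \<open>x\<close> is replaced by its Fejer sum: a
  trigonometric polynomial, uniformly close to \<open>x\<close>, whose integral is an average of
  finite sums over Fourier coefficients, so that its bound does not depend on the degree. Fourier
  coefficients do not show the effect of Lipschitz maps; for that the increments are used. The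
  powers in the necessity half are tuned to each other: the threshold
  \<open>(1 / 2) ^ (m + 1)\<close> removes all blocks beyond \<open>m\<close> and leaves the same
  amplitude on block \<open>m\<close>, where variation \<open>4 ^ m\<close> turns it into about
  \<open>2 ^ m / 2\<close>. The exponential in the star-shaped domain makes the logarithm of the
  modulus of a boundary point equal to \<open>g\<close> of its direction, so that \<open>u\<close>
  becomes \<open>g\<close> of the boundary map. The obstacle in the sufficiency half is injectivity
  of the limit \<open>h\<close>: equicontinuity only yields a weakly increasing limit. A flat piece
  would force the conformal map to approach a nonzero constant along an arc, which is impossible for
  a bounded holomorphic function vanishing at the centre. No boundary extension of the conformal map
  is needed.\<close>

definition mean :: "(complex \<Rightarrow> 'a::real_normed_vector) \<Rightarrow> 'a" where
  "mean x = (1 / (2 * pi)) *\<^sub>R integral {0..2 * pi} (\<lambda>t. x (cis t))"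

text \<open>Complex-valued arguments are allowed because the coefficients of holomorphic functions
  on circles occur too. \<open>fourier_coeff_eq_fc\<close> gives the link with
  \<open>fourier_coeff\<close>.\<close>

definition fc :: "(complex \<Rightarrow> complex) \<Rightarrow> int \<Rightarrow> complex" where
  "fc x k = mean (\<lambda>z. x z * z powi (-k))"

lemma continuous_on_circle_cis:
  assumes "continuous_on circle x"
  shows "continuous_on S (\<lambda>t::real. x (cis t))"
  by (rule continuous_on_compose2[OF assms]) (auto intro!: continuous_intros)

lemma integrable_circle_cis:
  fixes x :: "complex \<Rightarrow> 'a::banach"
  assumes "continuous_on circle x"
  shows "(\<lambda>t. x (cis t)) integrable_on {a..b}"
  by (intro integrable_continuous_real continuous_on_circle_cis assms)

lemma mean_cong: "(\<And>z. z \<in> circle \<Longrightarrow> x z = y z) \<Longrightarrow> mean x = mean y"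
  unfolding mean_def by simp

lemma mean_const [simp]: "mean (\<lambda>_. c :: 'a::banach) = c"
  by (simp add: mean_def)

lemma mean_add:
  fixes x y :: "complex \<Rightarrow> 'a::banach"
  assumes "continuous_on circle x" "continuous_on circle y"
  shows "mean (\<lambda>z. x z + y z) = mean x + mean y"
  using assms by (simp add: mean_def integral_add integrable_circle_cis scaleR_right_distrib)

lemma mean_diff:
  fixes x y :: "complex \<Rightarrow> 'a::banach"
  assumes "continuous_on circle x" "continuous_on circle y"
  shows "mean (\<lambda>z. x z - y z) = mean x - mean y"
  using assms by (simp add: mean_def integral_diff integrable_circle_cis scaleR_right_diff_distrib)

lemma mean_linear:
  fixes x :: "complex \<Rightarrow> 'a::banach" and l :: "'a \<Rightarrow> 'b::banach"
  assumes "continuous_on circle x" "bounded_linear l"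
  shows "mean (\<lambda>z. l (x z)) = l (mean x)"
  using integral_linear[OF integrable_circle_cis[OF assms(1), of 0 "2 * pi"] assms(2)]
  by (simp add: mean_def o_def linear_cmul assms(2) bounded_linear.linear)

lemma mean_mult_left:
  fixes x :: "complex \<Rightarrow> 'a::{banach,real_normed_algebra}"
  assumes "continuous_on circle x"
  shows "mean (\<lambda>z. c * x z) = c * mean x"
  by (rule mean_linear[OF assms bounded_linear_mult_right])

lemma mean_sum:
  fixes x :: "'i \<Rightarrow> complex \<Rightarrow> 'a::banach"
  assumes "finite K" "\<And>k. k \<in> K \<Longrightarrow> continuous_on circle (x k)"
  shows "mean (\<lambda>z. \<Sum>k\<in>K. x k z) = (\<Sum>k\<in>K. mean (x k))"
  using assms by (simp add: mean_def integral_sum integrable_circle_cis scaleR_right.sum)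

lemma mean_mono:
  fixes x y :: "complex \<Rightarrow> real"
  assumes "continuous_on circle x" "continuous_on circle y" "\<And>z. z \<in> circle \<Longrightarrow> x z \<le> y z"
  shows "mean x \<le> mean y"
  unfolding mean_def real_scaleR_def
  by (intro mult_left_mono integral_le integrable_circle_cis assms) auto

lemma norm_mean_le:
  fixes x :: "complex \<Rightarrow> 'a::banach"
  assumes "continuous_on circle x"
  shows "norm (mean x) \<le> mean (\<lambda>z. norm (x z))"
  unfolding mean_def using assms
  by (auto intro!: divide_right_mono integral_norm_bound_integral integrable_circle_cis continuous_intros)

lemma mean_nonneg:
  fixes x :: "complex \<Rightarrow> real"
  assumes "continuous_on circle x" "\<And>z. z \<in> circle \<Longrightarrow> 0 \<le> x z"
  shows "0 \<le> mean x"
  using mean_mono[of "\<lambda>_. 0" x] assms by simp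

lemma mean_le:
  fixes x :: "complex \<Rightarrow> real"
  assumes "continuous_on circle x" "\<And>z. z \<in> circle \<Longrightarrow> x z \<le> B"
  shows "mean x \<le> B"
  using mean_mono[of x "\<lambda>_. B"] assms by simp

lemma continuous_on_circle_powi [continuous_intros]:
  "continuous_on circle (\<lambda>z::complex. z powi k)"
  by (intro continuous_intros) auto

lemma cis_powi: "cis t powi k = cis (of_int k * t)"
  by (simp add: cis_power_int)

lemma mean_powi: "mean (\<lambda>z::complex. z powi k) = (if k = 0 then 1 else 0)"
proof (cases "k = 0")
  case False
  have "((\<lambda>t. cis (of_int k * t)) has_integral
      cis (of_int k * (2 * pi)) / (\<i> * of_int k) - cis (of_int k * 0) / (\<i> * of_int k)) {0..2*pi}"
    by (rule fundamental_theorem_of_calculus)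
      (use False in \<open>auto intro!: derivative_eq_intros ext
         simp: has_vector_derivative_def field_simps scaleR_conv_of_real\<close>)
  moreover have "cis (of_int k * (2 * pi)) = 1"
    by (metis cis_multiple_2pi mult.commute Ints_of_int)
  ultimately have "integral {0..2*pi} (\<lambda>t. cis (of_int k * t)) = 0"
    by (simp add: integral_unique)
  with False show ?thesis by (simp add: mean_def cis_powi)
qed simp

text \<open>As a function of \<open>u\<close>, the integral over \<open>{u..u + T}\<close> has
  derivative \<open>p (u + T) - p u = 0\<close>; its constant value is compared at \<open>a\<close>
  and at \<open>0\<close>.\<close>

lemma periodic_integral_shift:
  fixes p :: "real \<Rightarrow> 'a::banach"
  assumes "continuous_on UNIV p" "\<And>t. p (t + T) = p t" "0 \<le> T"
  shows "integral {a..a+T} p = integral {0..T} p"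
proof -
  have int: "p integrable_on {c..d}" for c d
    using assms(1) continuous_on_subset integrable_continuous_real by blast
  \<comment> \<open>The window \<open>{-b-1..b+1}\<close> contains both \<open>a\<close> and
    \<open>0\<close>, and the antiderivative starts at its left end.\<close>
  define b where "b = \<bar>a\<bar>"
  define P where "P u = integral {-b-1..u} p" for u
  have sub: "integral {u..v} p = P v - P u" if "-b-1 \<le> u" "u \<le> v" for u v
    using Henstock_Kurzweil_Integration.integral_combine[OF that int] by (simp add: P_def algebra_simps)
  have der: "(P has_vector_derivative p u) (at u within {-b-1..b+1+T})" if "u \<in> {-b-1..b+1+T}" for u
    unfolding P_def using that assms(1)
    by (intro integral_has_vector_derivative) (auto intro: continuous_on_subset)
  have "((\<lambda>u. P (u + T) - P u) has_vector_derivative 0) (at u within {-b-1..b+1})"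
    if "u \<in> {-b-1..b+1}" for u
  proof -
    have "((P \<circ> (\<lambda>u. u + T)) has_vector_derivative 1 *\<^sub>R p (u + T)) (at u within {-b-1..b+1})"
    proof (rule vector_diff_chain_within)
      show "((\<lambda>u. u + T) has_vector_derivative 1) (at u within {-b-1..b+1})"
        by (auto intro!: derivative_eq_intros)
      show "(P has_vector_derivative p (u + T)) (at (u + T) within (\<lambda>u. u + T) ` {-b-1..b+1})"
        using that assms(3) by (intro has_vector_derivative_within_subset[OF der]) auto
    qed
    moreover have "(P has_vector_derivative p u) (at u within {-b-1..b+1})"
      using that assms(3) by (intro has_vector_derivative_within_subset[OF der]) auto
    ultimately show ?thesis
      using has_vector_derivative_diff assms(2) by (fastforce simp: o_def)
  qed
  then obtain c where c: "\<And>u. u \<in> {-b-1..b+1} \<Longrightarrow> P (u + T) - P u = c"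
    using has_vector_derivative_zero_constant[of "{-b-1..b+1}" "\<lambda>u. P (u + T) - P u"] by auto
  have "integral {u..u+T} p = c" if "u \<in> {-b-1..b+1}" for u
    using sub[of u "u + T"] c[of u] that assms(3) by auto
  note  this[of a] this[of 0]
  moreover have "a \<in> {-b-1..b+1}" "0 \<in> {-b-1..b+1}" by (auto simp: b_def)
  ultimately show ?thesis by simp
qed

lemma mean_shift:
  fixes x :: "complex \<Rightarrow> 'a::banach"
  assumes "continuous_on circle x"
  shows "mean x = (1 / (2 * pi)) *\<^sub>R integral {a..a + 2 * pi} (\<lambda>t. x (cis t))"
  unfolding mean_def
  by (subst periodic_integral_shift)
    (auto intro!: continuous_on_circle_cis assms simp flip: cis_mult)

lemma mean_rotate:
  fixes x :: "complex \<Rightarrow> 'a::banach"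
  assumes x: "continuous_on circle x" and w: "w \<in> circle"
  shows "mean (\<lambda>z. x (w * z)) = mean x"
proof -
  have s: "w = cis (Arg2pi w)" using w by (simp add: complex_norm_eq_1_exp cis_conv_exp)
  define s where "s = Arg2pi w"
  note s = s[folded s_def]
  have "mean (\<lambda>z. x (w * z)) = (1 / (2 * pi)) *\<^sub>R integral {0..2*pi} (\<lambda>t. x (cis (t + s)))"
    by (simp add: mean_def s cis_mult add.commute)
  also have "integral {0..2*pi} (\<lambda>t. x (cis (t + s))) = integral {s..s+2*pi} (\<lambda>t. x (cis t))"
    using integral_shift_Icc_real[of 0 "2*pi" "\<lambda>t. x (cis t)" s]
    by (simp add: o_def add.commute)
  finally show ?thesis using mean_shift[OF x, of s] by simp
qed

lemma mean_cnj:
  assumes "continuous_on circle x"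
  shows "mean (\<lambda>z. cnj (x z)) = cnj (mean x)"
  by (rule mean_linear[OF assms bounded_linear_cnj])

lemma mean_of_real:
  fixes x :: "complex \<Rightarrow> real"
  assumes "continuous_on circle x"
  shows "mean (\<lambda>z. complex_of_real (x z)) = of_real (mean x)"
  by (rule mean_linear[OF assms bounded_linear_of_real])

lemma fc_diff:
  assumes "continuous_on circle x" "continuous_on circle y"
  shows "fc (\<lambda>z. x z - y z) k = fc x k - fc y k"
  unfolding fc_def left_diff_distrib by (intro mean_diff continuous_intros assms)

lemma fc_add:
  assumes "continuous_on circle x" "continuous_on circle y"
  shows "fc (\<lambda>z. x z + y z) k = fc x k + fc y k"
  unfolding fc_def distrib_right by (intro mean_add continuous_intros assms)

lemma fc_mult_left:
  assumes "continuous_on circle x"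
  shows "fc (\<lambda>z. c * x z) k = c * fc x k"
  unfolding fc_def mult.assoc by (intro mean_mult_left continuous_intros assms)

lemma circle_cnj_powi:
  assumes "z \<in> circle"
  shows "cnj z powi k = z powi (-k)"
proof -
  have "cnj z = inverse z" using assms divide_conv_cnj[of z 1] by (simp add: inverse_eq_divide)
  then show ?thesis by (simp add: power_int_minus power_int_inverse)
qed

lemma fc_cnj:
  assumes "continuous_on circle x"
  shows "fc (\<lambda>z. cnj (x z)) k = cnj (fc x (-k))"
proof -
  have "fc (\<lambda>z. cnj (x z)) k = mean (\<lambda>z. cnj (x z * z powi k))"
    unfolding fc_def by (rule mean_cong) (simp add: circle_cnj_powi)
  also have "\<dots> = cnj (fc x (-k))"
    unfolding fc_def by (subst mean_cnj) (auto intro!: continuous_on_mult continuous_on_circle_powi assms)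
  finally show ?thesis .
qed

lemma fc_rotate:
  assumes x: "continuous_on circle x" and w: "w \<in> circle"
  shows "fc (\<lambda>z. x (w * z)) k = w powi k * fc x k"
proof -
  have "fc (\<lambda>z. x (w * z)) k = mean (\<lambda>z. (\<lambda>z. w powi k * (x z * z powi (-k))) (w * z))"
    unfolding fc_def using w
    by (intro mean_cong) (auto simp: power_int_mult_distrib power_int_minus field_simps)
  also have "\<dots> = mean (\<lambda>z. w powi k * (x z * z powi (-k)))"
    by (rule mean_rotate) (intro continuous_intros assms)+
  also have "\<dots> = w powi k * fc x k"
    unfolding fc_def by (rule mean_mult_left) (auto intro!: continuous_intros assms)
  finally show ?thesis .
qed

lemma continuous_on_circle_rotate:
  assumes "continuous_on circle x" "w \<in> circle"
  shows "continuous_on circle (\<lambda>z. x (w * z))"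
  by (rule continuous_on_compose2[OF assms(1)]) (use assms(2) in \<open>auto intro!: continuous_intros simp: norm_mult\<close>)

lemma norm_fc_le:
  assumes "continuous_on circle x" "\<And>z. z \<in> circle \<Longrightarrow> cmod (x z) \<le> B"
  shows "cmod (fc x k) \<le> B"
proof -
  have "cmod (fc x k) \<le> mean (\<lambda>z. cmod (x z * z powi (-k)))"
    unfolding fc_def by (rule norm_mean_le) (intro continuous_intros assms)
  also have "\<dots> \<le> B"
    using assms(2) by (intro mean_le continuous_intros assms) (simp add: norm_mult norm_power_int)
  finally show ?thesis .
qed

text \<open>Pythagoras for the orthonormal powers of \<open>z\<close>. The choice
  \<open>a = fc x\<close> gives Bessel's inequality; for other coefficients the last sum is
  nonnegative, which gives Parseval by approximation.\<close>

lemma mean_square_distance: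
  assumes x: "continuous_on circle x" and K: "finite K"
  shows "mean (\<lambda>z. (cmod (x z - (\<Sum>k\<in>K. a k * z powi k)))\<^sup>2) =
     mean (\<lambda>z. (cmod (x z))\<^sup>2) - (\<Sum>k\<in>K. (cmod (fc x k))\<^sup>2) + (\<Sum>k\<in>K. (cmod (a k - fc x k))\<^sup>2)"
proof -
  define p where "p z = (\<Sum>k\<in>K. a k * z powi k)" for z
  have p: "continuous_on circle p" unfolding p_def by (intro continuous_intros) auto
  \<comment> \<open>Used for \<open>y = x\<close> and again for \<open>y = p\<close>: one
    computation yields the mixed terms and the norm of \<open>p\<close>.\<close>
  have xp: "mean (\<lambda>z. y z * cnj (p z)) = (\<Sum>k\<in>K. cnj (a k) * fc y k)"
    if y: "continuous_on circle y" for y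
  proof -
    have "mean (\<lambda>z. y z * cnj (p z)) = mean (\<lambda>z. \<Sum>k\<in>K. cnj (a k) * (y z * z powi (-k)))"
      by (rule mean_cong) (simp add: p_def sum_distrib_left circle_cnj_powi mult_ac)
    also have "\<dots> = (\<Sum>k\<in>K. cnj (a k) * fc y k)"
      using K y unfolding fc_def
      by (subst mean_sum) (auto intro!: continuous_intros sum.cong mean_mult_left)
    finally show ?thesis .
  qed
  have fcp: "fc p k = (if k \<in> K then a k else 0)" for k
  proof -
    have "fc p k = mean (\<lambda>z. \<Sum>j\<in>K. a j * z powi (j - k))"
      unfolding fc_def
    proof (rule mean_cong)
      fix z :: complex assume "z \<in> circle"
      then have "z \<noteq> 0" by auto
      then show "p z * z powi (-k) = (\<Sum>j\<in>K. a j * z powi (j - k))"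
        by (simp add: p_def sum_distrib_right power_int_diff power_int_minus divide_inverse mult.assoc)
    qed
    also have "\<dots> = (\<Sum>j\<in>K. a j * (if j = k then 1 else 0))"
      using K by (subst mean_sum)
        (auto intro!: continuous_intros sum.cong simp: mean_mult_left continuous_intros mean_powi)
    finally show ?thesis using K by (simp add: if_distrib sum.delta cong: if_cong)
  qed
  have sq: "of_real ((cmod (x z - p z))\<^sup>2) = of_real ((cmod (x z))\<^sup>2) - x z * cnj (p z)
      - cnj (x z * cnj (p z)) + p z * cnj (p z)" for z
    unfolding complex_norm_square by (simp add: algebra_simps)
  have "of_real (mean (\<lambda>z. (cmod (x z - p z))\<^sup>2)) = mean (\<lambda>z. complex_of_real ((cmod (x z - p z))\<^sup>2))"
    by (subst mean_of_real) (auto intro!: continuous_intros x p)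
  also have "\<dots> = of_real (mean (\<lambda>z. (cmod (x z))\<^sup>2)) - mean (\<lambda>z. x z * cnj (p z))
      - cnj (mean (\<lambda>z. x z * cnj (p z))) + mean (\<lambda>z. p z * cnj (p z))"
    unfolding sq by (subst mean_add mean_diff mean_cnj mean_of_real; (intro continuous_intros x p)?)+ simp
  also have "\<dots> = of_real (mean (\<lambda>z. (cmod (x z))\<^sup>2)) + (\<Sum>k\<in>K. cnj (a k) * a k - cnj (a k) * fc x k - a k * cnj (fc x k))"
    by (simp add: xp x p fcp sum_subtractf sum.distrib algebra_simps)
  also have "(\<Sum>k\<in>K. cnj (a k) * a k - cnj (a k) * fc x k - a k * cnj (fc x k)) =
      of_real ((\<Sum>k\<in>K. (cmod (a k - fc x k))\<^sup>2) - (\<Sum>k\<in>K. (cmod (fc x k))\<^sup>2))"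
    unfolding of_real_diff of_real_sum complex_norm_square sum_subtractf[symmetric]
    by (intro sum.cong) (auto simp: algebra_simps)
  finally show ?thesis unfolding p_def by (simp flip: of_real_diff of_real_add)
qed

lemma bessel:
  assumes "continuous_on circle x" "finite K"
  shows "(\<Sum>k\<in>K. (cmod (fc x k))\<^sup>2) \<le> mean (\<lambda>z. (cmod (x z))\<^sup>2)"
proof -
  have "0 \<le> mean (\<lambda>z. (cmod (x z - (\<Sum>k\<in>K. fc x k * z powi k)))\<^sup>2)"
    by (intro mean_nonneg continuous_intros assms) auto
  then show ?thesis unfolding mean_square_distance[OF assms] by simp
qed

section \<open>Fejer means and Parseval's inequality\<close>

text \<open>Both sides contain \<open>a k\<close> exactly \<open>N + 1 - \<bar>k\<bar>\<close>
  times. This turns the square of a geometric sum into a sum of Dirichlet kernels.\<close>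

lemma double_sum_diff:
  fixes a :: "int \<Rightarrow> 'a::comm_monoid_add"
  shows "(\<Sum>j\<le>N. \<Sum>l\<le>N. a (int j - int l)) = (\<Sum>m\<le>N. \<Sum>k\<in>{-int m..int m}. a k)"
proof (induction N)
  case (Suc N)
  have 1: "{-int (Suc N)..int (Suc N)} = (\<lambda>l. int (Suc N) - int l) ` {..N} \<union> ({0} \<union> (\<lambda>j. int j - int (Suc N)) ` {..N})"
    (is "?L = ?A \<union> ({0} \<union> ?B)")
  proof (intro equalityI subsetI)
    fix k assume "k \<in> ?L"
    then consider "k = 0" | "k > 0" "k = int (Suc N) - int (Suc N - nat k)" "Suc N - nat k \<le> N"
      | "k < 0" "k = int (Suc N - nat (-k)) - int (Suc N)" "Suc N - nat (-k) \<le> N"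
      by (cases "k = 0"; cases "k > 0") auto
    then show "k \<in> ?A \<union> ({0} \<union> ?B)" by cases blast+
  qed auto
  have "(\<Sum>k\<in>?L. a k) = (\<Sum>l\<le>N. a (int (Suc N) - int l)) + (a 0 + (\<Sum>j\<le>N. a (int j - int (Suc N))))"
    unfolding 1 by (subst sum.union_disjoint, simp, simp, force)+ (simp add: sum.reindex inj_on_def)
  then show ?case using Suc.IH
    by (simp add: sum.distrib add_ac)
qed simp

definition partial_sum :: "(complex \<Rightarrow> complex) \<Rightarrow> nat \<Rightarrow> complex \<Rightarrow> complex" where
  "partial_sum x m z = (\<Sum>k\<in>{-int m..int m}. fc x k * z powi k)"

definition fejer_sum :: "(complex \<Rightarrow> complex) \<Rightarrow> nat \<Rightarrow> complex \<Rightarrow> complex" where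
  "fejer_sum x N z = (\<Sum>m\<le>N. partial_sum x m z) / of_nat (Suc N)"

text \<open>The Fejer kernel as a squared modulus, so that positivity is immediate;
  \<open>fejer_kernel_eq\<close> recovers the average of Dirichlet kernels.\<close>

definition fejer_kernel :: "nat \<Rightarrow> complex \<Rightarrow> real" where
  "fejer_kernel N u = (cmod (\<Sum>j\<le>N. u ^ j))\<^sup>2 / real (Suc N)"

lemma continuous_on_partial_sum: "continuous_on circle (partial_sum x m)"
  unfolding partial_sum_def by (intro continuous_intros)

lemma continuous_on_fejer_sum: "continuous_on circle (fejer_sum x m)"
  unfolding fejer_sum_def by (intro continuous_intros continuous_on_partial_sum) (simp del: of_nat_Suc)

lemma fejer_kernel_nonneg: "0 \<le> fejer_kernel N u"
  by (simp add: fejer_kernel_def)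

lemma fejer_kernel_eq:
  assumes "u \<in> circle"
  shows "of_real (fejer_kernel N u) = (\<Sum>m\<le>N. \<Sum>k\<in>{-int m..int m}. u powi k) / of_nat (Suc N)"
proof -
  have "(\<Sum>m\<le>N. \<Sum>k\<in>{-int m..int m}. u powi k) = (\<Sum>j\<le>N. \<Sum>l\<le>N. u powi (int j) * cnj (u powi (int l)))"
    unfolding double_sum_diff[symmetric] using assms
    by (intro sum.cong refl, subst power_int_diff)
      (auto simp: circle_cnj_powi power_int_minus divide_inverse simp del: power_int_of_nat)
  also have "\<dots> = (\<Sum>j\<le>N. u ^ j) * cnj (\<Sum>j\<le>N. u ^ j)"
    by (simp add: sum_product)
  also have "\<dots> = of_real ((cmod (\<Sum>j\<le>N. u ^ j))\<^sup>2)"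
    unfolding complex_norm_square ..
  finally show ?thesis by (simp add: fejer_kernel_def)
qed

lemma continuous_on_fejer_kernel: "continuous_on circle (\<lambda>w. fejer_kernel N (z * cnj w))"
  unfolding fejer_kernel_def by (intro continuous_intros) auto

lemma fejer_sum_eq:
  assumes x: "continuous_on circle x" and z: "z \<in> circle"
  shows "fejer_sum x N z = mean (\<lambda>w. x w * of_real (fejer_kernel N (z * cnj w)))"
proof -
  have eq: "x w * of_real (fejer_kernel N (z * cnj w)) =
     (\<Sum>m\<le>N. \<Sum>k\<in>{-int m..int m}. (z powi k / of_nat (Suc N)) * (x w * w powi (-k)))"
    if w: "w \<in> circle" for w
  proof -
    have "(z * cnj w) powi k = z powi k * w powi (-k)" for k
      using circle_cnj_powi[OF w, of k] by (simp add: power_int_mult_distrib)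
    moreover have "z * cnj w \<in> circle" using z w by (simp add: norm_mult)
    ultimately show ?thesis
      by (simp add: fejer_kernel_eq sum_distrib_left sum_divide_distrib mult_ac)
  qed
  have "mean (\<lambda>w. x w * of_real (fejer_kernel N (z * cnj w))) =
     (\<Sum>m\<le>N. \<Sum>k\<in>{-int m..int m}. (z powi k / of_nat (Suc N)) * fc x k)"
  proof -
    have c: "continuous_on circle (\<lambda>w. (z powi k / of_nat (Suc N)) * (x w * w powi (-k)))" for k
      by (intro continuous_on_mult continuous_on_const continuous_on_circle_powi x)
    have "mean (\<lambda>w. x w * of_real (fejer_kernel N (z * cnj w))) =
       mean (\<lambda>w. \<Sum>m\<le>N. \<Sum>k\<in>{-int m..int m}. (z powi k / of_nat (Suc N)) * (x w * w powi (-k)))"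
      by (rule mean_cong) (rule eq)
    also have "\<dots> = (\<Sum>m\<le>N. \<Sum>k\<in>{-int m..int m}. mean (\<lambda>w. (z powi k / of_nat (Suc N)) * (x w * w powi (-k))))"
      using c by (simp add: mean_sum continuous_on_sum del: of_nat_Suc)
    also have "\<dots> = (\<Sum>m\<le>N. \<Sum>k\<in>{-int m..int m}. (z powi k / of_nat (Suc N)) * fc x k)"
      unfolding fc_def
      by (intro sum.cong refl mean_mult_left continuous_on_mult continuous_on_circle_powi x)
    finally show ?thesis .
  qed
  then show ?thesis
    by (simp add: fejer_sum_def partial_sum_def sum_divide_distrib mult_ac)
qed

text \<open>The convolution formula for the constant function 1, whose only nonzero coefficient sits
  at 0.\<close>

lemma mean_fejer_kernel:
  assumes "z \<in> circle"
  shows "mean (\<lambda>w. fejer_kernel N (z * cnj w)) = 1"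
proof -
  have fc1: "fc (\<lambda>_. 1) k = (if k = 0 then 1 else 0)" for k
    using mean_powi[of "-k"] by (simp add: fc_def)
  have "complex_of_real (mean (\<lambda>w. fejer_kernel N (z * cnj w))) = fejer_sum (\<lambda>_. 1) N z"
    using assms by (subst fejer_sum_eq) (simp_all add: mean_of_real continuous_on_fejer_kernel)
  also have "\<dots> = 1"
    by (simp add: fejer_sum_def partial_sum_def fc1 if_distrib[of "\<lambda>x. x * _"] sum.delta cong: if_cong del: of_nat_Suc)
  finally show ?thesis by simp
qed

text \<open>The kernel is nonnegative with mean 1, so a constant can be moved under the convolution.
  \<open>c = 0\<close> yields the uniform bound, \<open>c = x z\<close> the convergence.\<close>

lemma fejer_sum_diff_le:
  assumes x: "continuous_on circle x" and z: "z \<in> circle"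
  shows "cmod (fejer_sum x N z - c) \<le> mean (\<lambda>w. cmod (x w - c) * fejer_kernel N (z * cnj w))"
proof -
  have "fejer_sum x N z - c = mean (\<lambda>w. x w * of_real (fejer_kernel N (z * cnj w))) -
      c * mean (\<lambda>w. of_real (fejer_kernel N (z * cnj w)))"
    using mean_fejer_kernel[OF z] fejer_sum_eq[OF x z] by (simp add: mean_of_real continuous_on_fejer_kernel)
  also have "\<dots> = mean (\<lambda>w. (x w - c) * of_real (fejer_kernel N (z * cnj w)))"
    unfolding left_diff_distrib
    by (subst mean_diff mean_mult_left[symmetric]; (intro continuous_intros x continuous_on_fejer_kernel)?)+ simp?
  also have "cmod \<dots> \<le> mean (\<lambda>w. cmod ((x w - c) * of_real (fejer_kernel N (z * cnj w))))"
    by (intro norm_mean_le continuous_intros x continuous_on_fejer_kernel)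
  finally show ?thesis by (simp add: norm_mult fejer_kernel_nonneg)
qed

lemma norm_fejer_sum_le:
  assumes x: "continuous_on circle x" and z: "z \<in> circle" and B: "\<And>w. w \<in> circle \<Longrightarrow> cmod (x w) \<le> B"
  shows "cmod (fejer_sum x N z) \<le> B"
proof -
  have "cmod (fejer_sum x N z) \<le> mean (\<lambda>w. cmod (x w) * fejer_kernel N (z * cnj w))"
    using fejer_sum_diff_le[OF x z, of N 0] by simp
  also have "\<dots> \<le> mean (\<lambda>w. B * fejer_kernel N (z * cnj w))"
    by (intro mean_mono continuous_intros x continuous_on_fejer_kernel mult_right_mono B fejer_kernel_nonneg)
  finally show ?thesis
    using mean_fejer_kernel[OF z, of N] by (simp add: mean_mult_left continuous_on_fejer_kernel)
qed

text \<open>Uniform continuity and boundedness give \<open>\<bar>x w - x z\<bar> \<le> e + C \<bar>w - z\<bar>\<^sup>2\<close>, and the Fejer mean of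
  the quadratic term is \<open>O(1/N)\<close> because the kernel times \<open>\<bar>u - 1\<bar>\<^sup>2\<close> is bounded by \<open>4/(N+1)\<close>.\<close>

lemma fejer_sum_uniform:
  assumes x: "continuous_on circle x" and e: "0 < e"
  shows "\<exists>N0. \<forall>N\<ge>N0. \<forall>z\<in>circle. cmod (fejer_sum x N z - x z) < e"
proof -
  have "uniformly_continuous_on circle x"
    by (rule compact_uniformly_continuous[OF x]) simp
  then obtain d where d: "0 < d" "\<And>w z. w \<in> circle \<Longrightarrow> z \<in> circle \<Longrightarrow> cmod (w - z) < d \<Longrightarrow> cmod (x w - x z) < e / 2"
    using e unfolding uniformly_continuous_on_def dist_norm by (meson half_gt_zero)
  have "bounded (x ` circle)"
    by (intro compact_imp_bounded compact_continuous_image x) simp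
  then obtain M where M: "\<And>z. z \<in> circle \<Longrightarrow> cmod (x z) \<le> M" "0 < M"
    unfolding bounded_pos by blast
  define C where "C = 2 * M / d\<^sup>2"
  have C: "0 < C" using M d by (simp add: C_def)
  have bd: "cmod (x w - x z) \<le> e / 2 + C * (cmod (z * cnj w - 1))\<^sup>2" if w: "w \<in> circle" and z: "z \<in> circle" for w z
  proof -
    have "z * cnj w - 1 = (z - w) * cnj w"
      using w by (simp add: left_diff_distrib complex_norm_square[symmetric])
    then have n: "cmod (z * cnj w - 1) = cmod (w - z)" using w by (simp add: norm_mult norm_minus_commute)
    show ?thesis
    proof (cases "cmod (w - z) < d")
      case True
      then have "cmod (x w - x z) \<le> e / 2" using d(2)[OF w z] by simp
      moreover have "0 \<le> C * (cmod (z * cnj w - 1))\<^sup>2" using C by simp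
      ultimately show ?thesis by linarith
    next
      case False
      have "cmod (x w - x z) \<le> 2 * M"
        using norm_triangle_ineq4[of "x w" "x z"] M(1)[OF w] M(1)[OF z] by simp
      also have "\<dots> = C * d\<^sup>2" using d by (simp add: C_def)
      also have "\<dots> \<le> C * (cmod (w - z))\<^sup>2" using False d C by (intro mult_left_mono power_mono) auto
      finally show ?thesis using e unfolding n by simp
    qed
  qed
  have est: "cmod (fejer_sum x N z - x z) \<le> e / 2 + C * (4 / real (Suc N))" if z: "z \<in> circle" for N z
  proof -
    have ker: "(cmod (u - 1))\<^sup>2 * fejer_kernel N u \<le> 4 / real (Suc N)" if "u \<in> circle" for u
    proof -
      have "cmod ((u - 1) * (\<Sum>j\<le>N. u ^ j)) = cmod (u ^ Suc N - 1)"
        using power_diff_1_eq[of u "Suc N"] by (simp add: lessThan_Suc_atMost)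
      also have "\<dots> \<le> 2" using norm_triangle_ineq4[of "u ^ Suc N" 1] that by (simp add: norm_power norm_mult)
      finally have "(cmod ((u - 1) * (\<Sum>j\<le>N. u ^ j)))\<^sup>2 \<le> 2\<^sup>2" by (intro power_mono) auto
      then show ?thesis by (simp add: fejer_kernel_def norm_mult power_mult_distrib divide_right_mono)
    qed
    have "cmod (fejer_sum x N z - x z) \<le> mean (\<lambda>w. cmod (x w - x z) * fejer_kernel N (z * cnj w))"
      by (rule fejer_sum_diff_le[OF x z])
    also have "\<dots> \<le> mean (\<lambda>w. e / 2 * fejer_kernel N (z * cnj w) + C * (4 / real (Suc N)))"
    proof (intro mean_mono continuous_intros x continuous_on_fejer_kernel)
      fix w :: complex assume w: "w \<in> circle"
      have "cmod (x w - x z) * fejer_kernel N (z * cnj w) \<le>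
          (e / 2 + C * (cmod (z * cnj w - 1))\<^sup>2) * fejer_kernel N (z * cnj w)"
        by (intro mult_right_mono bd w z fejer_kernel_nonneg)
      also have "\<dots> = e / 2 * fejer_kernel N (z * cnj w) + C * ((cmod (z * cnj w - 1))\<^sup>2 * fejer_kernel N (z * cnj w))"
        by (simp add: algebra_simps)
      also have "\<dots> \<le> e / 2 * fejer_kernel N (z * cnj w) + C * (4 / real (Suc N))"
        using C w z by (intro add_left_mono mult_left_mono ker) (auto simp: norm_mult)
      finally show "cmod (x w - x z) * fejer_kernel N (z * cnj w) \<le> e / 2 * fejer_kernel N (z * cnj w) + C * (4 / real (Suc N))" .
    qed
    also have "\<dots> = e / 2 + C * (4 / real (Suc N))"
      using mean_fejer_kernel[OF z, of N] mean_mult_left[OF continuous_on_fejer_kernel, of "e / 2" N z]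
      by (subst mean_add) (auto intro!: continuous_intros continuous_on_fejer_kernel)
    finally show ?thesis .
  qed
  obtain N0 where N0: "8 * C / e < real N0" using reals_Archimedean2 by blast
  show ?thesis
  proof (intro exI[of _ N0] allI impI ballI)
    fix N z assume "N0 \<le> N" and z: "z \<in> circle"
    then have "8 * C / e < real (Suc N)" using N0 by linarith
    then have "C * (4 / real (Suc N)) < e / 2" using e C by (simp add: field_simps)
    with est[OF z, of N] show "cmod (fejer_sum x N z - x z) < e" by linarith
  qed
qed

text \<open>Allows Fejer sums to be inserted into \<open>mean_square_distance\<close>; the
  coefficients are those of \<open>x\<close> with Cesaro weights.\<close>

lemma fejer_sum_as_poly:
  "\<exists>a. \<forall>z. fejer_sum x N z = (\<Sum>k\<in>{-int N..int N}. a k * z powi k)"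
proof -
  define a where "a k = (\<Sum>m\<le>N. if \<bar>k\<bar> \<le> int m then fc x k else 0) / of_nat (Suc N)" for k
  have "partial_sum x m z = (\<Sum>k\<in>{-int N..int N}. (if \<bar>k\<bar> \<le> int m then fc x k else 0) * z powi k)"
    if "m \<le> N" for m z
    unfolding partial_sum_def using that
    by (intro sum.mono_neutral_cong_left) auto
  then have "fejer_sum x N z = (\<Sum>k\<in>{-int N..int N}. a k * z powi k)" for z
    by (simp add: fejer_sum_def a_def sum_divide_distrib sum_distrib_right sum.swap[of _ "{..N}"])
  then show ?thesis by blast
qed

text \<open>Completeness: a Fejer sum is a trigonometric polynomial of degree at most
  \<open>N\<close> uniformly close to \<open>x\<close>, so the part of \<open>x\<close> orthogonal
  to such polynomials is arbitrarily small.\<close>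

lemma parseval_le:
  assumes x: "continuous_on circle x" and B: "\<And>m. (\<Sum>k\<in>{-int m..int m}. (cmod (fc x k))\<^sup>2) \<le> B"
  shows "mean (\<lambda>z. (cmod (x z))\<^sup>2) \<le> B"
proof (rule field_le_epsilon)
  fix e :: real assume e: "0 < e"
  then obtain N where N: "\<And>z. z \<in> circle \<Longrightarrow> cmod (fejer_sum x N z - x z) < sqrt e"
    using fejer_sum_uniform[OF x, of "sqrt e"] by (metis order_refl real_sqrt_gt_zero)
  obtain a where a: "\<And>z. fejer_sum x N z = (\<Sum>k\<in>{-int N..int N}. a k * z powi k)"
    using fejer_sum_as_poly by blast
  have "mean (\<lambda>z. (cmod (x z))\<^sup>2) - (\<Sum>k\<in>{-int N..int N}. (cmod (fc x k))\<^sup>2)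
      \<le> mean (\<lambda>z. (cmod (x z - fejer_sum x N z))\<^sup>2)"
    unfolding a by (subst mean_square_distance[OF x]) (auto intro: sum_nonneg)
  also have "\<dots> \<le> e"
  proof (intro mean_le continuous_intros x continuous_on_fejer_sum)
    fix z :: complex assume "z \<in> circle"
    then have "(cmod (x z - fejer_sum x N z))\<^sup>2 \<le> (sqrt e)\<^sup>2"
      using N[of z] by (intro power_mono) (auto simp: norm_minus_commute)
    then show "(cmod (x z - fejer_sum x N z))\<^sup>2 \<le> e" using e by simp
  qed
  finally show "mean (\<lambda>z. (cmod (x z))\<^sup>2) \<le> B + e" using B[of N] by simp
qed

subsection \<open>Dyadic increments and the half-order energy\<close>

text \<open>Symmetric truncations keep all interchanges of sums finite. The terms are nonnegative,
  so a bound uniform in \<open>m\<close> amounts to summability.\<close>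

abbreviation half_energy :: "(complex \<Rightarrow> complex) \<Rightarrow> nat \<Rightarrow> real" where
  "half_energy x m \<equiv> (\<Sum>k\<in>{-int m..int m}. \<bar>of_int k\<bar> * (cmod (fc x k))\<^sup>2)"

definition dyadic_increment :: "(complex \<Rightarrow> complex) \<Rightarrow> nat \<Rightarrow> real" where
  "dyadic_increment x n = mean (\<lambda>z. (cmod (x (cis (pi / 2 ^ n) * z) - x z))\<^sup>2)"

lemma continuous_on_increment:
  fixes x :: "complex \<Rightarrow> complex"
  assumes "continuous_on circle x"
  shows "continuous_on circle (\<lambda>z. x (cis s * z) - x z)"
  using continuous_on_circle_rotate[OF assms, of "cis s"] assms by (intro continuous_on_diff) auto

lemma fc_increment:
  assumes x: "continuous_on circle x"
  shows "fc (\<lambda>z. x (cis s * z) - x z) k = (cis (of_int k * s) - 1) * fc x k"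
proof -
  have "fc (\<lambda>z. x (cis s * z) - x z) k = fc (\<lambda>z. x (cis s * z)) k - fc x k"
    by (intro fc_diff continuous_on_circle_rotate x) simp
  also have "fc (\<lambda>z. x (cis s * z)) k = cis (of_int k * s) * fc x k"
    using fc_rotate[OF x, of "cis s" k] by (simp add: cis_powi)
  finally show ?thesis by (simp add: algebra_simps)
qed

lemma norm_cis_minus_1: "cmod (cis t - 1) = 2 * \<bar>sin (t / 2)\<bar>"
proof -
  have "(cmod (cis t - 1))\<^sup>2 = (cos t - 1)\<^sup>2 + (sin t)\<^sup>2"
    by (simp add: cmod_power2)
  also have "\<dots> = 2 - 2 * cos t" using sin_cos_squared_add[of t] by (simp add: power2_eq_square algebra_simps)
  also have "\<dots> = (2 * \<bar>sin (t / 2)\<bar>)\<^sup>2"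
    using cos_double_sin[of "t / 2"] by (simp add: power_mult_distrib)
  finally show ?thesis by (rule power2_eq_imp_eq) auto
qed

lemma norm_cis_diff: "cmod (cis s - cis t) = 2 * \<bar>sin ((s - t) / 2)\<bar>"
proof -
  have "cis s - cis t = cis t * (cis (s - t) - 1)" by (simp add: algebra_simps cis_mult)
  then show ?thesis by (simp add: norm_mult norm_cis_minus_1)
qed

lemma norm_cis_diff_le: "cmod (cis s - cis t) \<le> \<bar>s - t\<bar>"
  using abs_sin_x_le_abs_x[of "(s - t) / 2"] by (simp add: norm_cis_diff)

text \<open>With \<open>2 ^ m \<le> \<bar>k\<bar> < 2 ^ (m + 1)\<close>, the terms up to
  \<open>m\<close> are at most \<open>4 * 2 ^ n\<close> and sum to at most
  \<open>8 * \<bar>k\<bar>\<close>. Beyond \<open>m\<close> the chord is at most the arc, and the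
  geometric tail is at most \<open>2 * pi\<^sup>2 * \<bar>k\<bar>\<close>.\<close>

lemma dyadic_weight_upper:
  "(\<Sum>n<N. 2 ^ n * (cmod (cis (of_int k * (pi / 2 ^ n)) - 1))\<^sup>2) \<le> (8 + 2 * pi\<^sup>2) * \<bar>of_int k\<bar>"
proof (cases "k = 0")
  case False
  define j where "j = \<bar>real_of_int k\<bar>"
  have j: "1 \<le> j" using False by (simp add: j_def)
  obtain m :: nat where m: "2 ^ m \<le> j" "j < 2 ^ Suc m"
  proof -
    have "\<exists>m::nat. j < 2 ^ m" by (rule real_arch_pow) simp
    then obtain m where m: "j < 2 ^ m" "\<And>i. i < m \<Longrightarrow> \<not> j < 2 ^ i"
      using exists_least_iff[of "\<lambda>m. j < 2 ^ m"] by auto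
    with j have "m \<noteq> 0" by (intro notI) simp
    with m that[of "m - 1"] show ?thesis by (simp add: not_less)
  qed
  define a where "a n = 2 ^ n * (cmod (cis (of_int k * (pi / 2 ^ n)) - 1))\<^sup>2" for n
  have a1: "a n \<le> 4 * 2 ^ n" for n
  proof -
    have "(cmod (cis (of_int k * (pi / 2 ^ n)) - 1))\<^sup>2 \<le> 2\<^sup>2"
      by (intro power_mono) (auto simp: norm_cis_minus_1)
    then show ?thesis by (simp add: a_def)
  qed
  have a2: "a n \<le> pi\<^sup>2 * j\<^sup>2 / 2 ^ n" for n
  proof -
    have "(cmod (cis (of_int k * (pi / 2 ^ n)) - 1))\<^sup>2 \<le> (j * (pi / 2 ^ n))\<^sup>2"
      using norm_cis_diff_le[of "of_int k * (pi / 2 ^ n)" 0]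
      by (intro power_mono) (auto simp: j_def abs_mult)
    then have "a n \<le> 2 ^ n * (j * (pi / 2 ^ n))\<^sup>2" by (simp add: a_def)
    also have "\<dots> = pi\<^sup>2 * j\<^sup>2 / 2 ^ n" by (simp add: power2_eq_square field_simps)
    finally show ?thesis .
  qed
  have s1: "(\<Sum>n\<le>m. a n) \<le> 8 * j"
  proof -
    have "(\<Sum>n\<le>m. a n) \<le> (\<Sum>n\<le>m. 4 * 2 ^ n)" by (intro sum_mono a1)
    also have "\<dots> = 4 * (2 ^ Suc m - 1)"
      by (induction m) auto
    also have "\<dots> \<le> 8 * j" using m by simp
    finally show ?thesis .
  qed
  have s2: "(\<Sum>n\<in>{Suc m..<M}. a n) \<le> 2 * pi\<^sup>2 * j" for M
  proof -
    have "(\<Sum>n\<in>{Suc m..<M}. a n) \<le> (\<Sum>n\<in>{Suc m..<M}. pi\<^sup>2 * j\<^sup>2 * (1 / 2) ^ n)"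
      using a2 by (intro sum_mono) (simp add: power_divide)
    also have "\<dots> = pi\<^sup>2 * j\<^sup>2 * (\<Sum>n\<in>{Suc m..<M}. (1 / 2) ^ n)" by (simp add: sum_distrib_left)
    also have "(\<Sum>n\<in>{Suc m..<M}. (1 / 2::real) ^ n) \<le> (1 / 2) ^ m"
    proof -
      have "(\<Sum>n\<in>{Suc m..<Suc m + i}. (1 / 2::real) ^ n) = (1 / 2) ^ m - (1 / 2) ^ (m + i)" for i
        by (induction i) auto
      from this[of "M - Suc m"] show ?thesis by (cases "Suc m \<le> M") auto
    qed
    also have "pi\<^sup>2 * j\<^sup>2 * (1 / 2) ^ m \<le> 2 * pi\<^sup>2 * j"
    proof -
      have "j * (1 / 2) ^ m \<le> 2" using m by (simp add: power_divide field_simps)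
      then have "pi\<^sup>2 * j * (j * (1 / 2) ^ m) \<le> pi\<^sup>2 * j * 2" using j by (intro mult_left_mono) auto
      then show ?thesis by (simp add: power2_eq_square mult_ac)
    qed
    finally show ?thesis by (simp add: mult_left_mono)
  qed
  have "(\<Sum>n<N. a n) \<le> (\<Sum>n\<in>{..m} \<union> {Suc m..<N}. a n)"
    by (intro sum_mono2) (auto simp: a_def)
  also have "\<dots> = (\<Sum>n\<le>m. a n) + (\<Sum>n\<in>{Suc m..<N}. a n)"
    by (intro sum.union_disjoint) auto
  also have "\<dots> \<le> (8 + 2 * pi\<^sup>2) * j" using s1 s2[of N] by (simp add: algebra_simps)
  finally show ?thesis by (simp add: a_def j_def)
qed simp

text \<open>One scale suffices: for nonzero \<open>k\<close> and the least \<open>m\<close> with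
  \<open>\<bar>k\<bar> < 2 ^ m\<close>, the rotation angle \<open>\<bar>k\<bar> * pi / 2 ^ m\<close>
  lies between \<open>pi / 2\<close> and \<open>pi\<close>, so the chord has length at least
  1.\<close>

lemma dyadic_weight_lower:
  fixes k :: int
  shows "\<exists>n. real_of_int \<bar>k\<bar> \<le> 2 ^ n * (cmod (cis (of_int k * (pi / 2 ^ n)) - 1))\<^sup>2"
proof (cases "k = 0")
  case False
  define j where "j = \<bar>real_of_int k\<bar>"
  have j: "1 \<le> j" using False by (simp add: j_def)
  have "\<exists>m::nat. j < 2 ^ m" by (rule real_arch_pow) simp
  then obtain m where m: "j < 2 ^ m" "\<And>i. i < m \<Longrightarrow> \<not> j < 2 ^ i"
    using exists_least_iff[of "\<lambda>m. j < 2 ^ m"] by auto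
  with j have m0: "m \<noteq> 0" by (intro notI) simp
  then have m1: "2 ^ m \<le> 2 * j" using m(2)[of "m - 1"] by (cases m) (auto simp: not_less)
  define t where "t = j * (pi / 2 ^ m)"
  have "cmod (cis (of_int k * (pi / 2 ^ m)) - 1) = 2 * \<bar>sin (t / 2)\<bar>"
    unfolding norm_cis_minus_1 t_def j_def by (simp add: abs_if)
  moreover have "1 / 2 \<le> sin (t / 2)"
  proof -
    have "pi / 6 \<le> t / 2" "t / 2 \<le> pi / 2"
      using m m1 j by (auto simp: t_def field_simps)
    then have "sin (pi / 6) \<le> sin (t / 2)"
      by (intro sin_monotone_2pi_le) (auto intro: order_trans[of _ 0])
    then show ?thesis by (simp add: sin_30)
  qed
  ultimately have "1 \<le> cmod (cis (of_int k * (pi / 2 ^ m)) - 1)" by simp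
  then have "1 \<le> (cmod (cis (of_int k * (pi / 2 ^ m)) - 1))\<^sup>2" by simp
  then have "2 ^ m * 1 \<le> 2 ^ m * (cmod (cis (of_int k * (pi / 2 ^ m)) - 1))\<^sup>2" by (intro mult_left_mono) auto
  with m(1) show ?thesis unfolding j_def of_int_abs by (intro exI[of _ m]) linarith
qed auto

text \<open>The coefficients of an increment are those of \<open>x\<close> times
  \<open>cis (k * pi / 2 ^ n) - 1\<close>. Parseval and an exchange of the sums over
  \<open>n\<close> and \<open>k\<close> reduce the claim to
  \<open>dyadic_weight_upper\<close>.\<close>

lemma dyadic_increment_le:
  assumes x: "continuous_on circle x"
    and E: "\<And>m. half_energy x m \<le> E"
  shows "(\<Sum>n<N. 2 ^ n * dyadic_increment x n) \<le> (8 + 2 * pi\<^sup>2) * E"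
proof -
  define c where "c n k = (cmod (cis (of_int k * (pi / 2 ^ n)) - 1))\<^sup>2 * (cmod (fc x k))\<^sup>2" for n k
  define P where "P n m = (\<Sum>k\<in>{-int m..int m}. c n k)" for n m
  have c0: "0 \<le> c n k" for n k by (simp add: c_def)
  have Pmono: "P n m \<le> P n m'" if "m \<le> m'" for n m m'
    unfolding P_def using that c0 by (intro sum_mono2) auto
  have bd: "(\<Sum>n<N. 2 ^ n * P n m) \<le> (8 + 2 * pi\<^sup>2) * E" for m
  proof -
    have "(\<Sum>n<N. 2 ^ n * P n m) = (\<Sum>k\<in>{-int m..int m}. (\<Sum>n<N. 2 ^ n * (cmod (cis (of_int k * (pi / 2 ^ n)) - 1))\<^sup>2) * (cmod (fc x k))\<^sup>2)"
      unfolding P_def c_def sum_distrib_left sum_distrib_right by (subst sum.swap) (simp add: mult.assoc)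
    also have "\<dots> \<le> (\<Sum>k\<in>{-int m..int m}. ((8 + 2 * pi\<^sup>2) * \<bar>of_int k\<bar>) * (cmod (fc x k))\<^sup>2)"
      by (intro sum_mono mult_right_mono dyadic_weight_upper) auto
    also have "\<dots> = (8 + 2 * pi\<^sup>2) * half_energy x m"
      by (simp add: sum_distrib_left mult.assoc)
    also have "\<dots> \<le> (8 + 2 * pi\<^sup>2) * E" using E[of m] by (intro mult_left_mono) auto
    finally show ?thesis .
  qed
  have B: "P n m \<le> mean (\<lambda>z. (cmod (x (cis (pi / 2 ^ n) * z) - x z))\<^sup>2)" for n m
    using bessel[OF continuous_on_increment[OF x], of "{-int m..int m}" "pi / 2 ^ n"]
    by (simp add: P_def c_def fc_increment x norm_mult power_mult_distrib)
  \<comment> \<open>The exchange was made for frequencies up to \<open>m\<close> only. Since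
    \<open>n\<close> runs through a finite set, the truncation can be removed by a limit.\<close>
  have conv: "(P n) \<longlonglongrightarrow> (SUP m. P n m)" for n
    using bdd_aboveI2[of UNIV "P n", OF B] by (intro LIMSEQ_incseq_SUP) (auto simp: incseq_def Pmono)
  have D: "dyadic_increment x n \<le> (SUP m. P n m)" for n
    unfolding dyadic_increment_def
  proof (rule parseval_le[OF continuous_on_increment[OF x]])
    fix m
    have "P n m \<le> (SUP m. P n m)" using bdd_aboveI2[of UNIV "P n", OF B] by (intro cSUP_upper) auto
    then show "(\<Sum>k\<in>{-int m..int m}. (cmod (fc (\<lambda>z. x (cis (pi / 2 ^ n) * z) - x z) k))\<^sup>2) \<le> (SUP m. P n m)"
      by (simp add: P_def c_def fc_increment x norm_mult power_mult_distrib)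
  qed
  have "(\<lambda>m. \<Sum>n<N. 2 ^ n * P n m) \<longlonglongrightarrow> (\<Sum>n<N. 2 ^ n * (SUP m. P n m))"
    by (intro tendsto_intros conv)
  then have "(\<Sum>n<N. 2 ^ n * (SUP m. P n m)) \<le> (8 + 2 * pi\<^sup>2) * E"
    by (rule LIMSEQ_le_const2) (use bd in auto)
  moreover have "(\<Sum>n<N. 2 ^ n * dyadic_increment x n) \<le> (\<Sum>n<N. 2 ^ n * (SUP m. P n m))"
    by (intro sum_mono mult_left_mono D) auto
  ultimately show ?thesis by linarith
qed

text \<open>Each frequency \<open>k\<close> is charged to the single scale \<open>\<nu> k\<close>
  where its weight is large; Bessel's inequality then bounds the charges at each scale.\<close>

lemma energy_le_dyadic_increment:
  assumes x: "continuous_on circle x"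
    and E: "\<And>N. (\<Sum>n<N. 2 ^ n * dyadic_increment x n) \<le> E" and K: "finite K"
  shows "(\<Sum>k\<in>K. \<bar>of_int k\<bar> * (cmod (fc x k))\<^sup>2) \<le> E"
proof -
  obtain \<nu> :: "int \<Rightarrow> nat" where \<nu>: "\<And>k. real_of_int \<bar>k\<bar> \<le> 2 ^ \<nu> k * (cmod (cis (of_int k * (pi / 2 ^ \<nu> k)) - 1))\<^sup>2"
    using dyadic_weight_lower by metis
  obtain N where N: "\<And>k. k \<in> K \<Longrightarrow> \<nu> k < N"
    using finite_nat_set_iff_bounded[of "\<nu> ` K"] K by auto
  have "(\<Sum>k\<in>K. \<bar>of_int k\<bar> * (cmod (fc x k))\<^sup>2) \<le>
     (\<Sum>k\<in>K. \<Sum>n<N. 2 ^ n * (cmod (cis (of_int k * (pi / 2 ^ n)) - 1))\<^sup>2 * (cmod (fc x k))\<^sup>2)"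
  proof (rule sum_mono)
    fix k assume k: "k \<in> K"
    have "\<bar>of_int k\<bar> * (cmod (fc x k))\<^sup>2 \<le> 2 ^ \<nu> k * (cmod (cis (of_int k * (pi / 2 ^ \<nu> k)) - 1))\<^sup>2 * (cmod (fc x k))\<^sup>2"
      using \<nu>[of k] by (intro mult_right_mono) auto
    also have "\<dots> \<le> (\<Sum>n<N. 2 ^ n * (cmod (cis (of_int k * (pi / 2 ^ n)) - 1))\<^sup>2 * (cmod (fc x k))\<^sup>2)"
      using N[OF k] by (intro member_le_sum) auto
    finally show "\<bar>of_int k\<bar> * (cmod (fc x k))\<^sup>2 \<le> (\<Sum>n<N. 2 ^ n * (cmod (cis (of_int k * (pi / 2 ^ n)) - 1))\<^sup>2 * (cmod (fc x k))\<^sup>2)" .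
  qed
  also have "\<dots> = (\<Sum>n<N. 2 ^ n * (\<Sum>k\<in>K. (cmod (fc (\<lambda>z. x (cis (pi / 2 ^ n) * z) - x z) k))\<^sup>2))"
    unfolding fc_increment[OF x] norm_mult power_mult_distrib sum_distrib_left
    by (subst sum.swap) (simp add: mult.assoc)
  also have "\<dots> \<le> (\<Sum>n<N. 2 ^ n * dyadic_increment x n)"
    unfolding dyadic_increment_def
    by (intro sum_mono mult_left_mono bessel continuous_on_increment x K) auto
  finally show ?thesis using E[of N] by linarith
qed

section \<open>Description of continuous functions in \<open>W_half\<close>\<close>

lemma fourier_coeff_eq_fc:
  fixes x :: "complex \<Rightarrow> real"
  assumes x: "continuous_on circle x"
  shows "fourier_coeff x k = fc (\<lambda>z. of_real (x z)) k"
proof -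
  have c: "continuous_on circle (\<lambda>z. complex_of_real (x z) * z powi (-k))"
    by (intro continuous_intros x)
  have e: "exp (- \<i> * of_int k * of_real t) = cis t powi (-k)" for t
    unfolding cis_power_int by (simp add: cis_conv_exp mult_ac)
  have "set_integrable lebesgue {0..2 * pi} (\<lambda>t. complex_of_real (x (cis t)) * cis t powi (-k))"
    by (intro absolutely_integrable_continuous_real continuous_on_circle_cis[OF c])
  from set_lebesgue_integral_eq_integral(2)[OF this]
  show ?thesis unfolding fourier_coeff_def fc_def mean_def e by (simp add: scaleR_conv_of_real)
qed

text \<open>Unconditional summability of nonnegative terms needs a bound over all finite sets of
  frequencies, and each of these lies in a symmetric interval.\<close>

lemma W_half_iff:
  fixes x :: "complex \<Rightarrow> real"
  assumes x: "continuous_on circle x"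
  shows "x \<in> W_half \<longleftrightarrow> (\<exists>E. \<forall>m. half_energy (\<lambda>z. of_real (x z)) m \<le> E)"
    (is "_ \<longleftrightarrow> (\<exists>E. \<forall>m. ?S m \<le> E)")
proof
  assume "x \<in> W_half"
  then have s: "(\<lambda>k. \<bar>of_int k\<bar> * (cmod (fc (\<lambda>z. of_real (x z)) k))\<^sup>2) summable_on UNIV"
    by (simp add: W_half_def fourier_coeff_eq_fc x mult.commute)
  show "\<exists>E. \<forall>m. ?S m \<le> E"
    using finite_sum_le_infsum[OF s] by (intro exI allI) auto
next
  assume "\<exists>E. \<forall>m. ?S m \<le> E"
  then obtain E where E: "\<And>m. ?S m \<le> E" by blast
  have "(\<lambda>k. \<bar>of_int k\<bar> * (cmod (fc (\<lambda>z. of_real (x z)) k))\<^sup>2) summable_on UNIV"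
  proof (rule nonneg_bdd_above_summable_on)
    show "bdd_above (sum (\<lambda>k. \<bar>of_int k\<bar> * (cmod (fc (\<lambda>z. of_real (x z)) k))\<^sup>2) ` {F. F \<subseteq> UNIV \<and> finite F})"
    proof (rule bdd_aboveI2)
      fix F :: "int set" assume "F \<in> {F. F \<subseteq> UNIV \<and> finite F}"
      then have F: "finite F" by simp
      then obtain b where b: "\<And>k. k \<in> F \<Longrightarrow> \<bar>k\<bar> \<le> b" 
        using Max_ge[of "abs ` F"] by blast
      have "F \<subseteq> {-int (nat b)..int (nat b)}"
      proof
        fix k assume "k \<in> F" with b[of k] show "k \<in> {-int (nat b)..int (nat b)}" by auto
      qed
      then have "(\<Sum>k\<in>F. \<bar>of_int k\<bar> * (cmod (fc (\<lambda>z. of_real (x z)) k))\<^sup>2) \<le> ?S (nat b)"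
        by (intro sum_mono2) auto
      then show "(\<Sum>k\<in>F. \<bar>of_int k\<bar> * (cmod (fc (\<lambda>z. of_real (x z)) k))\<^sup>2) \<le> E"
        using E[of "nat b"] by linarith
    qed
  qed auto
  moreover have "set_integrable lebesgue {0..2 * pi} (\<lambda>t. x (cis t))"
    by (intro absolutely_integrable_continuous_real continuous_on_circle_cis[OF x])
  ultimately show "x \<in> W_half"
    by (simp add: W_half_def fourier_coeff_eq_fc x mult.commute)
qed

subsection \<open>Variation sums and test functions detecting variation\<close>

text \<open>A relation between endpoints and attainable sums, so that no supremum has to exist when
  the variation is infinite. Repeated points are allowed, which spares degenerate cases in
  concatenation and splitting.\<close>

inductive variation_sum :: "(real \<Rightarrow> real) \<Rightarrow> real \<Rightarrow> real \<Rightarrow> real \<Rightarrow> bool" for f a where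
  empty: "variation_sum f a a 0"
| snoc: "variation_sum f a b s \<Longrightarrow> b \<le> c \<Longrightarrow> variation_sum f a c (s + \<bar>f c - f b\<bar>)"

lemma variation_sum_le: "variation_sum f a b s \<Longrightarrow> a \<le> b"
  by (induction rule: variation_sum.induct) auto

lemma variation_sum_single: "a \<le> b \<Longrightarrow> variation_sum f a b \<bar>f b - f a\<bar>"
  using snoc[OF empty, of a b f] by simp

lemma variation_sum_trivial: "variation_sum f a b s \<Longrightarrow> b \<le> a \<Longrightarrow> s = 0"
proof (induction rule: variation_sum.induct)
  case (snoc b s c)
  then have "b = a" "c = a" using variation_sum_le[of f a b s] by auto
  with snoc show ?case by simp
qed simp

lemma variation_sum_concat:
  assumes "variation_sum f b c s'" "variation_sum f a b s"
  shows "variation_sum f a c (s + s')"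
  using assms(1)
proof (induction rule: variation_sum.induct)
  case empty
  then show ?case using assms(2) by simp
next
  case (snoc c s' d)
  then show ?case using variation_sum.snoc[of f a c "s + s'" d] by (simp add: add.assoc)
qed

text \<open>Inserting \<open>m\<close> into the partition can only increase the sum, by the triangle
  inequality; hence an inequality and not an equality.\<close>

lemma variation_sum_split:
  assumes "variation_sum f a b s" "a \<le> m" "m \<le> b"
  shows "\<exists>s1 s2. variation_sum f a m s1 \<and> variation_sum f m b s2 \<and> s \<le> s1 + s2"
  using assms
proof (induction rule: variation_sum.induct)
  case empty
  then show ?case by (auto intro!: exI[of _ 0] variation_sum.empty)
next
  case (snoc b s c)
  show ?case
  proof (cases "m \<le> b")
    case True
    then obtain s1 s2 where "variation_sum f a m s1" "variation_sum f m b s2" "s \<le> s1 + s2"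
      using snoc by blast
    then show ?thesis using variation_sum.snoc[of f m b s2 c] snoc.hyps
      by (intro exI[of _ s1] exI[of _ "s2 + \<bar>f c - f b\<bar>"]) auto
  next
    case False
    then show ?thesis
      using variation_sum.snoc[of f a b s m] snoc variation_sum_single[of m c f]
      by (intro exI[of _ "s + \<bar>f m - f b\<bar>"] exI[of _ "\<bar>f c - f m\<bar>"]) auto
  qed
qed

text \<open>Only the last nondegenerate interval ends at \<open>b\<close>, and its increment depends
  continuously on the endpoint.\<close>

lemma variation_sum_left_limit:
  assumes "variation_sum f a b s" "continuous_on UNIV f" "0 < e"
  shows "\<exists>d>0. \<forall>t. b - d < t \<and> t \<le> b \<and> a \<le> t \<longrightarrow> (\<exists>s'\<ge>s - e. variation_sum f a t s')"
  using assms
proof (induction rule: variation_sum.induct)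
  case empty
  have "variation_sum f a t 0" if "a \<le> t" "t \<le> a" for t
    using that variation_sum.empty[of f a] by simp
  then show ?case using empty by - (rule exI[of _ "1::real"], auto intro!: exI[of _ "0::real"])
next
  case (snoc b s c)
  show ?case
  proof (cases "b = c")
    case True
    with snoc show ?thesis by simp
  next
    case False
    have "isCont f c" using snoc.prems(1) by (simp add: continuous_on_eq_continuous_at)
    then obtain d where d: "d > 0" "\<And>t. \<bar>t - c\<bar> < d \<Longrightarrow> \<bar>f t - f c\<bar> < e"
      using snoc.prems(2) unfolding continuous_at_eps_delta dist_real_def by blast
    show ?thesis
    proof (rule exI[of _ "min d (c - b)"], intro conjI allI impI)
      fix t assume t: "c - min d (c - b) < t \<and> t \<le> c \<and> a \<le> t"
      then have "variation_sum f a t (s + \<bar>f t - f b\<bar>)"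
        by (intro variation_sum.snoc snoc.hyps) auto
      moreover have "\<bar>f t - f c\<bar> < e" using d t by auto
      ultimately show "\<exists>s'\<ge>s + \<bar>f c - f b\<bar> - e. variation_sum f a t s'"
        by (intro exI[of _ "s + \<bar>f t - f b\<bar>"]) auto
    qed (use d False snoc.hyps in auto)
  qed
qed

text \<open>Partitions grow at the right end, so the first nondegenerate interval is met in the
  induction step with \<open>a = b\<close>; there continuity of \<open>f\<close> at \<open>a\<close>
  is used, and later steps only carry the estimate along.\<close>

lemma variation_sum_right_limit:
  assumes "variation_sum f a b s" "continuous_on UNIV f" "0 < e"
  shows "\<exists>d>0. \<forall>t. a \<le> t \<and> t < a + d \<and> t \<le> b \<longrightarrow> (\<exists>s'\<ge>s - e. variation_sum f t b s')"
  using assms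
proof (induction rule: variation_sum.induct)
  case empty
  have "variation_sum f t a 0" if "a \<le> t" "t \<le> a" for t
    using that variation_sum.empty[of f a] by simp
  then show ?case using empty by - (rule exI[of _ "1::real"], auto intro!: exI[of _ "0::real"])
next
  case (snoc b s c)
  show ?case
  proof (cases "a = b")
    case True
    with snoc.hyps have s: "s = 0" by (auto dest: variation_sum_trivial)
    have "isCont f a" using snoc.prems(1) by (simp add: continuous_on_eq_continuous_at)
    then obtain d where d: "d > 0" "\<And>t. \<bar>t - a\<bar> < d \<Longrightarrow> \<bar>f t - f a\<bar> < e"
      using snoc.prems(2) unfolding continuous_at_eps_delta dist_real_def by blast
    show ?thesis
    proof (rule exI[of _ d], intro conjI allI impI)
      fix t assume t: "a \<le> t \<and> t < a + d \<and> t \<le> c"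
      then have "\<bar>f t - f a\<bar> < e" using d by auto
      with t True s show "\<exists>s'\<ge>s + \<bar>f c - f b\<bar> - e. variation_sum f t c s'"
        by (intro exI[of _ "\<bar>f c - f t\<bar>"] conjI variation_sum_single) auto
    qed (use d in auto)
  next
    case False
    then have ab: "a < b" using variation_sum_le[OF snoc.hyps(1)] by simp
    obtain d where d: "d > 0" "\<And>t. a \<le> t \<and> t < a + d \<and> t \<le> b \<Longrightarrow> \<exists>s'\<ge>s - e. variation_sum f t b s'"
      using snoc.IH snoc.prems by blast
    show ?thesis
    proof (rule exI[of _ "min d (b - a)"], intro conjI allI impI)
      fix t assume t: "a \<le> t \<and> t < a + min d (b - a) \<and> t \<le> c"
      then have "t < a + d \<and> t \<le> b" by linarith
      with t obtain s' where "s' \<ge> s - e" "variation_sum f t b s'" using d(2)[of t] by auto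
      then show "\<exists>s'\<ge>s + \<bar>f c - f b\<bar> - e. variation_sum f t c s'"
        using variation_sum.snoc[of f t b s' c] snoc.hyps by (intro exI[of _ "s' + \<bar>f c - f b\<bar>"]) auto
    qed (use d ab in auto)
  qed
qed

section \<open>Disjoint intervals of large variation\<close>

definition unbounded_variation :: "(real \<Rightarrow> real) \<Rightarrow> real \<Rightarrow> real \<Rightarrow> bool" where
  "unbounded_variation f a b \<longleftrightarrow> (\<forall>B. \<exists>s\<ge>B. variation_sum f a b s)"

lemma unbounded_variation_le: "unbounded_variation f a b \<Longrightarrow> a \<le> b"
  unfolding unbounded_variation_def using variation_sum_le by blast

text \<open>Otherwise every \<open>m\<close> has variation at most \<open>M\<close> on one of its
  sides. At the supremum \<open>c\<close> of the points with small variation on the left, continuity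
  of \<open>f\<close> makes both sides small, so the total would be at most
  \<open>2 * M\<close>.\<close>

lemma unbounded_variation_split:
  assumes f: "continuous_on UNIV f" and U: "unbounded_variation f a b"
  shows "\<exists>m\<in>{a..b}. (unbounded_variation f a m \<and> (\<exists>s\<ge>M. variation_sum f m b s)) \<or>
           (unbounded_variation f m b \<and> (\<exists>s\<ge>M. variation_sum f a m s))"
proof (rule ccontr)
  assume neg: "\<not> ?thesis"
  define P where "P m \<longleftrightarrow> (\<forall>s. variation_sum f a m s \<longrightarrow> s \<le> M)" for m
  define Q where "Q m \<longleftrightarrow> (\<forall>s. variation_sum f m b s \<longrightarrow> s \<le> M)" for m
  have ab: "a \<le> b" using U by (rule unbounded_variation_le)
  have un: "unbounded_variation f a m \<or> unbounded_variation f m b" if m: "m \<in> {a..b}" for m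
  proof (rule ccontr)
    assume "\<not> ?thesis"
    then obtain B1 B2 where B: "\<And>s. variation_sum f a m s \<Longrightarrow> s < B1" "\<And>s. variation_sum f m b s \<Longrightarrow> s < B2"
      unfolding unbounded_variation_def by (meson not_le)
    obtain s where s: "variation_sum f a b s" "s \<ge> B1 + B2"
      using U unfolding unbounded_variation_def by blast
    obtain s1 s2 where "variation_sum f a m s1" "variation_sum f m b s2" "s \<le> s1 + s2"
      using variation_sum_split[OF s(1), of m] m by auto
    with s B show False by force
  qed
  \<comment> \<open>One side of \<open>m\<close> has unbounded variation, and then the negated claim
    bounds every sum on the other side.\<close>
  have PQ: "P m \<or> Q m" if "m \<in> {a..b}" for m
    using un[OF that] neg that unfolding P_def Q_def by (meson le_cases)
  have notP: "\<not> P b" and notQ: "\<not> Q a"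
    using U unfolding unbounded_variation_def P_def Q_def by (meson not_le less_add_one order_less_le_trans)+
  define S where "S = {m\<in>{a..b}. P m}"
  have aS: "a \<in> S" using PQ[of a] notQ ab by (auto simp: S_def)
  have bdd: "bdd_above S" by (auto simp: S_def)
  define c where "c = Sup S"
  have c: "a \<le> c" "c \<le> b"
    using aS bdd by (auto simp: c_def S_def intro!: cSup_upper cSup_least)
  \<comment> \<open>Points of \<open>S\<close> come arbitrarily close to \<open>c\<close> from the
    left, and a sum up to \<open>c\<close> survives a small shortening up to the loss
    \<open>e\<close>.\<close>
  have Pc: "s \<le> M" if s: "variation_sum f a c s" for s
  proof (rule field_le_epsilon)
    fix e :: real assume "0 < e"
    then obtain d where d: "d > 0" "\<And>t. c - d < t \<and> t \<le> c \<and> a \<le> t \<Longrightarrow> \<exists>s'\<ge>s - e. variation_sum f a t s'"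
      using variation_sum_left_limit[OF s f] by blast
    obtain t where t: "t \<in> S" "c - d < t"
      using less_cSup_iff[of S "c - d"] aS bdd d(1) unfolding c_def by auto
    then have "t \<le> c" unfolding c_def by (intro cSup_upper bdd)
    with d(2)[of t] t obtain s' where "s' \<ge> s - e" "variation_sum f a t s'" by (auto simp: S_def)
    with t show "s \<le> M + e" by (auto simp: S_def P_def)
  qed
  then have cb: "c < b" using notP c by (cases "c = b") (auto simp: P_def)
  have Qc: "s \<le> M" if s: "variation_sum f c b s" for s
  proof (rule field_le_epsilon)
    fix e :: real assume "0 < e"
    then obtain d where d: "d > 0" "\<And>t. c \<le> t \<and> t < c + d \<and> t \<le> b \<Longrightarrow> \<exists>s'\<ge>s - e. variation_sum f t b s'"
      using variation_sum_right_limit[OF s f] by blast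
    \<comment> \<open>Points slightly to the right of \<open>c\<close> are outside \<open>S\<close>,
      hence satisfy \<open>Q\<close>; this passes to \<open>c\<close> in the limit.\<close>
    define t where "t = min b (c + d / 2)"
    have t: "c < t" "t \<le> b" "t < c + d" using d cb by (auto simp: t_def)
    then have "t \<notin> S" using cSup_upper[OF _ bdd, of t] by (auto simp: c_def)
    then have "Q t" using PQ[of t] t c by (auto simp: S_def)
    moreover obtain s' where "s' \<ge> s - e" "variation_sum f t b s'" using d(2)[of t] t by auto
    ultimately show "s \<le> M + e" by (auto simp: Q_def)
  qed
  obtain s where s: "variation_sum f a b s" "s \<ge> M + M + 1"
    using U unfolding unbounded_variation_def by blast
  obtain s1 s2 where "variation_sum f a c s1" "variation_sum f c b s2" "s \<le> s1 + s2"
    using variation_sum_split[OF s(1) c] by auto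
  with Pc[of s1] Qc[of s2] s(2) show False by linarith
qed

text \<open>Iteration of the splitting: at each stage one part is cut off as a block and the part of
  unbounded variation is split again.\<close>

lemma unbounded_variation_blocks:
  assumes f: "continuous_on UNIV f" and U: "unbounded_variation f a b"
  shows "\<exists>p q. (\<forall>n::nat. a \<le> p n \<and> p n \<le> q n \<and> q n \<le> b \<and> (\<exists>s\<ge>M n. variation_sum f (p n) (q n) s)) \<and>
           (\<forall>n k. n \<noteq> k \<longrightarrow> q n \<le> p k \<or> q k \<le> p n)"
proof -
  \<comment> \<open>In a state \<open>(x, y, p, q)\<close> the interval from \<open>x\<close> to
    \<open>y\<close> is what remains to be split, and \<open>p\<close>, \<open>q\<close> bound the
    block just cut off outside it.\<close>
  define P where "P n r \<longleftrightarrow> (case r of (x, y, p, q) \<Rightarrow> unbounded_variation f x y \<and> a \<le> x \<and> y \<le> b \<and> a \<le> p \<and> p \<le> q \<and> q \<le> b \<and>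
      (\<exists>s\<ge>M n. variation_sum f p q s) \<and> (q \<le> x \<or> y \<le> p))" for n :: nat and r :: "real \<times> real \<times> real \<times> real"
  define Q where "Q r r' \<longleftrightarrow> (case (r, r') of ((x, y, p, q), (x', y', p', q')) \<Rightarrow>
      x \<le> x' \<and> y' \<le> y \<and> x \<le> p' \<and> q' \<le> y)" for r r' :: "real \<times> real \<times> real \<times> real"
  have step: "\<exists>r. P n r \<and> (case r of (x', y', p', q') \<Rightarrow> x \<le> x' \<and> y' \<le> y \<and> x \<le> p' \<and> q' \<le> y)"
    if xy: "unbounded_variation f x y" "a \<le> x" "y \<le> b" for x y n
  proof -
    obtain m where m: "m \<in> {x..y}" and c: "(unbounded_variation f x m \<and> (\<exists>s\<ge>M n. variation_sum f m y s)) \<or>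
           (unbounded_variation f m y \<and> (\<exists>s\<ge>M n. variation_sum f x m s))"
      using unbounded_variation_split[OF f xy(1)] by blast
    from c show ?thesis
    proof
      assume "unbounded_variation f x m \<and> (\<exists>s\<ge>M n. variation_sum f m y s)"
      then show ?thesis using m xy by (intro exI[of _ "(x, m, m, y)"]) (auto simp: P_def)
    next
      assume "unbounded_variation f m y \<and> (\<exists>s\<ge>M n. variation_sum f x m s)"
      then show ?thesis using m xy by (intro exI[of _ "(m, y, x, m)"]) (auto simp: P_def)
    qed
  qed
  have "\<exists>r. P 0 r" using step[OF U, of 0] by auto
  moreover have "\<exists>r'. P (Suc n) r' \<and> Q r r'" if "P n r" for n r
    using that step[of "fst r" "fst (snd r)" "Suc n"] by (auto simp: P_def Q_def split: prod.splits)
  ultimately obtain r where r: "\<And>n. P n (r n)" "\<And>n. Q (r n) (r (Suc n))"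
    using dependent_nat_choice[of P "\<lambda>_. Q"] by blast
  define x y p q where "x n = fst (r n)" and "y n = fst (snd (r n))" and "p n = fst (snd (snd (r n)))"
    and "q n = snd (snd (snd (r n)))" for n
  have rn: "r n = (x n, y n, p n, q n)" for n by (simp add: x_def y_def p_def q_def)
  have 1: "a \<le> p n" "p n \<le> q n" "q n \<le> b" "\<exists>s\<ge>M n. variation_sum f (p n) (q n) s" "q n \<le> x n \<or> y n \<le> p n" for n
    using r(1)[of n] by (auto simp: rn P_def)
  have 2: "x n \<le> x (Suc n)" "y (Suc n) \<le> y n" "x n \<le> p (Suc n)" "q (Suc n) \<le> y n" for n
    using r(2)[of n] by (auto simp: rn Q_def)
  have 3: "x n \<le> x k" "y k \<le> y n" if "n \<le> k" for n k
    using that 2 by (auto intro: lift_Suc_mono_le[of x] lift_Suc_antimono_le[of y])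
  \<comment> \<open>Block \<open>k = Suc j\<close> lies in the interval left after stage
    \<open>j\<close>, hence in the one left after stage \<open>n\<close>; block \<open>n\<close>
    lies outside that one.\<close>
  have "q n \<le> p k \<or> q k \<le> p n" if "n < k" for n k
  proof -
    obtain j where j: "k = Suc j" "n \<le> j" using \<open>n < k\<close> by (cases k) auto
    show ?thesis using 1(5)[of n] 2(3,4)[of j] 3[OF j(2)] j(1) by auto
  qed
  with 1 show ?thesis by (intro exI[of _ p] exI[of _ q]) (metis linorder_neqE_nat)
qed

section \<open>Test functions whose integral against a derivative detects variation\<close>

text \<open>The second mean value theorem: \<open>W\<close> need only be monotone, which is the
  property that survives an arbitrary increasing change of variable.\<close>

lemma integral_deriv_times_mono:
  fixes Y Y' W :: "real \<Rightarrow> real"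
  assumes Y: "\<And>t. (Y has_real_derivative Y' t) (at t)" and ab: "a \<le> b"
    and W: "\<And>s t. a \<le> s \<Longrightarrow> s \<le> t \<Longrightarrow> t \<le> b \<Longrightarrow> W s \<le> W t"
  shows "\<exists>c\<in>{a..b}. ((\<lambda>t. Y' t * W t) has_integral (W a * (Y c - Y a) + W b * (Y b - Y c))) {a..b}"
proof -
  have ftc: "(Y' has_integral Y v - Y u) {u..v}" if "u \<le> v" for u v
    using that Y by (intro fundamental_theorem_of_calculus)
      (auto simp: has_real_derivative_iff_has_vector_derivative intro: has_vector_derivative_at_within)
  obtain c where c: "c \<in> {a..b}" "((\<lambda>x. W x * Y' x) has_integral (W a * integral {a..c} Y' + W b * integral {c..b} Y')) {a..b}"
    by (rule second_mean_value_theorem_full[of Y' a b W]) (use ftc[OF ab] ab W in \<open>auto simp: has_integral_integrable\<close>)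
  then show ?thesis
    using ftc[of a c] ftc[of c b] by (intro bexI[of _ c]) (auto simp: integral_unique mult.commute)
qed

text \<open>The rising, flat and falling parts contribute increments of \<open>Y\<close> that
  telescope to \<open>h * (Y v - Y u)\<close>, with \<open>u\<close> on the rising and
  \<open>v\<close> on the falling ramp.\<close>

lemma integral_deriv_times_trapezoid:
  fixes Y Y' W :: "real \<Rightarrow> real"
  assumes Y: "\<And>t. (Y has_real_derivative Y' t) (at t)" and abcd: "a \<le> b" "b \<le> c" "c \<le> d"
    and incr: "\<And>s t. a \<le> s \<Longrightarrow> s \<le> t \<Longrightarrow> t \<le> b \<Longrightarrow> W s \<le> W t"
    and flat: "\<And>t. b \<le> t \<Longrightarrow> t \<le> c \<Longrightarrow> W t = h"
    and decr: "\<And>s t. c \<le> s \<Longrightarrow> s \<le> t \<Longrightarrow> t \<le> d \<Longrightarrow> W t \<le> W s"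
    and ends: "W a = 0" "W d = 0"
    and \<alpha>: "\<And>t. a \<le> t \<Longrightarrow> t \<le> b \<Longrightarrow> \<bar>Y t - \<alpha>\<bar> \<le> \<kappa>" and \<beta>: "\<And>t. c \<le> t \<Longrightarrow> t \<le> d \<Longrightarrow> \<bar>Y t - \<beta>\<bar> \<le> \<kappa>"
  shows "\<exists>I\<ge>h * (\<beta> - \<alpha> - 2 * \<kappa>). ((\<lambda>t. Y' t * W t) has_integral I) {a..d}"
proof -
  obtain u where u: "u \<in> {a..b}" "((\<lambda>t. Y' t * W t) has_integral (W a * (Y u - Y a) + W b * (Y b - Y u))) {a..b}"
    using integral_deriv_times_mono[OF Y abcd(1), of W] incr by blast
  obtain m where m: "((\<lambda>t. Y' t * W t) has_integral (W b * (Y m - Y b) + W c * (Y c - Y m))) {b..c}"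
    using integral_deriv_times_mono[OF Y abcd(2), of W] flat by auto
  obtain v where v: "v \<in> {c..d}" "((\<lambda>t. Y' t * - W t) has_integral (- W c * (Y v - Y c) + - W d * (Y d - Y v))) {c..d}"
    using integral_deriv_times_mono[OF Y abcd(3), of "\<lambda>t. - W t"] decr by auto
  have h: "W b = h" "W c = h" using flat abcd by auto
  have h0: "0 \<le> h" using incr[of a b] abcd ends h by auto
  have "((\<lambda>t. Y' t * W t) has_integral (h * (Y b - Y u) + h * (Y c - Y b))) {a..c}"
    using has_integral_combine[OF abcd(1,2) u(2) m] ends h by (simp add: algebra_simps)
  moreover have "((\<lambda>t. Y' t * W t) has_integral (h * (Y v - Y c))) {c..d}"
    using has_integral_neg[OF v(2)] ends h by simp
  ultimately have "((\<lambda>t. Y' t * W t) has_integral (h * (Y b - Y u) + h * (Y c - Y b) + h * (Y v - Y c))) {a..d}"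
    using abcd by (intro has_integral_combine[of a c d]) auto
  moreover have "h * (\<beta> - \<alpha> - 2 * \<kappa>) \<le> h * (Y v - Y u)"
    using \<alpha>[of u] \<beta>[of v] u v h0 by (intro mult_left_mono) auto
  ultimately show ?thesis by (intro exI[of _ "h * (Y b - Y u) + h * (Y c - Y b) + h * (Y v - Y c)"]) (auto simp: algebra_simps)
qed

text \<open>The lower bound is invariant under the change of variable \<open>\<psi>\<close> and stable under perturbations of
  \<open>f\<close> and under odd monotone maps applied to \<open>w\<close>.\<close>

definition detects_variation :: "(real \<Rightarrow> real) \<Rightarrow> (real \<Rightarrow> real) \<Rightarrow> real \<Rightarrow> real \<Rightarrow> real \<Rightarrow> real \<Rightarrow> bool" where
  "detects_variation f w p q c K \<longleftrightarrow> (\<forall>\<psi> Y Y' \<theta> W \<kappa>.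
     strict_mono_on {p..q} \<psi> \<and> continuous_on {p..q} \<psi> \<and> (\<forall>t. (Y has_real_derivative Y' t) (at t)) \<and>
     mono \<theta> \<and> (\<forall>x. \<theta> (- x) = - \<theta> x) \<and> (\<forall>x\<in>{p..q}. W (\<psi> x) = \<theta> (w x)) \<and>
     (\<forall>x\<in>{p..q}. \<bar>Y (\<psi> x) - f x\<bar> \<le> \<kappa>) \<longrightarrow>
     (\<exists>I\<ge>\<theta> 1 * (c - K * \<kappa>). ((\<lambda>t. Y' t * W t) has_integral I) {\<psi> p..\<psi> q}))"

text \<open>The witness is a trapezoid of height 1, with the sign of \<open>f c - f b\<close> and
  ramps so short that \<open>f\<close> moves by less than \<open>e / 2\<close> on each. The constant
  2 counts one error \<open>\<kappa>\<close> per ramp.\<close>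

lemma trapezoid_detects_variation:
  assumes f: "continuous_on UNIV f" and bc: "b < c" and e: "0 < e"
  shows "\<exists>w. continuous_on UNIV w \<and> (\<forall>x. \<bar>w x\<bar> \<le> 1) \<and> (\<forall>x. x \<notin> {b<..<c} \<longrightarrow> w x = 0) \<and>
           detects_variation f w b c (\<bar>f c - f b\<bar> - e) 2"
proof -
  have abs\<sigma>: "\<bar>u - v\<bar> \<le> e / 2 + k" if "\<bar>u - x\<bar> \<le> k" "\<bar>x - v\<bar> < e / 2" for u v x k :: real
    using that by linarith
  have "isCont f b" "isCont f c" using f by (simp_all add: continuous_on_eq_continuous_at)
  then obtain d1 d2 where d1: "d1 > 0" "\<And>t. \<bar>t - b\<bar> < d1 \<Longrightarrow> \<bar>f t - f b\<bar> < e / 2"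
    and d2: "d2 > 0" "\<And>t. \<bar>t - c\<bar> < d2 \<Longrightarrow> \<bar>f t - f c\<bar> < e / 2"
    using e unfolding continuous_at_eps_delta dist_real_def by (metis half_gt_zero)
  \<comment> \<open>The halves make the ramps strictly shorter than the continuity radii, since
    ramps are closed intervals; the last entry keeps the two ramps from overlapping.\<close>
  define d where "d = min (min (d1 / 2) (d2 / 2)) ((c - b) / 2)"
  have d: "d > 0" "d < d1" "d < d2" "b + d \<le> c - d" using d1 d2 bc by (auto simp: d_def min_def field_simps)
  define \<sigma> :: real where "\<sigma> = (if f c \<ge> f b then 1 else -1)"
  define \<tau> where "\<tau> x = max 0 (min 1 (min ((x - b) / d) ((c - x) / d)))" for x
  define w where "w x = \<sigma> * \<tau> x" for x
  have \<tau>: "0 \<le> \<tau> x" "\<tau> x \<le> 1" for x by (auto simp: \<tau>_def)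
  have \<tau>_out: "\<tau> x = 0" if "x \<notin> {b<..<c}" for x
  proof -
    have "(x - b) / d \<le> 0 \<or> (c - x) / d \<le> 0" using that d(1) by (auto simp: divide_simps)
    then show ?thesis by (auto simp: \<tau>_def)
  qed
  have \<tau>1: "\<tau> x = (x - b) / d" if "b \<le> x" "x \<le> b + d" for x
  proof -
    have "0 \<le> (x - b) / d" "(x - b) / d \<le> 1" "1 \<le> (c - x) / d" using that d by (auto simp: divide_simps)
    then show ?thesis by (auto simp: \<tau>_def)
  qed
  have \<tau>2: "\<tau> x = 1" if "b + d \<le> x" "x \<le> c - d" for x
  proof -
    have "1 \<le> (x - b) / d" "1 \<le> (c - x) / d" using that d by (auto simp: divide_simps)
    then show ?thesis by (auto simp: \<tau>_def)
  qed
  have \<tau>3: "\<tau> x = (c - x) / d" if "c - d \<le> x" "x \<le> c" for x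
  proof -
    have "0 \<le> (c - x) / d" "(c - x) / d \<le> 1" "1 \<le> (x - b) / d" using that d by (auto simp: divide_simps)
    then show ?thesis by (auto simp: \<tau>_def)
  qed
  have det: "detects_variation f w b c (\<bar>f c - f b\<bar> - e) 2"
    unfolding detects_variation_def
  proof (intro allI impI, elim conjE)
    fix \<psi> Y Y' \<theta> W :: "real \<Rightarrow> real" and \<kappa> :: real
    assume \<psi>: "strict_mono_on {b..c} \<psi>" "continuous_on {b..c} \<psi>" and Y: "\<forall>t. (Y has_real_derivative Y' t) (at t)"
      and \<theta>: "mono \<theta>" "\<forall>x. \<theta> (- x) = - \<theta> x" and W: "\<forall>x\<in>{b..c}. W (\<psi> x) = \<theta> (w x)"
      and \<kappa>: "\<forall>x\<in>{b..c}. \<bar>Y (\<psi> x) - f x\<bar> \<le> \<kappa>"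
    have \<theta>0: "\<theta> 0 = 0" using \<theta>(2)[rule_format, of 0] by simp
    have \<sigma>\<theta>: "\<sigma> * \<theta> (\<sigma> * x) = \<theta> x" for x using \<theta>(2) by (simp add: \<sigma>_def)
    have mono: "\<psi> u \<le> \<psi> v \<longleftrightarrow> u \<le> v" if "u \<in> {b..c}" "v \<in> {b..c}" for u v
      using \<psi>(1) that by (simp add: strict_mono_on_less_eq)
    have sur: "\<exists>x. u \<le> x \<and> x \<le> v \<and> t = \<psi> x" if "b \<le> u" "u \<le> v" "v \<le> c" "\<psi> u \<le> t" "t \<le> \<psi> v" for u v t
      using IVT'[of \<psi> u t v] that continuous_on_subset[OF \<psi>(2), of "{u..v}"] by auto
    \<comment> \<open>The sign is removed from \<open>W\<close> and put on \<open>Y\<close> instead;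
      as \<open>\<theta>\<close> is odd, \<open>V\<close> is an upright trapezoid with heights
      transformed by \<open>\<theta>\<close>.\<close>
    define V where "V t = \<sigma> * W t" for t
    have V: "V (\<psi> x) = \<theta> (\<tau> x)" if "x \<in> {b..c}" for x
      using W that \<sigma>\<theta> by (simp add: V_def w_def)
    have "\<exists>I\<ge>\<theta> 1 * (\<sigma> * f c - \<sigma> * f b - 2 * (e / 2 + \<kappa>)). ((\<lambda>t. \<sigma> * Y' t * V t) has_integral I) {\<psi> b..\<psi> c}"
    proof (rule integral_deriv_times_trapezoid[where Y="\<lambda>t. \<sigma> * Y t" and b = "\<psi> (b + d)" and c = "\<psi> (c - d)"])
      show "((\<lambda>t. \<sigma> * Y t) has_real_derivative \<sigma> * Y' t) (at t)" for t
        using Y by (intro DERIV_cmult) auto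
      show "\<psi> b \<le> \<psi> (b + d)" "\<psi> (b + d) \<le> \<psi> (c - d)" "\<psi> (c - d) \<le> \<psi> c"
        using mono d bc by auto
      show "V (\<psi> b) = 0" "V (\<psi> c) = 0" using V \<tau>_out bc \<theta>0 by auto
    next
      fix s t assume st: "\<psi> b \<le> s" "s \<le> t" "t \<le> \<psi> (b + d)"
      obtain x where x: "b \<le> x" "x \<le> b + d" "t = \<psi> x" using sur[of b "b + d" t] st d by auto
      obtain y where y: "b \<le> y" "y \<le> x" "s = \<psi> y" using sur[of b x s] st d x by auto
      have "\<tau> y \<le> \<tau> x" using \<tau>1[of x] \<tau>1[of y] x y d by (simp add: divide_right_mono)
      then show "V s \<le> V t" using V x y d by (simp add: monoD[OF \<theta>(1)])
    next
      fix s t assume st: "\<psi> (c - d) \<le> s" "s \<le> t" "t \<le> \<psi> c"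
      obtain y where y: "c - d \<le> y" "y \<le> c" "s = \<psi> y" using sur[of "c - d" c s] st d by auto
      obtain x where x: "y \<le> x" "x \<le> c" "t = \<psi> x" using sur[of y c t] st d y by auto
      have "\<tau> x \<le> \<tau> y" using \<tau>3[of x] \<tau>3[of y] x y d by (simp add: divide_right_mono)
      then show "V t \<le> V s" using V x y d by (simp add: monoD[OF \<theta>(1)])
    next
      fix t assume "\<psi> (b + d) \<le> t" "t \<le> \<psi> (c - d)"
      then obtain x where x: "b + d \<le> x" "x \<le> c - d" "t = \<psi> x" using sur[of "b + d" "c - d" t] d by auto
      then show "V t = \<theta> 1" using V \<tau>2 d by auto
    next
      fix t assume "\<psi> b \<le> t" "t \<le> \<psi> (b + d)"
      then obtain x where x: "b \<le> x" "x \<le> b + d" "t = \<psi> x" using sur[of b "b + d" t] d by auto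
      have "\<bar>Y (\<psi> x) - f x\<bar> \<le> \<kappa>" "\<bar>f x - f b\<bar> < e / 2" using \<kappa> d1 x d by auto
      then have "\<bar>Y t - f b\<bar> \<le> e / 2 + \<kappa>" using abs\<sigma> x(3) by blast
      then show "\<bar>\<sigma> * Y t - \<sigma> * f b\<bar> \<le> e / 2 + \<kappa>" by (auto simp: \<sigma>_def abs_minus_commute)
    next
      fix t assume "\<psi> (c - d) \<le> t" "t \<le> \<psi> c"
      then obtain x where x: "c - d \<le> x" "x \<le> c" "t = \<psi> x" using sur[of "c - d" c t] d by auto
      have "\<bar>Y (\<psi> x) - f x\<bar> \<le> \<kappa>" "\<bar>f x - f c\<bar> < e / 2" using \<kappa> d2 x d by auto
      then have "\<bar>Y t - f c\<bar> \<le> e / 2 + \<kappa>" using abs\<sigma> x(3) by blast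
      then show "\<bar>\<sigma> * Y t - \<sigma> * f c\<bar> \<le> e / 2 + \<kappa>" by (auto simp: \<sigma>_def abs_minus_commute)
    qed
    moreover have "\<sigma> * f c - \<sigma> * f b = \<bar>f c - f b\<bar>" by (auto simp: \<sigma>_def)
    moreover have "(\<lambda>t. \<sigma> * Y' t * V t) = (\<lambda>t. Y' t * W t)" by (auto simp: V_def \<sigma>_def)
    ultimately show "\<exists>I\<ge>\<theta> 1 * (\<bar>f c - f b\<bar> - e - 2 * \<kappa>). ((\<lambda>t. Y' t * W t) has_integral I) {\<psi> b..\<psi> c}"
      by (simp add: algebra_simps)
  qed
  moreover have "continuous_on UNIV w" unfolding w_def \<tau>_def using d by (intro continuous_intros) auto
  moreover have "\<bar>w x\<bar> \<le> 1" "x \<notin> {b<..<c} \<Longrightarrow> w x = 0" for x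
    using \<tau>[of x] \<tau>_out by (auto simp: w_def \<sigma>_def)
  ultimately show ?thesis by blast
qed

text \<open>One trapezoid is added for each nondegenerate interval, so the construction makes
  \<open>K\<close> twice their number. \<open>K\<close> depends on the partition but not on
  \<open>\<psi>\<close>, \<open>Y\<close> or \<open>\<kappa>\<close>, so \<open>\<kappa>\<close> may
  be chosen after \<open>K\<close>.\<close>

lemma variation_sum_detected:
  assumes "variation_sum f p q s" "continuous_on UNIV f" "0 < e"
  shows "\<exists>w K. continuous_on UNIV w \<and> (\<forall>x. \<bar>w x\<bar> \<le> 1) \<and> (\<forall>x. x \<notin> {p<..<q} \<longrightarrow> w x = 0) \<and>
           detects_variation f w p q (s - e) K"
  using assms
proof (induction arbitrary: e rule: variation_sum.induct)
  case (empty e)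
  have "detects_variation f (\<lambda>_. 0) p p (0 - e) 0"
    unfolding detects_variation_def
  proof (intro allI impI, elim conjE)
    fix \<psi> Y Y' \<theta> W :: "real \<Rightarrow> real" and \<kappa> :: real
    assume \<theta>: "mono \<theta>" "\<forall>x. \<theta> (- x) = - \<theta> x"
    have "0 \<le> \<theta> 1" using monoD[OF \<theta>(1), of "-1" 1] \<theta>(2) by simp
    then have "\<theta> 1 * (0 - e - 0 * \<kappa>) \<le> 0" using empty by simp
    then show "\<exists>I\<ge>\<theta> 1 * (0 - e - 0 * \<kappa>). ((\<lambda>t. Y' t * W t) has_integral I) {\<psi> p..\<psi> p}"
      by (intro exI[of _ 0]) (auto simp: has_integral_refl)
  qed
  then show ?case by (intro exI[of _ "\<lambda>_. 0"] exI[of _ 0]) auto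
next
  case (snoc b s c e)
  obtain w K where w: "continuous_on UNIV w" "\<And>x. \<bar>w x\<bar> \<le> 1" "\<And>x. x \<notin> {p<..<b} \<Longrightarrow> w x = 0"
    "detects_variation f w p b (s - e / 2) K"
    using snoc.IH[of "e / 2"] snoc.prems by auto
  have pb: "p \<le> b" using snoc.hyps(1) by (rule variation_sum_le)
  show ?case
  proof (cases "b = c")
    case True
    obtain w K where "continuous_on UNIV w" "\<And>x. \<bar>w x\<bar> \<le> 1" "\<And>x. x \<notin> {p<..<b} \<Longrightarrow> w x = 0"
      "detects_variation f w p b (s - e) K"
      using snoc.IH[of e] snoc.prems by auto
    with True show ?thesis by auto
  next
    case False
    then have bc: "b < c" using snoc.hyps by simp
    obtain v where v: "continuous_on UNIV v" "\<And>x. \<bar>v x\<bar> \<le> 1" "\<And>x. x \<notin> {b<..<c} \<Longrightarrow> v x = 0"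
      "detects_variation f v b c (\<bar>f c - f b\<bar> - e / 2) 2"
      using trapezoid_detects_variation[OF snoc.prems(1) bc, of "e / 2"] snoc.prems(2) by auto
    \<comment> \<open>Disjoint supports: \<open>\<theta> (w x + v x)\<close> is
      \<open>\<theta> (w x)\<close> left of \<open>b\<close> and \<open>\<theta> (v x)\<close> right
      of it, although \<open>\<theta>\<close> is not additive.\<close>
    have sep: "w x = 0 \<or> v x = 0" for x using w(3)[of x] v(3)[of x] by (cases "x \<le> b") auto
    have "detects_variation f (\<lambda>x. w x + v x) p c (s + \<bar>f c - f b\<bar> - e) (K + 2)"
      unfolding detects_variation_def
    proof (intro allI impI, elim conjE)
      fix \<psi> Y Y' \<theta> W :: "real \<Rightarrow> real" and \<kappa> :: real
      assume \<psi>: "strict_mono_on {p..c} \<psi>" "continuous_on {p..c} \<psi>" and Y: "\<forall>t. (Y has_real_derivative Y' t) (at t)"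
        and \<theta>: "mono \<theta>" "\<forall>x. \<theta> (- x) = - \<theta> x" and W: "\<forall>x\<in>{p..c}. W (\<psi> x) = \<theta> (w x + v x)"
        and \<kappa>: "\<forall>x\<in>{p..c}. \<bar>Y (\<psi> x) - f x\<bar> \<le> \<kappa>"
      have sub: "{p..b} \<subseteq> {p..c}" "{b..c} \<subseteq> {p..c}" using pb bc by auto
      have "\<exists>I\<ge>\<theta> 1 * (s - e / 2 - K * \<kappa>). ((\<lambda>t. Y' t * W t) has_integral I) {\<psi> p..\<psi> b}"
      proof (rule w(4)[unfolded detects_variation_def, rule_format], intro conjI)
        show "strict_mono_on {p..b} \<psi>" "continuous_on {p..b} \<psi>"
          using \<psi> sub by (auto intro: monotone_on_subset continuous_on_subset)
        show "\<forall>x\<in>{p..b}. W (\<psi> x) = \<theta> (w x)" using W sub v(3) by auto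
      qed (use \<theta> Y \<kappa> sub in auto)
      then obtain I where I: "I \<ge> \<theta> 1 * (s - e / 2 - K * \<kappa>)" "((\<lambda>t. Y' t * W t) has_integral I) {\<psi> p..\<psi> b}" by blast
      have "\<exists>I\<ge>\<theta> 1 * (\<bar>f c - f b\<bar> - e / 2 - 2 * \<kappa>). ((\<lambda>t. Y' t * W t) has_integral I) {\<psi> b..\<psi> c}"
      proof (rule v(4)[unfolded detects_variation_def, rule_format], intro conjI)
        show "strict_mono_on {b..c} \<psi>" "continuous_on {b..c} \<psi>"
          using \<psi> sub by (auto intro: monotone_on_subset continuous_on_subset)
        show "\<forall>x\<in>{b..c}. W (\<psi> x) = \<theta> (v x)" using W sub w(3) by auto
      qed (use \<theta> Y \<kappa> sub in auto)
      then obtain J where J: "J \<ge> \<theta> 1 * (\<bar>f c - f b\<bar> - e / 2 - 2 * \<kappa>)" "((\<lambda>t. Y' t * W t) has_integral J) {\<psi> b..\<psi> c}" by blast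
      have "\<psi> p \<le> \<psi> b" "\<psi> b \<le> \<psi> c" using \<psi>(1) pb bc by (simp_all add: strict_mono_on_less_eq)
      then have "((\<lambda>t. Y' t * W t) has_integral (I + J)) {\<psi> p..\<psi> c}"
        using I(2) J(2) by (intro has_integral_combine[of _ "\<psi> b"]) auto
      moreover have "\<theta> 1 * (s + \<bar>f c - f b\<bar> - e - (K + 2) * \<kappa>) \<le> I + J"
        using I(1) J(1) by (simp add: algebra_simps)
      ultimately show "\<exists>I\<ge>\<theta> 1 * (s + \<bar>f c - f b\<bar> - e - (K + 2) * \<kappa>). ((\<lambda>t. Y' t * W t) has_integral I) {\<psi> p..\<psi> c}"
        by blast
    qed
    moreover have "\<bar>w x + v x\<bar> \<le> 1" for x using sep[of x] w(2)[of x] v(2)[of x] by auto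
    moreover have "w x + v x = 0" if "x \<notin> {p<..<c}" for x
    proof -
      have "x \<notin> {p<..<b}" "x \<notin> {b<..<c}" using that pb bc by auto
      then show ?thesis using w(3) v(3) by simp
    qed
    ultimately show ?thesis using w(1) v(1)
      by (intro exI[of _ "\<lambda>x. w x + v x"] exI[of _ "K + 2"]) (auto intro!: continuous_intros)
  qed
qed

subsection \<open>Necessity of bounded variation\<close>

definition fejer_deriv :: "(complex \<Rightarrow> complex) \<Rightarrow> nat \<Rightarrow> complex \<Rightarrow> complex" where
  "fejer_deriv x N z = (\<Sum>m\<le>N. \<Sum>k\<in>{-int m..int m}. \<i> * of_int k * fc x k * z powi k) / of_nat (Suc N)"

lemma continuous_on_fejer_deriv: "continuous_on circle (fejer_deriv x m)"
  unfolding fejer_deriv_def by (intro continuous_intros) (simp del: of_nat_Suc)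

lemma has_vector_derivative_fejer_sum:
  "((\<lambda>t. fejer_sum x N (cis t)) has_vector_derivative fejer_deriv x N (cis t)) (at t)"
proof -
  have "((\<lambda>t. cis (of_int k * t)) has_vector_derivative \<i> * of_int k * cis (of_int k * t)) (at t)" for k
    by (auto intro!: derivative_eq_intros ext simp: has_vector_derivative_def scaleR_conv_of_real)
  note this[derivative_intros]
  show ?thesis
    unfolding fejer_sum_def partial_sum_def fejer_deriv_def cis_powi
    by (auto intro!: derivative_eq_intros sum.cong simp: mult.assoc mult.left_commute divide_inverse)
qed

lemma mean_fejer_deriv_mult:
  assumes y: "continuous_on circle y"
  shows "mean (\<lambda>z. fejer_deriv x N z * y z) =
    (\<Sum>m\<le>N. \<Sum>k\<in>{-int m..int m}. \<i> * of_int k * fc x k * fc y (-k)) / of_nat (Suc N)"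
proof -
  have c: "continuous_on circle (\<lambda>z. (\<i> * of_int k * fc x k / of_nat (Suc N)) * (y z * z powi k))" for k
    by (intro continuous_on_mult continuous_on_const continuous_on_circle_powi y)
  have "mean (\<lambda>z. fejer_deriv x N z * y z) =
      mean (\<lambda>z. \<Sum>m\<le>N. \<Sum>k\<in>{-int m..int m}. (\<i> * of_int k * fc x k / of_nat (Suc N)) * (y z * z powi k))"
    by (rule mean_cong) (simp add: fejer_deriv_def sum_divide_distrib sum_distrib_left sum_distrib_right mult_ac)
  also have "\<dots> = (\<Sum>m\<le>N. \<Sum>k\<in>{-int m..int m}. mean (\<lambda>z. (\<i> * of_int k * fc x k / of_nat (Suc N)) * (y z * z powi k)))"
    using c by (simp add: mean_sum continuous_on_sum del: of_nat_Suc)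
  also have "\<dots> = (\<Sum>m\<le>N. \<Sum>k\<in>{-int m..int m}. (\<i> * of_int k * fc x k / of_nat (Suc N)) * fc y (-k))"
    unfolding fc_def minus_minus
    by (intro sum.cong refl mean_mult_left continuous_on_mult continuous_on_circle_powi y)
  finally show ?thesis by (simp add: sum_divide_distrib)
qed

text \<open>The mean is an average of \<open>N + 1\<close> truncated pairings, each bounded by
  \<open>E + E'\<close> through the arithmetic-geometric inequality; so the bound is free of
  \<open>N\<close>.\<close>

lemma norm_mean_fejer_deriv_le:
  assumes y: "continuous_on circle y"
    and E: "\<And>m. half_energy x m \<le> E"
    and E': "\<And>m. half_energy y m \<le> E'"
  shows "cmod (mean (\<lambda>z. fejer_deriv x N z * y z)) \<le> E + E'"
proof -
  have "cmod (\<Sum>k\<in>{-int m..int m}. \<i> * of_int k * fc x k * fc y (-k)) \<le> E + E'" for m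
  proof -
    have "cmod (\<Sum>k\<in>{-int m..int m}. \<i> * of_int k * fc x k * fc y (-k)) \<le>
        (\<Sum>k\<in>{-int m..int m}. \<bar>of_int k\<bar> * (cmod (fc x k) * cmod (fc y (-k))))"
      by (rule order_trans[OF norm_sum]) (simp add: norm_mult mult.assoc)
    also have "\<dots> \<le> (\<Sum>k\<in>{-int m..int m}. \<bar>of_int k\<bar> * ((cmod (fc x k))\<^sup>2 + (cmod (fc y (-k)))\<^sup>2))"
    proof (intro sum_mono mult_left_mono)
      fix k
      have "0 \<le> (cmod (fc x k) - cmod (fc y (-k)))\<^sup>2" "0 \<le> cmod (fc x k) * cmod (fc y (-k))" by simp_all
      then show "cmod (fc x k) * cmod (fc y (-k)) \<le> (cmod (fc x k))\<^sup>2 + (cmod (fc y (-k)))\<^sup>2"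
        unfolding power2_diff by linarith
    qed auto
    also have "\<dots> = half_energy x m + (\<Sum>k\<in>{-int m..int m}. \<bar>of_int k\<bar> * (cmod (fc y (-k)))\<^sup>2)"
      by (simp add: distrib_left sum.distrib)
    also have "(\<Sum>k\<in>{-int m..int m}. \<bar>of_int k\<bar> * (cmod (fc y (-k)))\<^sup>2) = half_energy y m"
      by (rule sum.reindex_bij_witness[of _ uminus uminus]) auto
    finally show ?thesis using E[of m] E'[of m] by linarith
  qed
  then have "cmod (\<Sum>m\<le>N. \<Sum>k\<in>{-int m..int m}. \<i> * of_int k * fc x k * fc y (-k)) \<le> of_nat (Suc N) * (E + E')"
    using sum_norm_bound[of "{..N}" "\<lambda>m. \<Sum>k\<in>{-int m..int m}. \<i> * of_int k * fc x k * fc y (-k)" "E + E'"] by simp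
  then show ?thesis
    unfolding mean_fejer_deriv_mult[OF y] norm_divide norm_of_nat by (simp add: divide_le_eq mult.commute)
qed

text \<open>Increments of \<open>y\<close> are dominated pointwise by those of \<open>x\<close>. The
  factor is the price for passing from coefficients to increments.\<close>

lemma lipschitz_energy_le:
  fixes x :: "complex \<Rightarrow> complex"
  assumes x: "continuous_on circle x" and y: "continuous_on circle y"
    and lip: "\<And>z w. z \<in> circle \<Longrightarrow> w \<in> circle \<Longrightarrow> cmod (y z - y w) \<le> cmod (x z - x w)"
    and E: "\<And>m. half_energy x m \<le> E"
  shows "half_energy y m \<le> (8 + 2 * pi\<^sup>2) * E"
proof (rule energy_le_dyadic_increment[OF y])
  fix N
  have "dyadic_increment y n \<le> dyadic_increment x n" for n
    unfolding dyadic_increment_def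
    by (intro mean_mono continuous_on_power continuous_on_norm continuous_on_increment x y power_mono lip)
       (auto simp: norm_mult)
  then have "(\<Sum>n<N. 2 ^ n * dyadic_increment y n) \<le> (\<Sum>n<N. 2 ^ n * dyadic_increment x n)"
    by (intro sum_mono mult_left_mono) auto
  also have "\<dots> \<le> (8 + 2 * pi\<^sup>2) * E" by (rule dyadic_increment_le[OF x E])
  finally show "(\<Sum>n<N. 2 ^ n * dyadic_increment y n) \<le> (8 + 2 * pi\<^sup>2) * E" .
qed simp

section \<open>Reflection, extension and lifting on the circle\<close>

lemma mean_comp_cnj:
  fixes x :: "complex \<Rightarrow> 'a::euclidean_space"
  assumes x: "continuous_on circle x"
  shows "mean (\<lambda>z. x (cnj z)) = mean x"
proof -
  have "integral {0..2*pi} (\<lambda>t. x (cnj (cis t))) = integral {-(2*pi)..-0} (\<lambda>t. x (cnj (cis (-t))))"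
    by (rule Henstock_Kurzweil_Integration.integral_reflect_real[symmetric])
  also have "\<dots> = integral {-(2*pi)..-(2*pi) + 2*pi} (\<lambda>t. x (cis t))" by (simp only: cis_cnj minus_minus) simp
  finally show ?thesis
    using mean_shift[OF x, of "-(2*pi)"] mean_def[of "\<lambda>z. x (cnj z)"] by metis
qed

text \<open>Reflection exchanges the frequencies \<open>k\<close> and \<open>-k\<close>. It reduces
  orientation-reversing homeomorphisms to orientation-preserving ones.\<close>

lemma W_half_comp_cnj:
  fixes x :: "complex \<Rightarrow> real"
  assumes x: "continuous_on circle x" and W: "x \<in> W_half"
  shows "continuous_on circle (\<lambda>z. x (cnj z))" "(\<lambda>z. x (cnj z)) \<in> W_half"
proof -
  show c: "continuous_on circle (\<lambda>z. x (cnj z))"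
    by (rule continuous_on_compose2[OF x]) (auto intro!: continuous_intros)
  have "fc (\<lambda>z. of_real (x (cnj z))) k = fc (\<lambda>z. of_real (x z)) (-k)" for k
  proof -
    have "fc (\<lambda>z. of_real (x (cnj z))) k = mean (\<lambda>z. (\<lambda>z. of_real (x z) * z powi k) (cnj z))"
      unfolding fc_def by (rule mean_cong) (simp add: circle_cnj_powi)
    also have "\<dots> = mean (\<lambda>z. complex_of_real (x z) * z powi k)"
      by (rule mean_comp_cnj) (intro continuous_intros x)
    finally show ?thesis by (simp add: fc_def)
  qed
  moreover have "(\<Sum>k\<in>{-int m..int m}. \<bar>of_int k\<bar> * (cmod (fc (\<lambda>z. of_real (x z)) (-k)))\<^sup>2) =
      half_energy (\<lambda>z. of_real (x z)) m" for m
    by (rule sum.reindex_bij_witness[of _ uminus uminus]) auto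
  ultimately show "(\<lambda>z. x (cnj z)) \<in> W_half"
    using W by (simp add: W_half_iff x c)
qed

lemma circle_extension:
  fixes k :: "real \<Rightarrow> 'a::topological_space"
  assumes k: "continuous_on {0..2*pi} k" "k (2*pi) = k 0"
  shows "\<exists>x. continuous_on circle x \<and> (\<forall>t\<in>{0..2*pi}. x (cis t) = k t)"
proof -
  define p where "p s = k (2 * pi * s)" for s
  have p: "path p"
    unfolding path_def p_def
    by (rule continuous_on_compose2[OF k(1)]) (auto intro!: continuous_intros mult_left_le)
  \<comment> \<open>The trivial homotopy serves to obtain continuity of \<open>p\<close> composed
    with the normalised argument on the whole circle, across the jump of
    \<open>Arg2pi\<close>.\<close>
  have "homotopic_loops UNIV p p"
    using p k(2) by (simp add: homotopic_loops_refl pathfinish_def pathstart_def p_def)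
  then have "continuous_on circle (p \<circ> (\<lambda>z. Arg2pi z / (2 * pi)))"
    using homotopic_with_imp_continuous[OF homotopic_loops_imp_homotopic_circlemaps] by blast
  moreover have "(p \<circ> (\<lambda>z. Arg2pi z / (2 * pi))) (cis t) = k t" if t: "t \<in> {0..2*pi}" for t
  proof (cases "t = 2 * pi")
    case True
    then show ?thesis using k(2) Arg2pi_of_real[of 1] by (simp add: p_def)
  next
    case False
    then have "Arg2pi (cis t) = t" using t
      by (intro Arg2pi_unique[of 1]) (auto simp: cis_conv_exp)
    then show ?thesis by (simp add: p_def)
  qed
  ultimately show ?thesis by blast
qed

lemma cis_inj_on: "inj_on cis {a..<a + 2 * pi}"
proof (rule inj_onI)
  fix s t assume st: "s \<in> {a..<a + 2 * pi}" "t \<in> {a..<a + 2 * pi}" and "cis s = cis t"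
  then have "sin ((s - t) / 2) = 0" using norm_cis_diff[of s t] by simp
  then obtain n :: int where "(s - t) / 2 = of_int n * pi" by (auto simp: sin_zero_iff_int2)
  then have n: "s - t = of_int n * (2 * pi)" by simp
  then have "\<bar>of_int n * (2 * pi)\<bar> < 1 * (2 * pi)" using st by auto
  then have "\<bar>of_int n\<bar> < (1::real)" unfolding abs_mult using mult_less_cancel_right_pos[of "2*pi" "\<bar>of_int n\<bar>" 1] by simp
  then have "n = 0" by linarith
  with n show "s = t" by simp
qed

text \<open>Continuity alone gives a weak inequality at the endpoint; comparison with an
  intermediate point \<open>u\<close> keeps it strict.\<close>

lemma strict_mono_on_right_endpoint:
  fixes f :: "real \<Rightarrow> real"
  assumes cont: "continuous_on {a..b} f" and m: "strict_mono_on {a..<b} f"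
  shows "strict_mono_on {a..b} f"
proof (rule strict_mono_onI)
  fix x y assume xy: "x \<in> {a..b}" "y \<in> {a..b}" "x < y"
  define u where "u = (x + y) / 2"
  have u: "x < u" "u < y" using xy by (auto simp: u_def)
  have "f x < f u" using strict_mono_onD[OF m, of x u] u xy by auto
  also have "f u \<le> f y"
  proof (rule tendsto_lowerbound)
    show "(f \<longlongrightarrow> f y) (at y within {u..y})"
      using continuous_on_subset[OF cont, of "{u..y}"] xy u by (auto simp: continuous_on_def)
    have "\<forall>\<^sub>F t in at y within {u..y}. t \<in> {u..<y}"
      by (auto simp: eventually_at intro!: exI[of _ 1])
    then show "\<forall>\<^sub>F t in at y within {u..y}. f u \<le> f t"
      by eventually_elim (use strict_mono_on_leD[OF m, of u] u xy in auto)
    show "at y within {u..y} \<noteq> bot" using u by (simp add: trivial_limit_within islimpt_Icc)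
  qed
  finally show "f x < f y" .
qed

text \<open>\<open>\<psi>\<close> is an angle of the inverse \<open>h'\<close>, so that
  \<open>f \<circ> h\<close> along \<open>cis \<circ> \<psi>\<close> is \<open>f\<close> along
  \<open>cis\<close>. Injectivity on the half-open period gives monotonicity, and the winding number
  can only be 1 or -1.\<close>

lemma circle_homeomorphism_lift:
  assumes h: "homeomorphism circle circle h h'"
  shows "\<exists>\<psi>. continuous_on {0..2*pi} \<psi> \<and> (\<forall>t\<in>{0..2*pi}. h (cis (\<psi> t)) = cis t) \<and>
    (strict_mono_on {0..2*pi} \<psi> \<and> \<psi> (2*pi) = \<psi> 0 + 2 * pi \<or>
     strict_antimono_on {0..2*pi} \<psi> \<and> \<psi> (2*pi) = \<psi> 0 - 2 * pi)"
proof -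
  have h': "continuous_on circle h'" "\<And>z. z \<in> circle \<Longrightarrow> h (h' z) = z" "\<And>z. z \<in> circle \<Longrightarrow> h' z \<in> circle"
    using h by (auto simp: homeomorphism_def)
  have "continuous_on {0..2*pi} (\<lambda>t. h' (cis t))" by (rule continuous_on_circle_cis[OF h'(1)])
  moreover have "h' (cis t) \<noteq> 0" for t using h'(3)[of "cis t"] by auto
  ultimately obtain G where G: "continuous_on {0..2*pi} G" "\<And>t. t \<in> {0..2*pi} \<Longrightarrow> h' (cis t) = exp (G t)"
    using continuous_logarithm_on_contractible[of "{0..2*pi}" "\<lambda>t. h' (cis t)"]
      convex_imp_contractible[of "{0..2*pi}"] by auto
  define \<psi> where "\<psi> t = Im (G t)" for t
  have \<psi>: "h' (cis t) = cis (\<psi> t)" if "t \<in> {0..2*pi}" for t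
  proof -
    have "exp (Re (G t)) = 1" using h'(3)[of "cis t"] G(2)[OF that] by simp
    then show ?thesis using G(2)[OF that] by (simp add: \<psi>_def exp_eq_polar)
  qed
  have h\<psi>: "h (cis (\<psi> t)) = cis t" if "t \<in> {0..2*pi}" for t using h'(2)[of "cis t"] \<psi>[OF that] by simp
  have cont: "continuous_on {0..2*pi} \<psi>" unfolding \<psi>_def by (intro continuous_intros G(1))
  have "inj_on \<psi> {0..<2*pi}"
  proof (rule inj_onI)
    fix s t assume st: "s \<in> {0..<2*pi}" "t \<in> {0..<2*pi}" "\<psi> s = \<psi> t"
    then have "cis s = cis t" using h\<psi>[of s] h\<psi>[of t] by simp
    then show "s = t" using cis_inj_on[of 0] st by (auto dest: inj_onD)
  qed
  have inj: "\<psi> s \<noteq> \<psi> t + 2 * pi * of_int n" if "s \<in> {0..<2*pi}" "t \<in> {0..<2*pi}" "s \<noteq> t" for s t n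
  proof
    assume "\<psi> s = \<psi> t + 2 * pi * of_int n"
    then have "cis (\<psi> s) = cis (\<psi> t)" by (simp flip: cis_mult)
    then have "cis s = cis t" using h\<psi>[of s] h\<psi>[of t] that by simp
    then show False using cis_inj_on[of 0] that by (auto dest: inj_onD)
  qed
  have "cis (\<psi> (2*pi)) = cis (\<psi> 0)" using \<psi>[of "2*pi"] \<psi>[of 0] by simp
  then have "sin ((\<psi> (2*pi) - \<psi> 0) / 2) = 0" using norm_cis_diff[of "\<psi> (2*pi)" "\<psi> 0"] by simp
  then obtain n :: int where n: "\<psi> (2*pi) - \<psi> 0 = of_int n * (2 * pi)"
    by (auto simp: sin_zero_iff_int2)
  have mono: "strict_mono_on {0..<2*pi} \<psi> \<or> strict_antimono_on {0..<2*pi} \<psi>"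
    using \<open>inj_on \<psi> {0..<2*pi}\<close> cont
    by (subst injective_eq_monotone_map[symmetric]) (auto simp: is_interval_co intro: continuous_on_subset)
  \<comment> \<open>If \<open>\<psi>\<close> changed by more than one turn, the intermediate value
    theorem would give a point strictly inside the period with the same image as \<open>0\<close>,
    against injectivity.\<close>
  have le1: "\<bar>of_int n\<bar> \<le> (1::real)"
  proof (rule ccontr)
    assume "\<not> ?thesis"
    then have "\<bar>n\<bar> > 1" by linarith
    then have "of_int n \<ge> (2::real) \<or> of_int n \<le> (-2::real)" by linarith
    then have "\<psi> 0 + 2 * pi < \<psi> (2*pi) \<or> \<psi> (2*pi) < \<psi> 0 - 2 * pi"
    proof
      assume "of_int n \<ge> (2::real)"
      then have "of_int n * (2*pi) \<ge> 2 * (2 * pi)" by (intro mult_right_mono) auto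
      then show ?thesis using n pi_gt_zero by linarith
    next
      assume "of_int n \<le> (-2::real)"
      then have "of_int n * (2*pi) \<le> -2 * (2 * pi)" by (intro mult_right_mono) auto
      then show ?thesis using n pi_gt_zero by linarith
    qed
    then obtain e :: int and t where t: "t \<in> {0..2*pi}" "\<psi> t = \<psi> 0 + 2 * pi * of_int e" "e \<noteq> 0" "t \<noteq> 2 * pi"
    proof
      assume "\<psi> 0 + 2 * pi < \<psi> (2*pi)"
      then obtain t where "0 \<le> t" "t \<le> 2*pi" "\<psi> t = \<psi> 0 + 2 * pi"
        using IVT'[of \<psi> 0 "\<psi> 0 + 2 * pi" "2 * pi"] cont by auto
      then show ?thesis using \<open>\<psi> 0 + 2 * pi < \<psi> (2*pi)\<close> by (intro that[of t 1]) auto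
    next
      assume "\<psi> (2*pi) < \<psi> 0 - 2 * pi"
      then obtain t where "0 \<le> t" "t \<le> 2*pi" "\<psi> t = \<psi> 0 - 2 * pi"
        using IVT2'[of \<psi> "2 * pi" "\<psi> 0 - 2 * pi" 0] cont by auto
      then show ?thesis using \<open>\<psi> (2*pi) < \<psi> 0 - 2 * pi\<close> by (intro that[of t "-1"]) auto
    qed
    have "t \<noteq> 0" using t by auto
    then show False using inj[of t 0 e] t by auto
  qed
  from mono show ?thesis
  proof
    assume m: "strict_mono_on {0..<2*pi} \<psi>"
    have sm: "strict_mono_on {0..2*pi} \<psi>" by (rule strict_mono_on_right_endpoint[OF cont m])
    have "0 < \<psi> (2*pi) - \<psi> 0" using strict_mono_onD[OF sm, of 0 "2*pi"] by simp
    then have "0 < of_int n * (2 * pi)" by (simp only: n)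
    then have "0 < (of_int n :: real)" by (simp add: zero_less_mult_iff)
    then have "n = 1" using le1 by linarith
    with n sm cont h\<psi> show ?thesis by (intro exI[of _ \<psi>]) auto
  next
    assume m: "strict_antimono_on {0..<2*pi} \<psi>"
    have "strict_mono_on {0..2*pi} (\<lambda>t. - \<psi> t)"
      by (rule strict_mono_on_right_endpoint) (use m in \<open>auto simp: monotone_on_def intro!: continuous_intros cont\<close>)
    then have sm: "strict_antimono_on {0..2*pi} \<psi>" by (auto simp: monotone_on_def)
    have "\<psi> (2*pi) - \<psi> 0 < 0" using monotone_onD[OF sm, of 0 "2*pi"] by simp
    then have "of_int n * (2 * pi) < 0" by (simp only: n)
    then have "(of_int n :: real) < 0" by (simp add: mult_less_0_iff)
    then have "n = -1" using le1 by linarith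
    with n sm cont h\<psi> show ?thesis by (intro exI[of _ \<psi>]) auto
  qed
qed

section \<open>Soft thresholding and the contradiction to finite energy\<close>

text \<open>For \<open>0 \<le> e\<close> this is \<open>sgn x * max (\<bar>x\<bar> - e) 0\<close>. A
  hard cutoff would also remove small values but is not Lipschitz.\<close>

definition soft_threshold :: "real \<Rightarrow> real \<Rightarrow> real" where
  "soft_threshold e x = max (x - e) 0 + min (x + e) 0"

lemma soft_threshold_lipschitz: "0 \<le> e \<Longrightarrow> \<bar>soft_threshold e x - soft_threshold e y\<bar> \<le> \<bar>x - y\<bar>"
  by (auto simp: soft_threshold_def max_def min_def)

lemma soft_threshold_minus: "soft_threshold e (- x) = - soft_threshold e x"
  by (auto simp: soft_threshold_def max_def min_def)

lemma soft_threshold_eq_0: "\<bar>x\<bar> \<le> e \<Longrightarrow> soft_threshold e x = 0"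
  by (auto simp: soft_threshold_def max_def min_def)

lemma soft_threshold_pos: "0 \<le> e \<Longrightarrow> e \<le> x \<Longrightarrow> soft_threshold e x = x - e"
  by (auto simp: soft_threshold_def max_def min_def)

lemma mono_soft_threshold: "mono (soft_threshold e)"
  by (intro monoI) (auto simp: soft_threshold_def max_def min_def)

lemma continuous_on_soft_threshold: "continuous_on A x \<Longrightarrow> continuous_on A (\<lambda>t. soft_threshold e (x t))"
  unfolding soft_threshold_def by (intro continuous_intros)

lemma floor_2pi_bounds:
  "of_int \<lfloor>x / (2*pi)\<rfloor> * (2*pi) \<le> x" "x < (of_int \<lfloor>x / (2*pi)\<rfloor> + 1) * (2*pi)"
  using floor_divide_lower[of "2*pi" x] floor_divide_upper[of "2*pi" x] by simp_all

text \<open>A partition with another starting point is moved by whole turns to start in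
  \<open>{0..2 * pi}\<close> and is split at \<open>2 * pi\<close>. Each piece, moved back, extends
  to a partition of one period; hence the bound \<open>B + B\<close>.\<close>

lemma not_bounded_variation_T_imp_unbounded:
  fixes f :: "complex \<Rightarrow> real"
  assumes "\<not> bounded_variation_T f"
  shows "unbounded_variation (\<lambda>t. f (cis t)) 0 (2 * pi)"
proof (rule ccontr)
  let ?f = "\<lambda>t. f (cis t)"
  assume "\<not> unbounded_variation ?f 0 (2 * pi)"
  then obtain B where B: "\<And>s. variation_sum ?f 0 (2*pi) s \<Longrightarrow> s \<le> B"
    unfolding unbounded_variation_def by (meson le_cases)
  have shift: "variation_sum ?f (a + 2 * pi * of_int k) (b + 2 * pi * of_int k) s" if "variation_sum ?f a b s" for a b s and k :: int
    using that
  proof (induction rule: variation_sum.induct)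
    case (snoc b s c)
    have "cis (t + 2 * pi * of_int k) = cis t" for t by (simp flip: cis_mult)
    with snoc variation_sum.snoc[of ?f "a + 2 * pi * of_int k" "b + 2 * pi * of_int k" s "c + 2 * pi * of_int k"]
    show ?case by simp
  qed (rule variation_sum.empty)
  have "bounded_variation_T f"
    unfolding bounded_variation_T_def
  proof (rule exI[of _ "B + B"], intro allI impI)
    fix n and t :: "nat \<Rightarrow> real" assume t: "(\<forall>i<n. t i < t (Suc i)) \<and> t n = t 0 + 2 * pi"
    define S where "S j = (\<Sum>i<j. \<bar>f (cis (t (Suc i))) - f (cis (t i))\<bar>)" for j
    have S: "variation_sum ?f (t 0) (t j) (S j)" if "j \<le> n" for j
      using that
    proof (induction j)
      case 0
      then show ?case by (simp add: S_def variation_sum.empty)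
    next
      case (Suc j)
      then show ?case using variation_sum.snoc[of ?f "t 0" "t j" "S j" "t (Suc j)"] t by (simp add: S_def less_imp_le)
    qed
    define k where "k = - \<lfloor>t 0 / (2 * pi)\<rfloor>"
    define a where "a = t 0 + 2 * pi * of_int k"
    have a: "0 \<le> a" "a \<le> 2 * pi" using floor_2pi_bounds[of "t 0"] by (simp_all add: a_def k_def algebra_simps)
    have V: "variation_sum ?f a (a + 2 * pi) (S n)"
      using shift[OF S[of n], of k] t by (simp add: a_def algebra_simps)
    obtain s1 s2 where s: "variation_sum ?f a (2*pi) s1" "variation_sum ?f (2*pi) (a + 2*pi) s2" "S n \<le> s1 + s2"
      using variation_sum_split[OF V, of "2 * pi"] a by auto
    have "s1 \<le> B"
      using B[OF variation_sum_concat[OF s(1) variation_sum_single[of 0 a]]] a by auto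
    moreover have "s2 \<le> B"
      using B[OF variation_sum_concat[OF variation_sum_single[of a "2*pi"] shift[OF s(2), of "-1", simplified]]] a by auto
    ultimately show "(\<Sum>i<n. \<bar>f (cis (t (Suc i))) - f (cis (t i))\<bar>) \<le> B + B"
      using s(3) by (simp add: S_def)
  qed
  with assms show False by simp
qed

text \<open>The function is the sum of \<open>(1 / 2) ^ n * w n\<close>, which converges uniformly;
  as the supports are disjoint, at most one term is nonzero at each point.\<close>

lemma detecting_series:
  fixes f :: "real \<Rightarrow> real"
  assumes f: "continuous_on UNIV f" and U: "unbounded_variation f a b"
  shows "\<exists>g p q w K. continuous_on UNIV g \<and> (\<forall>n::nat. a \<le> p n \<and> p n \<le> q n \<and> q n \<le> b \<and>
      detects_variation f (w n) (p n) (q n) (4 ^ n) (K n) \<and> (\<forall>x. \<bar>w n x\<bar> \<le> 1) \<and> (\<forall>x. x \<notin> {p n<..<q n} \<longrightarrow> w n x = 0) \<and>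
      (\<forall>x\<in>{p n..q n}. g x = (1 / 2) ^ n * w n x)) \<and>
      (\<forall>n k x. n \<noteq> k \<longrightarrow> x \<in> {p n..q n} \<longrightarrow> x \<notin> {p k<..<q k}) \<and>
      (\<forall>x. (\<forall>n. x \<notin> {p n<..<q n}) \<longrightarrow> g x = 0)"
proof -
  \<comment> \<open>The additional 1 pays for the loss in \<open>variation_sum_detected\<close>,
    leaving exactly \<open>4 ^ n\<close>.\<close>
  obtain p q where pq: "\<And>n::nat. a \<le> p n \<and> p n \<le> q n \<and> q n \<le> b \<and> (\<exists>s\<ge>4 ^ n + 1. variation_sum f (p n) (q n) s)"
    and disj: "\<And>n k. n \<noteq> k \<Longrightarrow> q n \<le> p k \<or> q k \<le> p n"
    using unbounded_variation_blocks[OF f U, of "\<lambda>n. 4 ^ n + 1"] by blast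
  have lt: "p n < q n" for n
  proof (rule ccontr)
    assume "\<not> ?thesis"
    moreover obtain s where s: "s \<ge> 4 ^ n + 1" "variation_sum f (p n) (q n) s" using pq by blast
    ultimately have "s = 0" using variation_sum_trivial[OF s(2)] by simp
    moreover have "(0::real) < 4 ^ n" by simp
    ultimately show False using s(1) by linarith
  qed
  have "\<exists>w K. continuous_on UNIV w \<and> (\<forall>x. \<bar>w x\<bar> \<le> 1) \<and> (\<forall>x. x \<notin> {p n<..<q n} \<longrightarrow> w x = 0) \<and>
           detects_variation f w (p n) (q n) (4 ^ n) K" for n
  proof -
    obtain s where s: "s \<ge> 4 ^ n + 1" "variation_sum f (p n) (q n) s" using pq by blast
    have "0 < s - 4 ^ n" using s by simp
    from variation_sum_detected[OF s(2) f this] show ?thesis by simp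
  qed
  then obtain w K where w: "\<And>n. continuous_on UNIV (w n)" "\<And>n x. \<bar>w n x\<bar> \<le> 1"
    "\<And>n x. x \<notin> {p n<..<q n} \<Longrightarrow> w n x = 0" "\<And>n. detects_variation f (w n) (p n) (q n) (4 ^ n) (K n)"
    by metis
  define g where "g x = (\<Sum>n. (1 / 2) ^ n * w n x)" for x
  have sep: "x \<notin> {p k<..<q k}" if "n \<noteq> k" "x \<in> {p n..q n}" for n k x
    using disj[OF that(1)] that(2) by auto
  have "continuous_on UNIV g"
    unfolding g_def
  proof (rule uniform_limit_theorem)
    show "uniform_limit UNIV (\<lambda>n x. \<Sum>i<n. (1 / 2) ^ i * w i x) (\<lambda>x. \<Sum>n. (1 / 2) ^ n * w n x) sequentially"
    proof (rule Weierstrass_m_test)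
      show "norm ((1 / 2) ^ n * w n x) \<le> (1 / 2) ^ n" for n x
        using w(2)[of n x] by (simp add: abs_mult mult_left_le)
    qed (simp add: summable_geometric)
    show "\<forall>\<^sub>F n in sequentially. continuous_on UNIV (\<lambda>x. \<Sum>i<n. (1 / 2) ^ i * w i x)"
      by (intro always_eventually allI continuous_intros w)
  qed simp
  moreover have "g x = (1 / 2) ^ n * w n x" if "x \<in> {p n..q n}" for n x
  proof -
    have "(1 / 2) ^ k * w k x = 0" if "k \<notin> {n}" for k
      using w(3)[of x k] sep[of n k x] that \<open>x \<in> {p n..q n}\<close> by auto
    then show ?thesis unfolding g_def by (subst suminf_finite[of "{n}"]) auto
  qed
  moreover have "g x = 0" if "\<forall>n. x \<notin> {p n<..<q n}" for x
    using w(3) that by (simp add: g_def)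
  ultimately show ?thesis
    using pq w sep
    by - (rule exI[of _ g], rule exI[of _ p], rule exI[of _ q], rule exI[of _ w], rule exI[of _ K], blast)
qed

text \<open>Uniqueness of the block is asked only where \<open>D\<close> is nonzero, so that blocks
  may share endpoints.\<close>

lemma has_integral_sum_blocks:
  fixes D :: "real \<Rightarrow> real" and m :: nat
  assumes I: "\<And>n. n \<le> m \<Longrightarrow> (D has_integral I n) {u n..v n}" and sub: "\<And>n. n \<le> m \<Longrightarrow> {u n..v n} \<subseteq> {a..b}"
    and zero: "\<And>t. t \<in> {a..b} \<Longrightarrow> D t \<noteq> 0 \<Longrightarrow> \<exists>!n. n \<le> m \<and> t \<in> {u n..v n}"
  shows "(D has_integral (\<Sum>n\<le>m. I n)) {a..b}"
proof -
  have "((\<lambda>t. \<Sum>n\<le>m. if t \<in> {u n..v n} then D t else 0) has_integral (\<Sum>n\<le>m. I n)) {a..b}"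
  proof (rule has_integral_sum)
    fix n assume "n \<in> {..m}"
    then have n: "n \<le> m" by simp
    show "((\<lambda>t. if t \<in> {u n..v n} then D t else 0) has_integral I n) {a..b}"
      using I[OF n] has_integral_restrict[OF sub[OF n]] by blast
  qed simp
  then show ?thesis
  proof (rule has_integral_eq[rotated])
    fix t assume t: "t \<in> {a..b}"
    show "(\<Sum>n\<le>m. if t \<in> {u n..v n} then D t else 0) = D t"
  proof (cases "D t = 0")
    case False
    from zero[OF t False] obtain n where n: "n \<le> m" "t \<in> {u n..v n}" and uniq: "\<And>k. k \<le> m \<Longrightarrow> t \<in> {u k..v k} \<Longrightarrow> k = n"
      by blast
    have "(\<Sum>k\<le>m. if t \<in> {u k..v k} then D t else 0) = (\<Sum>k\<in>{n}. if t \<in> {u k..v k} then D t else 0)"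
    proof (rule sum.mono_neutral_right)
      show "\<forall>k\<in>{..m} - {n}. (if t \<in> {u k..v k} then D t else 0) = 0"
        using uniq by (metis DiffD1 DiffD2 atMost_iff insertI1)
    qed (use n in simp_all)
    then show ?thesis using n(2) by simp
  qed (simp add: sum.neutral)
  qed
qed

text \<open>For each \<open>m\<close> the thresholded \<open>G\<close> is integrated against the
  derivative of a Fejer sum of \<open>F\<close>. Block \<open>m\<close> alone gives at least
  \<open>(2 ^ m - 1) / 2\<close>, whereas the energies bound the integral independently of
  \<open>m\<close>.\<close>

lemma increasing_change_of_variable_contradiction:
  fixes f g :: "real \<Rightarrow> real" and F G :: "complex \<Rightarrow> real"
  assumes F: "continuous_on circle F" "F \<in> W_half" and G: "continuous_on circle G" "G \<in> W_half"
    and \<psi>: "continuous_on {0..2*pi} \<psi>" "strict_mono_on {0..2*pi} \<psi>" "\<psi> (2*pi) = \<psi> 0 + 2 * pi"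
    and f: "\<And>t. t \<in> {0..2*pi} \<Longrightarrow> F (cis (\<psi> t)) = f t"
    and g: "\<And>t. t \<in> {0..2*pi} \<Longrightarrow> G (cis (\<psi> t)) = g t"
    and pq: "\<And>n. 0 \<le> p n" "\<And>n. p n \<le> q n" "\<And>n. q n \<le> 2 * pi"
    and det: "\<And>n. detects_variation f (w n) (p n) (q n) (4 ^ n) (K n)" and w: "\<And>n x. \<bar>w n x\<bar> \<le> 1"
      "\<And>n x. x \<notin> {p n<..<q n} \<Longrightarrow> w n x = 0"
    and gw: "\<And>n x. x \<in> {p n..q n} \<Longrightarrow> g x = (1 / 2) ^ n * w n x"
    and disj: "\<And>n k x. n \<noteq> k \<Longrightarrow> x \<in> {p n..q n} \<Longrightarrow> x \<notin> {p k<..<q k}"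
    and g0: "\<And>x. (\<And>n. x \<notin> {p n<..<q n}) \<Longrightarrow> g x = 0"
  shows False
proof -
  define X where "X z = complex_of_real (F z)" for z
  have X: "continuous_on circle X" unfolding X_def by (intro continuous_intros F)
  obtain E1 where E1: "\<And>m. half_energy X m \<le> E1"
    using F(2) unfolding W_half_iff[OF F(1)] X_def by blast
  obtain E2 where E2: "\<And>m. half_energy (\<lambda>z. of_real (G z)) m \<le> E2"
    using G(2) unfolding W_half_iff[OF G(1)] by blast
  define C where "C = E1 + (8 + 2 * pi\<^sup>2) * E2"
  have main: "(2 ^ m - 1) / 2 \<le> 2 * pi * C" for m :: nat
  proof -
    \<comment> \<open>Blocks with \<open>n > m\<close> have amplitude at most \<open>e\<close> and
      vanish after thresholding, while block \<open>m\<close>, of amplitude \<open>2 * e\<close>,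
      keeps amplitude \<open>e\<close>.\<close>
    define e :: real where "e = (1 / 2) ^ Suc m"
    have e: "0 < e" by (simp add: e_def)
    define W where "W z = soft_threshold e (G z)" for z
    have Wc: "continuous_on circle W" unfolding W_def by (intro continuous_on_soft_threshold G)
    define y where "y z = complex_of_real (W z)" for z
    have y: "continuous_on circle y" unfolding y_def by (intro continuous_intros Wc)
    have yE: "half_energy y m \<le> (8 + 2 * pi\<^sup>2) * E2" for m
    proof (rule lipschitz_energy_le[OF _ y _ E2])
      show "continuous_on circle (\<lambda>z. complex_of_real (G z))" by (intro continuous_intros G)
      show "cmod (y z - y w) \<le> cmod (complex_of_real (G z) - complex_of_real (G w))" for z w
        using soft_threshold_lipschitz[of e "G z" "G w"] e by (simp add: y_def W_def flip: of_real_diff)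
    qed
    \<comment> \<open>The Fejer error is chosen so small that it costs at most 1 in each of the
      finitely many surviving blocks; the degree \<open>N\<close> may then be large, since the
      energy bound does not depend on it.\<close>
    define \<kappa> where "\<kappa> = 1 / (1 + (\<Sum>n\<le>m. \<bar>K n\<bar>))"
    have S0: "0 \<le> (\<Sum>n\<le>m. \<bar>K n\<bar>)" by (intro sum_nonneg) auto
    have \<kappa>: "0 < \<kappa>" unfolding \<kappa>_def using S0 by (intro divide_pos_pos add_pos_nonneg) auto
    have K\<kappa>: "K n * \<kappa> \<le> 1" if "n \<le> m" for n
    proof -
      have "\<bar>K n\<bar> \<le> (\<Sum>n\<le>m. \<bar>K n\<bar>)" using that by (intro member_le_sum) auto
      then have "K n \<le> 1 + (\<Sum>n\<le>m. \<bar>K n\<bar>)" by linarith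
      moreover have "0 < 1 + (\<Sum>n\<le>m. \<bar>K n\<bar>)" using S0 by linarith
      ultimately show ?thesis unfolding \<kappa>_def by (simp only: mult_1_right times_divide_eq_right divide_le_eq_1 simp_thms)
    qed
    obtain N where N: "\<And>z. z \<in> circle \<Longrightarrow> cmod (fejer_sum X N z - X z) < \<kappa>"
      using fejer_sum_uniform[OF X \<kappa>] by blast
    define Y where "Y t = Re (fejer_sum X N (cis t))" for t
    define Y' where "Y' t = Re (fejer_deriv X N (cis t))" for t
    have Yd: "(Y has_real_derivative Y' t) (at t)" for t
      unfolding Y_def Y'_def has_real_derivative_iff_has_vector_derivative
      by (rule bounded_linear.has_vector_derivative[OF bounded_linear_Re has_vector_derivative_fejer_sum])
    define D where "D t = Y' t * W (cis t)" for t
    have mono: "\<psi> x \<le> \<psi> y \<longleftrightarrow> x \<le> y" if "x \<in> {0..2*pi}" "y \<in> {0..2*pi}" for x y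
      using \<psi>(2) that by (simp add: strict_mono_on_less_eq)
    have block: "\<exists>I\<ge>soft_threshold e ((1 / 2) ^ n) * (4 ^ n - K n * \<kappa>). (D has_integral I) {\<psi> (p n)..\<psi> (q n)}" for n
    proof -
      have sub: "{p n..q n} \<subseteq> {0..2*pi}" using pq[of n] by auto
      \<comment> \<open>The amplitude of the block is absorbed into \<open>\<theta>\<close>: scaling
        followed by thresholding is still odd and monotone.\<close>
      have "\<exists>I\<ge>(\<lambda>x. soft_threshold e ((1 / 2) ^ n * x)) 1 * (4 ^ n - K n * \<kappa>). ((\<lambda>t. Y' t * W (cis t)) has_integral I) {\<psi> (p n)..\<psi> (q n)}"
      proof (rule det[of n, unfolded detects_variation_def, rule_format,
            where \<psi> = \<psi> and Y = Y and Y' = Y' and W = "\<lambda>t. W (cis t)" and \<kappa> = \<kappa>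
            and \<theta> = "\<lambda>x. soft_threshold e ((1 / 2) ^ n * x)"], intro conjI allI ballI)
        show "strict_mono_on {p n..q n} \<psi>" "continuous_on {p n..q n} \<psi>"
          using \<psi> sub by (auto intro: monotone_on_subset continuous_on_subset)
        show "mono (\<lambda>x. soft_threshold e ((1 / 2) ^ n * x))"
          by (intro monoI monoD[OF mono_soft_threshold] mult_left_mono) auto
        show "soft_threshold e ((1 / 2) ^ n * - x) = - soft_threshold e ((1 / 2) ^ n * x)" for x
          by (simp add: soft_threshold_minus)
        show "W (cis (\<psi> x)) = soft_threshold e ((1 / 2) ^ n * w n x)" if "x \<in> {p n..q n}" for x
        proof -
          have "G (cis (\<psi> x)) = g x" using g sub that by blast
          then show ?thesis using gw[OF that] by (simp add: W_def)
        qed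
        show "\<bar>Y (\<psi> x) - f x\<bar> \<le> \<kappa>" if "x \<in> {p n..q n}" for x
        proof -
          have "F (cis (\<psi> x)) = f x" using f sub that by blast
          then have "\<bar>Y (\<psi> x) - f x\<bar> = \<bar>Re (fejer_sum X N (cis (\<psi> x)) - X (cis (\<psi> x)))\<bar>"
            by (simp add: Y_def X_def)
          also have "\<dots> \<le> \<kappa>" using N[of "cis (\<psi> x)"] abs_Re_le_cmod[of "fejer_sum X N (cis (\<psi> x)) - X (cis (\<psi> x))"] by simp
          finally show ?thesis .
        qed
      qed (rule Yd)
      then show ?thesis unfolding D_def[abs_def] by simp
    qed
    then obtain I where I: "\<And>n. I n \<ge> soft_threshold e ((1 / 2) ^ n) * (4 ^ n - K n * \<kappa>)"
      "\<And>n. (D has_integral I n) {\<psi> (p n)..\<psi> (q n)}" by metis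
    have tot: "(D has_integral (\<Sum>n\<le>m. I n)) {\<psi> 0..\<psi> 0 + 2 * pi}"
    proof (rule has_integral_sum_blocks[where D = D])
      show "(D has_integral I n) {\<psi> (p n)..\<psi> (q n)}" for n by (rule I)
      show "{\<psi> (p n)..\<psi> (q n)} \<subseteq> {\<psi> 0..\<psi> 0 + 2 * pi}" for n
        using mono[of 0 "p n"] mono[of "q n" "2 * pi"] pq[of n] \<psi>(3) by auto
      fix t assume t: "t \<in> {\<psi> 0..\<psi> 0 + 2 * pi}" and D0: "D t \<noteq> 0"
      obtain x where x: "x \<in> {0..2*pi}" "t = \<psi> x"
        using IVT'[of \<psi> 0 t "2*pi"] t \<psi> by auto
      have s0: "soft_threshold e (g x) \<noteq> 0" using D0 g[OF x(1)] x(2) by (auto simp: D_def W_def)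
      then have "g x \<noteq> 0" using soft_threshold_eq_0[of 0 e] e by auto
      then obtain n where n: "x \<in> {p n<..<q n}" using g0 by blast
      then have n': "x \<in> {p n..q n}" by auto
      have "n \<le> m"
      proof (rule ccontr)
        assume "\<not> n \<le> m"
        then have "(1 / 2::real) ^ n \<le> e" unfolding e_def by (intro power_decreasing) auto
        moreover have "\<bar>(1 / 2) ^ n * w n x\<bar> \<le> (1 / 2) ^ n" using w(1)[of n x] by (simp add: abs_mult mult_left_le)
        ultimately have "\<bar>g x\<bar> \<le> e" using gw[OF n'] by linarith
        with s0 soft_threshold_eq_0 show False by blast
      qed
      moreover have mem: "t \<in> {\<psi> (p k)..\<psi> (q k)} \<longleftrightarrow> x \<in> {p k..q k}" for k
      proof -
        have "p k \<in> {0..2*pi}" "q k \<in> {0..2*pi}" using pq(1,2,3)[of k] by auto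
        then show ?thesis using mono[of "p k" x] mono[of x "q k"] x(1) unfolding x(2) atLeastAtMost_iff by blast
      qed
      ultimately show "\<exists>!n. n \<le> m \<and> t \<in> {\<psi> (p n)..\<psi> (q n)}"
        unfolding mem using n n' disj[of _ n x] by (intro ex1I[of _ n]) blast+
    qed
    have "(2 ^ m - 1) / 2 \<le> I m"
    proof -
      have s: "soft_threshold e ((1 / 2) ^ m) = e"
        by (subst soft_threshold_pos) (auto simp: e_def)
      have "(2 ^ m - 1) / 2 \<le> e * (4 ^ m - 1)"
      proof -
        have "(4::real) ^ m = 2 ^ m * 2 ^ m" by (simp flip: power_mult_distrib)
        then have "e * (4 ^ m - 1) = (2 ^ m - (1 / 2) ^ m) / 2" by (simp add: e_def field_simps power_divide)
        moreover have "(1 / 2::real) ^ m \<le> 1" by (simp add: power_le_one)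
        ultimately show ?thesis by simp
      qed
      also have "\<dots> \<le> e * (4 ^ m - K m * \<kappa>)" using K\<kappa>[of m] e by (intro mult_left_mono) auto
      finally show ?thesis using I(1)[of m] s by simp
    qed
    also have "I m \<le> (\<Sum>n\<le>m. I n)"
    proof (rule member_le_sum)
      fix n assume "n \<in> {..m} - {m}"
      then have n: "n \<le> m" by simp
      have "0 \<le> soft_threshold e ((1 / 2) ^ n)"
        using monoD[OF mono_soft_threshold, of 0 "(1 / 2) ^ n" e] soft_threshold_eq_0[of 0 e] e by simp
      moreover have "K n * \<kappa> \<le> 4 ^ n" using order_trans[OF K\<kappa>[OF n] one_le_power[of "4::real" n]] by simp
      ultimately have "0 \<le> soft_threshold e ((1 / 2) ^ n) * (4 ^ n - K n * \<kappa>)" by (intro mult_nonneg_nonneg) auto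
      then show "0 \<le> I n" using I(1)[of n] by linarith
    qed auto
    also have "(\<Sum>n\<le>m. I n) \<le> 2 * pi * C"
    proof -
      have c: "continuous_on circle (\<lambda>z. fejer_deriv X N z * y z)"
        by (intro continuous_intros y continuous_on_fejer_deriv)
      have "(\<Sum>n\<le>m. I n) = integral {\<psi> 0..\<psi> 0 + 2 * pi} (\<lambda>t. Re (fejer_deriv X N (cis t) * y (cis t)))"
        using tot by (simp add: integral_unique D_def[abs_def] Y'_def y_def)
      also have "\<dots> = Re (integral {\<psi> 0..\<psi> 0 + 2 * pi} (\<lambda>t. fejer_deriv X N (cis t) * y (cis t)))"
        using integral_linear[OF integrable_circle_cis[OF c] bounded_linear_Re] by (simp add: o_def)
      also have "integral {\<psi> 0..\<psi> 0 + 2 * pi} (\<lambda>t. fejer_deriv X N (cis t) * y (cis t)) =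
          of_real (2 * pi) * mean (\<lambda>z. fejer_deriv X N z * y z)"
        using mean_shift[OF c, of "\<psi> 0"] by (simp add: scaleR_conv_of_real)
      also have "Re \<dots> \<le> cmod \<dots>" by (rule complex_Re_le_cmod)
      also have "\<dots> = 2 * pi * cmod (mean (\<lambda>z. fejer_deriv X N z * y z))" by (simp add: norm_mult)
      also have "\<dots> \<le> 2 * pi * C"
        unfolding C_def by (intro mult_left_mono norm_mean_fejer_deriv_le y E1 yE) auto
      finally show ?thesis .
    qed
    finally show ?thesis .
  qed
  obtain m where "2 * (2 * pi * C) + 1 < 2 ^ m" using real_arch_pow[of 2 "2 * (2 * pi * C) + 1"] by auto
  with main[of m] show False by simp
qed

lemma bounded_variation_T_necessary:
  fixes f :: "complex \<Rightarrow> real"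
  assumes f: "continuous_on circle f"
    and h: "\<And>g. continuous_on circle g \<Longrightarrow> \<exists>h h'. homeomorphism circle circle h h' \<and> f \<circ> h \<in> W_half \<and> g \<circ> h \<in> W_half"
  shows "bounded_variation_T f"
proof (rule ccontr)
  let ?f = "\<lambda>t. f (cis t)"
  assume "\<not> bounded_variation_T f"
  from detecting_series[OF continuous_on_circle_cis[OF f] not_bounded_variation_T_imp_unbounded[OF this]]
  obtain \<gamma> p q w K where \<gamma>: "continuous_on UNIV \<gamma>"
    and A: "\<And>n::nat. 0 \<le> p n" "\<And>n. p n \<le> q n" "\<And>n. q n \<le> 2 * pi"
      "\<And>n. detects_variation ?f (w n) (p n) (q n) (4 ^ n) (K n)" "\<And>n x. \<bar>w n x\<bar> \<le> 1"
      "\<And>n x. x \<notin> {p n<..<q n} \<Longrightarrow> w n x = 0" "\<And>n x. x \<in> {p n..q n} \<Longrightarrow> \<gamma> x = (1 / 2) ^ n * w n x"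
      "\<And>n k x. n \<noteq> k \<Longrightarrow> x \<in> {p n..q n} \<Longrightarrow> x \<notin> {p k<..<q k}"
      "\<And>x. (\<And>n. x \<notin> {p n<..<q n}) \<Longrightarrow> \<gamma> x = 0"
    by (elim exE conjE) blast
  \<comment> \<open>The open blocks avoid both ends of the period, so \<open>\<gamma>\<close> closes
    up to a continuous function on the circle.\<close>
  have "\<gamma> 0 = 0" "\<gamma> (2 * pi) = 0"
    by (rule A(9), use A(1,3) in \<open>auto simp: not_less\<close>)+
  then obtain g where g: "continuous_on circle g" "\<And>t. t \<in> {0..2*pi} \<Longrightarrow> g (cis t) = \<gamma> t"
    using circle_extension[of \<gamma>] continuous_on_subset[OF \<gamma>] by auto
  obtain h h' where hom: "homeomorphism circle circle h h'" and W: "f \<circ> h \<in> W_half" "g \<circ> h \<in> W_half"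
    using h[OF g(1)] by blast
  have hc: "continuous_on circle h" "h ` circle \<subseteq> circle" using hom by (auto simp: homeomorphism_def)
  have c: "continuous_on circle (f \<circ> h)" "continuous_on circle (g \<circ> h)"
    by (rule continuous_on_compose[OF hc(1)], rule continuous_on_subset[OF _ hc(2)], rule f g(1))+
  obtain \<psi> where \<psi>: "continuous_on {0..2*pi} \<psi>" "\<And>t. t \<in> {0..2*pi} \<Longrightarrow> h (cis (\<psi> t)) = cis t"
    and dir: "strict_mono_on {0..2*pi} \<psi> \<and> \<psi> (2*pi) = \<psi> 0 + 2 * pi \<or>
     strict_antimono_on {0..2*pi} \<psi> \<and> \<psi> (2*pi) = \<psi> 0 - 2 * pi"
    using circle_homeomorphism_lift[OF hom] by blast
  from dir show False
  proof
    assume "strict_mono_on {0..2*pi} \<psi> \<and> \<psi> (2*pi) = \<psi> 0 + 2 * pi"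
    then show False
      using \<psi>(2) g(2)
      by (intro increasing_change_of_variable_contradiction[OF c(1) W(1) c(2) W(2) \<psi>(1) _ _ _ _ A]) auto
  next
    \<comment> \<open>Both functions are composed with the reflection \<open>cnj\<close>, which
      changes the lift to \<open>- \<psi>\<close>.\<close>
    assume d: "strict_antimono_on {0..2*pi} \<psi> \<and> \<psi> (2*pi) = \<psi> 0 - 2 * pi"
    have "strict_mono_on {0..2*pi} (\<lambda>t. - \<psi> t)" using d by (auto simp: monotone_on_def)
    moreover have "continuous_on {0..2*pi} (\<lambda>t. - \<psi> t)" by (intro continuous_intros \<psi>)
    ultimately show False
      using \<psi>(2) g(2) d
      by (intro increasing_change_of_variable_contradiction[OF W_half_comp_cnj[OF c(1) W(1)] W_half_comp_cnj[OF c(2) W(2)] _ _ _ _ _ A,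
            of "\<lambda>t. - \<psi> t"]) (auto simp: cis_cnj)
  qed
qed

subsection \<open>Conformal maps onto star-shaped domains\<close>

text \<open>\<open>N\<close> is the gauge of the star-shaped domain: homogeneous for nonnegative
  factors, continuous and comparable to the modulus. Hence the domain \<open>N w < 1\<close> is
  open, starlike and bounded, and the Riemann mapping theorem applies.\<close>

lemma star_domain_Riemann_map:
  fixes g :: "complex \<Rightarrow> real"
  assumes g: "continuous_on circle g"
  defines "N \<equiv> \<lambda>z. cmod z * exp (- g (sgn z))"
  shows "\<exists>F K. F holomorphic_on ball 0 1 \<and> K holomorphic_on {w. N w < 1} \<and> F 0 = 0 \<and>
     (\<forall>z\<in>ball 0 1. N (F z) < 1 \<and> K (F z) = z) \<and> (\<forall>w. N w < 1 \<longrightarrow> K w \<in> ball 0 1 \<and> F (K w) = w)"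
    and "continuous_on UNIV N" and "bounded {w. N w \<le> 1}"
proof -
  have "bounded (g ` circle)"
    by (intro compact_imp_bounded compact_continuous_image g) simp
  then obtain B where B: "\<And>z. z \<in> circle \<Longrightarrow> \<bar>g z\<bar> \<le> B"
    unfolding bounded_pos real_norm_def by blast
  have sgn: "sgn z \<in> circle" if "z \<noteq> 0" for z :: complex using that by (simp add: norm_sgn)
  have N_bounds: "cmod z * exp (- B) \<le> N z \<and> N z \<le> cmod z * exp B" for z
  proof (cases "z = 0")
    case False
    have "exp (- B) \<le> exp (- g (sgn z))" "exp (- g (sgn z)) \<le> exp B"
      using B[OF sgn[OF False]] by auto
    then show ?thesis unfolding N_def by (intro conjI mult_left_mono) auto
  qed (simp add: N_def)
  have "isCont N z" for z
  proof (cases "z = 0")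
    case True
    \<comment> \<open>The direction \<open>sgn z\<close> has no limit at 0, but \<open>g\<close> is
      bounded on the circle, so the factor \<open>cmod z\<close> decides.\<close>
    have "(N \<longlongrightarrow> 0) (at 0)"
    proof (rule tendsto_sandwich[OF always_eventually always_eventually])
      show "\<forall>z. 0 \<le> N z" by (simp add: N_def)
      show "\<forall>z. N z \<le> cmod z * exp B" using N_bounds by blast
      show "((\<lambda>z. cmod z * exp B) \<longlongrightarrow> 0) (at 0)"
        by (rule tendsto_eq_intros refl | simp)+
    qed auto
    then show ?thesis using True by (simp add: isCont_def N_def)
  next
    case False
    have "continuous_on (- {0}) (\<lambda>z. g (sgn z))"
    proof (rule continuous_on_compose2[OF g])
      show "continuous_on (- {0}) (sgn :: complex \<Rightarrow> complex)" by (intro continuous_intros) simp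
      show "sgn ` (- {0 :: complex}) \<subseteq> circle" using sgn by blast
    qed
    then have "continuous_on (- {0}) N" unfolding N_def by (intro continuous_intros)
    then show ?thesis using False by (simp add: continuous_on_eq_continuous_at open_Compl)
  qed
  then show cont: "continuous_on UNIV N" by (simp add: continuous_on_eq_continuous_at)
  show bdd: "bounded {w. N w \<le> 1}"
  proof (rule boundedI)
    fix w assume "w \<in> {w. N w \<le> 1}"
    then have "cmod w * exp (- B) \<le> 1" using N_bounds[of w] by auto
    then show "cmod w \<le> exp B" by (simp add: exp_minus field_simps)
  qed
  define \<Omega> where "\<Omega> = {w. N w < 1}"
  have N_scale: "N (of_real s * w) = s * N w" if "0 \<le> s" for s w
    using that by (cases "s = 0") (auto simp: N_def norm_mult sgn_mult sgn_of_real)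
  have "open \<Omega>" unfolding \<Omega>_def by (intro open_Collect_less cont continuous_on_const)
  have star: "starlike \<Omega>"
    unfolding starlike_def
  proof (intro bexI[of _ 0] ballI subsetI)
    fix w v assume w: "w \<in> \<Omega>" and "v \<in> closed_segment 0 w"
    then obtain u where u: "0 \<le> u" "u \<le> 1" "v = of_real u * w"
      by (auto simp: closed_segment_def scaleR_conv_of_real)
    then have "N v = u * N w" by (simp add: N_scale)
    also have "\<dots> \<le> N w" using u by (intro mult_left_le_one_le) (auto simp: N_def)
    finally show "v \<in> \<Omega>" using w by (simp add: \<Omega>_def)
  qed (simp add: \<Omega>_def N_def)
  have 0: "0 \<in> \<Omega>" by (simp add: \<Omega>_def N_def)
  have "\<Omega> \<noteq> UNIV"
  proof
    assume "\<Omega> = UNIV"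
    then have "bounded (UNIV :: complex set)" using bounded_subset[OF bdd, of UNIV] by (auto simp: \<Omega>_def intro: less_imp_le)
    then show False by simp
  qed
  then obtain f k where fk: "f holomorphic_on \<Omega>" "k holomorphic_on ball 0 1"
     "\<And>z. z \<in> \<Omega> \<Longrightarrow> f z \<in> ball 0 1 \<and> k (f z) = z" "\<And>z. z \<in> ball 0 1 \<Longrightarrow> k z \<in> \<Omega> \<and> f (k z) = z"
    using iffD1[OF Riemann_mapping_theorem conjI[OF \<open>open \<Omega>\<close> starlike_imp_simply_connected[OF star]]] 0
    by (elim disjE exE conjE) (blast | simp)+
  have a: "f 0 \<in> ball 0 1" using fk(3)[OF 0] by simp
  \<comment> \<open>An automorphism of the disc that moves the image of 0 back to 0.\<close>
  obtain F1 F2 where F: "F1 (f 0) = 0" "F1 holomorphic_on ball 0 1" "F1 ` ball 0 1 \<subseteq> ball 0 1"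
     "F2 holomorphic_on ball 0 1" "F2 ` ball 0 1 \<subseteq> ball 0 1"
     "\<And>z. z \<in> ball 0 1 \<Longrightarrow> F1 (F2 z) = z" "\<And>z. z \<in> ball 0 1 \<Longrightarrow> F2 (F1 z) = z"
    by (rule ball_biholomorphism_exists[OF a]) (rule that)
  have F12: "F1 (f 0) = 0" "F1 holomorphic_on ball 0 1" "F2 holomorphic_on ball 0 1"
     "\<And>w. w \<in> ball 0 1 \<Longrightarrow> F1 w \<in> ball 0 1 \<and> F2 (F1 w) = w" "\<And>w. w \<in> ball 0 1 \<Longrightarrow> F2 w \<in> ball 0 1 \<and> F1 (F2 w) = w"
    using F by blast+
  have "k \<circ> F2 holomorphic_on ball 0 1"
    by (rule holomorphic_on_compose[OF F12(3) holomorphic_on_subset[OF fk(2)]]) (use F12(5) in blast)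
  moreover have "F1 \<circ> f holomorphic_on \<Omega>"
    by (rule holomorphic_on_compose[OF fk(1) holomorphic_on_subset[OF F12(2)]]) (use fk(3) in blast)
  moreover have "(k \<circ> F2) 0 = 0"
    using F12(1) F12(4)[OF a] fk(3)[OF 0] by auto
  moreover have "\<forall>z\<in>ball 0 1. N ((k \<circ> F2) z) < 1 \<and> (F1 \<circ> f) ((k \<circ> F2) z) = z"
  proof (intro ballI conjI)
    fix z :: complex assume z: "z \<in> ball 0 1"
    have "k (F2 z) \<in> \<Omega>" "f (k (F2 z)) = F2 z" using fk(4) F12(5)[OF z] by blast+
    then show "N ((k \<circ> F2) z) < 1" "(F1 \<circ> f) ((k \<circ> F2) z) = z" using F12(5)[OF z] by (auto simp: \<Omega>_def)
  qed
  moreover have "\<forall>w. N w < 1 \<longrightarrow> (F1 \<circ> f) w \<in> ball 0 1 \<and> (k \<circ> F2) ((F1 \<circ> f) w) = w"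
  proof (intro allI impI conjI)
    fix w assume "N w < 1"
    then have "f w \<in> ball 0 1" "k (f w) = w" using fk(3)[of w] by (auto simp: \<Omega>_def)
    then show "(F1 \<circ> f) w \<in> ball 0 1" "(k \<circ> F2) ((F1 \<circ> f) w) = w" using F12(4)[of "f w"] by auto
  qed
  ultimately show "\<exists>F K. F holomorphic_on ball 0 1 \<and> K holomorphic_on {w. N w < 1} \<and> F 0 = 0 \<and>
     (\<forall>z\<in>ball 0 1. N (F z) < 1 \<and> K (F z) = z) \<and> (\<forall>w. N w < 1 \<longrightarrow> K w \<in> ball 0 1 \<and> F (K w) = w)"
    unfolding \<Omega>_def by blast
qed

text \<open>By the Schwarz lemma \<open>K (s F)\<close> does not increase the modulus for \<open>0 < s < 1\<close>; differentiating in
  \<open>s\<close> at \<open>1\<close> gives the classical characterisation of starlike maps.\<close>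

lemma starlike_map_Re_nonneg:
  assumes F: "F holomorphic_on ball 0 1" and K: "K holomorphic_on \<Omega>" and "open \<Omega>"
    and FK: "\<And>z. z \<in> ball 0 1 \<Longrightarrow> F z \<in> \<Omega> \<and> K (F z) = z" and KF: "\<And>w. w \<in> \<Omega> \<Longrightarrow> K w \<in> ball 0 1"
    and star: "\<And>s w. w \<in> \<Omega> \<Longrightarrow> 0 \<le> s \<Longrightarrow> s \<le> 1 \<Longrightarrow> of_real s * w \<in> \<Omega>"
    and F0: "F 0 = 0" and z: "z \<in> ball 0 1" "z \<noteq> 0"
  shows "0 \<le> Re (z * deriv F z / F z)" "deriv F z \<noteq> 0" "F z \<noteq> 0"
proof -
  define w where "w = F z"
  have w: "w \<in> \<Omega>" "K w = z" using FK z by (auto simp: w_def)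
  have K0: "K 0 = 0" using FK[of 0] F0 by simp
  show "F z \<noteq> 0" using w K0 z by (auto simp: w_def)
  have dF: "(F has_field_derivative deriv F z) (at z)"
    using F z by (intro holomorphic_derivI) auto
  have dK: "(K has_field_derivative deriv K w) (at w)"
    using K w \<open>open \<Omega>\<close> by (intro holomorphic_derivI)
  have "((K \<circ> F) has_field_derivative deriv K w * deriv F z) (at z)"
    using dF dK by (intro DERIV_chain) (auto simp: w_def)
  moreover have "((K \<circ> F) has_field_derivative 1) (at z)"
    by (rule has_field_derivative_transform_within_open[of "\<lambda>z. z" _ _ "ball 0 1"]) (use z FK in \<open>auto simp del: mem_ball\<close>)
  ultimately have one: "deriv K w * deriv F z = 1" by (rule DERIV_unique)
  then show nz: "deriv F z \<noteq> 0" by auto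
  have schwarz: "cmod (K (of_real s * w)) \<le> cmod z" if s: "0 \<le> s" "s \<le> 1" for s
  proof -
    have "cmod ((\<lambda>z. K (of_real s * F z)) z) \<le> cmod z"
    proof (rule Schwarz_Lemma(1))
      have "(\<lambda>z. of_real s * F z) ` ball 0 1 \<subseteq> \<Omega>" using star FK s by auto
      moreover have "(\<lambda>z. of_real s * F z) holomorphic_on ball 0 1" by (intro holomorphic_intros F)
      ultimately have "K \<circ> (\<lambda>z. of_real s * F z) holomorphic_on ball 0 1"
        by (metis holomorphic_on_compose holomorphic_on_subset[OF K])
      then show "(\<lambda>z. K (of_real s * F z)) holomorphic_on ball 0 1" by (simp add: o_def)
      show "cmod (K (of_real s * F z)) < 1" if "cmod z < 1" for z
        using KF[OF star[OF _ s, of "F z"]] FK[of z] that by simp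
    qed (use F0 K0 z in auto)
    then show ?thesis by (simp add: w_def)
  qed
  define k where "k s = (cmod (K (of_real s * w)))\<^sup>2" for s
  define D where "D = Re (cnj z * (deriv K w * w))"
  have Kv: "((\<lambda>s. K (of_real s * w)) has_vector_derivative (deriv K w * w)) (at 1)"
  proof -
    have "((\<lambda>s::real. of_real s * w) has_vector_derivative w) (at 1)"
      by (auto intro!: derivative_eq_intros)
    from field_vector_diff_chain_at[OF this, of K "deriv K w"] dK show ?thesis
      by (simp add: o_def mult.commute)
  qed
  have kk: "k s = (Re (K (of_real s * w)))\<^sup>2 + (Im (K (of_real s * w)))\<^sup>2" for s by (simp add: k_def cmod_power2)
  have "(k has_real_derivative 2 * D) (at 1)"
  proof -
    have r: "((\<lambda>s. Re (K (of_real s * w))) has_real_derivative Re (deriv K w * w)) (at 1)"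
      and i: "((\<lambda>s. Im (K (of_real s * w))) has_real_derivative Im (deriv K w * w)) (at 1)"
      using bounded_linear.has_vector_derivative[OF bounded_linear_Re Kv] bounded_linear.has_vector_derivative[OF bounded_linear_Im Kv]
      by (simp_all add: has_real_derivative_iff_has_vector_derivative)
    show ?thesis unfolding kk[abs_def]
      by (rule derivative_eq_intros r i refl)+ (simp add: D_def w)
  qed
  \<comment> \<open>A negative derivative at \<open>s = 1\<close> would make \<open>k\<close> larger
    just below 1, against the Schwarz bound.\<close>
  then have "0 \<le> 2 * D"
  proof (rule contrapos_pp)
    assume "\<not> 0 \<le> 2 * D"
    show "\<not> (k has_real_derivative 2 * D) (at 1)"
    proof
      assume "(k has_real_derivative 2 * D) (at 1)"
      from DERIV_neg_dec_left[OF this] \<open>\<not> 0 \<le> 2 * D\<close>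
      obtain d where d: "d > 0" "\<And>h. h > 0 \<Longrightarrow> h < d \<Longrightarrow> k 1 < k (1 - h)" by auto
      define h where "h = min (d / 2) (1 / 2)"
      have "k 1 < k (1 - h)" using d by (intro d(2)) (auto simp: h_def)
      moreover have "k (1 - h) \<le> k 1"
        using schwarz[of "1 - h"] d w unfolding k_def by (intro power_mono) (auto simp: h_def)
      ultimately show False by simp
    qed
  qed
  moreover have "deriv K w = 1 / deriv F z" using one nz by (simp add: field_simps)
  ultimately have D0: "0 \<le> Re (cnj z * w / deriv F z)" by (simp add: D_def)
  \<comment> \<open>Division by the positive number \<open>(cmod z)\<^sup>2\<close>, and then
    inversion, preserve the sign of the real part.\<close>
  have "0 \<le> Re (w / (z * deriv F z))"
  proof -
    have eq: "cnj z * w / deriv F z = of_real ((cmod z)\<^sup>2) * (w / (z * deriv F z))"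
      using z(2) nz unfolding complex_norm_square by (simp add: field_simps)
    have "Re (of_real a * c) = a * Re c" for a c by simp
    with D0 have "0 \<le> (cmod z)\<^sup>2 * Re (w / (z * deriv F z))" by (simp only: eq)
    then show ?thesis using z by (simp add: zero_le_mult_iff)
  qed
  then have "0 \<le> Re (inverse (w / (z * deriv F z)))"
    unfolding inverse_complex.sel by (intro divide_nonneg_nonneg) auto
  then show "0 \<le> Re (z * deriv F z / F z)" by (simp add: w_def)
qed

text \<open>\<open>G\<close> is a logarithm of \<open>F z / z\<close>, so
  \<open>Re (z * deriv G z)\<close> is the starlikeness quantity minus 1. In place of boundary
  values, properness is used: compact parts of the domain have compact preimages in the disc, so
  \<open>N (F z)\<close> tends to 1 uniformly at the circle.\<close>

lemma star_domain_conformal_log: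
  fixes g :: "complex \<Rightarrow> real"
  assumes g: "continuous_on circle g"
  shows "\<exists>G. G holomorphic_on ball 0 1 \<and> bounded ((\<lambda>z. z * exp (G z)) ` ball 0 1) \<and>
     (\<forall>z\<in>ball 0 1. -1 \<le> Re (z * deriv G z)) \<and>
     (\<forall>e>0. \<exists>r<1. \<forall>z. r < cmod z \<and> cmod z < 1 \<longrightarrow> \<bar>Re (G z) - g (sgn (z * exp (G z)))\<bar> < e)"
proof -
  define N where "N z = cmod z * exp (- g (sgn z))" for z
  note R = star_domain_Riemann_map[OF g, folded N_def]
  obtain F K where FK: "F holomorphic_on ball 0 1" "K holomorphic_on {w. N w < 1}" "F 0 = 0"
     "\<And>z. z \<in> ball 0 1 \<Longrightarrow> N (F z) < 1 \<and> K (F z) = z" "\<And>w. N w < 1 \<Longrightarrow> K w \<in> ball 0 1 \<and> F (K w) = w"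
    using R(1) by blast
  have op: "open {w. N w < 1}" by (intro open_Collect_less R(2) continuous_on_const)
  have sc: "N (of_real s * w) < 1" if "N w < 1" "0 \<le> s" "s \<le> 1" for s w
  proof -
    have "N (of_real s * w) = s * N w"
      using that by (cases "s = 0") (auto simp: N_def norm_mult sgn_mult sgn_of_real)
    also have "\<dots> \<le> N w" using that by (intro mult_left_le_one_le) (auto simp: N_def)
    finally show ?thesis using that by simp
  qed
  have S: "0 \<le> Re (z * deriv F z / F z)" "F z \<noteq> 0" if "z \<in> ball 0 1" "z \<noteq> 0" for z
    using starlike_map_Re_nonneg[OF FK(1,2) op _ _ _ FK(3) that] FK(4,5) sc by auto
  obtain h where h: "h holomorphic_on ball 0 1" "\<And>z. cmod z < 1 \<Longrightarrow> F z = z * h z" "deriv F 0 = h 0"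
    using Schwarz3[OF FK(1,3)] by blast
  \<comment> \<open>At 0 this is \<open>deriv F 0 \<noteq> 0\<close>, from the inverse
    \<open>K\<close>; elsewhere it says that \<open>F\<close> has no further zero.\<close>
  have "h z \<noteq> 0" if z: "z \<in> ball 0 1" for z
  proof (cases "z = 0")
    case True
    have dF: "(F has_field_derivative deriv F 0) (at 0)"
      using FK(1) by (intro holomorphic_derivI) auto
    have N0: "N 0 < 1" by (simp add: N_def)
    have dK: "(K has_field_derivative deriv K 0) (at (F 0))"
      unfolding FK(3) using N0 by (intro holomorphic_derivI[OF FK(2) op]) auto
    have "((K \<circ> F) has_field_derivative deriv K 0 * deriv F 0) (at 0)"
      using dF dK by (intro DERIV_chain) auto
    moreover have "((K \<circ> F) has_field_derivative 1) (at 0)"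
      by (rule has_field_derivative_transform_within_open[of "\<lambda>z. z" _ _ "ball 0 1"]) (use FK(4) in \<open>auto simp del: mem_ball\<close>)
    ultimately have "deriv K 0 * deriv F 0 = 1" by (rule DERIV_unique)
    then show ?thesis using h(3) True by auto
  next
    case False
    then show ?thesis using S(2)[OF z False] h(2)[of z] z by auto
  qed
  then obtain G where G: "G holomorphic_on ball 0 1" "\<And>z. z \<in> ball 0 1 \<Longrightarrow> h z = exp (G z)"
    using simply_connected_imp_holomorphic_log[OF h(1)] convex_imp_simply_connected[OF convex_ball]
      convex_imp_locally_path_connected[OF convex_ball] by metis
  have FG: "F z = z * exp (G z)" if "z \<in> ball 0 1" for z using h(2) G(2) that by simp
  show ?thesis
  proof (intro exI[of _ G] conjI ballI allI impI)
    show "G holomorphic_on ball 0 1" by (rule G)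
    have "(\<lambda>z. z * exp (G z)) ` ball 0 1 \<subseteq> {w. N w \<le> 1}"
      using FG FK(4) by (auto simp del: mem_ball intro: less_imp_le)
    then show "bounded ((\<lambda>z. z * exp (G z)) ` ball 0 1)" using R(3) bounded_subset by blast
  next
    fix z :: complex assume z: "z \<in> ball 0 1"
    show "-1 \<le> Re (z * deriv G z)"
    proof (cases "z = 0")
      case False
      have dG: "(G has_field_derivative deriv G z) (at z)"
        using G(1) z by (intro holomorphic_derivI) auto
      have "(F has_field_derivative exp (G z) + z * (exp (G z) * deriv G z)) (at z)"
        by (rule has_field_derivative_transform_within_open[of "\<lambda>z. z * exp (G z)" _ _ "ball 0 1"])
          (use z FG dG in \<open>auto intro!: derivative_eq_intros simp del: mem_ball\<close>)
      then have "deriv F z = exp (G z) * (1 + z * deriv G z)" by (simp add: DERIV_imp_deriv algebra_simps)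
      then have "z * deriv F z / F z = 1 + z * deriv G z" using FG[OF z] False by simp
      then show ?thesis using S(1)[OF z False] by simp
    qed simp
  next
    fix e :: real assume e: "0 < e"
    define S where "S = {w. N w \<le> exp (- (e / 2))}"
    have "exp (- (e / 2)) < 1" using e by simp
    then have S1: "S \<subseteq> {w. N w < 1}" unfolding S_def using order_le_less_trans by blast
    then have S2: "S \<subseteq> {w. N w \<le> 1}" by (auto intro: less_imp_le)
    have "closed S" unfolding S_def by (intro closed_Collect_le R(2) continuous_on_const)
    then have "compact S" using bounded_subset[OF R(3) S2] by (simp add: compact_eq_bounded_closed)
    then have cK: "compact (K ` S)"
      using holomorphic_on_imp_continuous_on[OF FK(2)] S1 by (intro compact_continuous_image) (auto intro: continuous_on_subset)
    have sub: "K ` S \<subseteq> ball 0 1" using FK(5) S1 by blast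
    obtain r0 where r0: "r0 < 1" "\<And>w. w \<in> K ` S \<Longrightarrow> cmod w \<le> r0"
    proof (cases "K ` S = {}")
      case True
      then show ?thesis using that[of 0] by auto
    next
      case False
      obtain w where "w \<in> K ` S" "\<And>v. v \<in> K ` S \<Longrightarrow> cmod v \<le> cmod w"
        using continuous_attains_sup[OF cK False, of cmod] by (auto intro: continuous_intros)
      then show ?thesis using that[of "cmod w"] sub by auto
    qed
    show "\<exists>r<1. \<forall>z. r < cmod z \<and> cmod z < 1 \<longrightarrow> \<bar>Re (G z) - g (sgn (z * exp (G z)))\<bar> < e"
    \<comment> \<open>Beyond both radii, \<open>ln (N (F z))\<close> and \<open>ln (cmod z)\<close>
      lie between \<open>- e / 2\<close> and 0, and the quantity to be estimated is their
      difference.\<close>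
    proof (intro exI[of _ "max r0 (exp (- (e / 2)))"] conjI allI impI)
      fix z assume z: "max r0 (exp (- (e / 2))) < cmod z \<and> cmod z < 1"
      then have zb: "z \<in> ball 0 1" by simp
      have "z \<noteq> 0" using z less_trans[of 0 "exp (- (e / 2))" "cmod z"] by auto
      have "F z \<notin> S"
      proof
        assume "F z \<in> S"
        then have "K (F z) \<in> K ` S" by blast
        then show False using FK(4)[OF zb] r0(2)[of z] z by auto
      qed
      then have n: "exp (- (e / 2)) < N (F z)" "N (F z) < 1" using FK(4)[OF zb] by (auto simp: S_def)
      have "ln (exp (- (e / 2))) < ln (N (F z))" using n by (subst ln_less_cancel_iff) (auto intro: less_trans[of 0 "exp (- (e / 2))"])
      moreover have "ln (N (F z)) < 0" using n less_trans[OF exp_gt_zero n(1)] by simp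
      moreover have "ln (N (F z)) = ln (cmod z) + Re (G z) - g (sgn (z * exp (G z)))"
        using \<open>z \<noteq> 0\<close> by (simp add: N_def FG[OF zb] norm_mult ln_mult)
      moreover have "ln (exp (- (e / 2))) < ln (cmod z)" using z \<open>z \<noteq> 0\<close> by (subst ln_less_cancel_iff) auto
      moreover have "ln (cmod z) < 0" using z \<open>z \<noteq> 0\<close> by simp
      ultimately show "\<bar>Re (G z) - g (sgn (z * exp (G z)))\<bar> < e" by simp
    qed (use r0 e in auto)
  qed
qed

section \<open>Energy of starlike maps on circles\<close>

lemma has_vector_derivative_mean_0:
  fixes P :: "real \<Rightarrow> 'a::banach"
  assumes "\<And>t. (P has_vector_derivative p (cis t)) (at t)" "P (2 * pi) = P 0"
  shows "mean p = 0"
proof -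
  have "((\<lambda>t. p (cis t)) has_integral P (2*pi) - P 0) {0..2*pi}"
    using assms(1) by (intro fundamental_theorem_of_calculus) (auto intro: has_vector_derivative_at_within)
  then show ?thesis using assms(2) by (simp add: mean_def integral_unique)
qed

text \<open>Cauchy's theorem for \<open>G z * z ^ (n - 1)\<close>; the remaining factor
  \<open>z\<close> comes from the derivative of the circle's parametrization.\<close>

lemma mean_holomorphic_powi:
  assumes G: "G holomorphic_on ball 0 1" and r: "0 < r" "r < 1" and n: "0 < n"
  shows "fc (\<lambda>z. G (of_real r * z)) (- int n) = 0"
proof -
  have "((\<lambda>z. G z * z ^ (n - 1)) has_contour_integral 0) (circlepath 0 r)"
    using r by (intro Cauchy_theorem_disc_simple[of _ 0 1] holomorphic_intros G) auto
  then have "contour_integral (part_circlepath 0 r 0 (2*pi)) (\<lambda>z. G z * z ^ (n - 1)) = 0"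
    by (simp add: contour_integral_unique circlepath_def)
  then have "integral {0..2*pi} (\<lambda>t. G (of_real r * cis t) * (of_real r * cis t) ^ (n - 1) * r * \<i> * cis t) = 0"
    by (subst (asm) contour_integral_part_circlepath_eq) auto
  moreover have "G (of_real r * cis t) * (of_real r * cis t) ^ (n - 1) * r * \<i> * cis t =
      (\<i> * of_real r ^ n) * (G (of_real r * cis t) * cis t ^ n)" for t
  proof -
    obtain j where "n = Suc j" using n by (cases n) auto
    then show ?thesis by (simp only: power_mult_distrib diff_Suc_1 power_Suc mult_ac)
  qed
  ultimately have "integral {0..2*pi} (\<lambda>t. (\<i> * of_real r ^ n) * (G (of_real r * cis t) * cis t ^ n)) = 0"
    by (simp only:)
  then have "(\<i> * of_real r ^ n) * integral {0..2*pi} (\<lambda>t. G (of_real r * cis t) * cis t ^ n) = 0"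
    by (simp only: integral_mult_right)
  then show ?thesis using r by (simp add: fc_def mean_def)
qed

lemma has_vector_derivative_holomorphic_circle:
  assumes G: "G holomorphic_on ball 0 1" and r: "0 < r" "r < 1"
  shows "((\<lambda>t. G (of_real r * cis t)) has_vector_derivative
    \<i> * (of_real r * cis t * deriv G (of_real r * cis t))) (at t)"
proof -
  have "(G has_field_derivative deriv G (of_real r * cis t)) (at (of_real r * cis t))"
    using r by (intro holomorphic_derivI[OF G]) (auto simp: norm_mult)
  moreover have "((\<lambda>t. of_real r * cis t) has_vector_derivative of_real r * (\<i> * cis t)) (at t)"
    by (auto intro!: derivative_eq_intros ext simp: has_vector_derivative_def scaleR_conv_of_real)
  ultimately show ?thesis
    using field_vector_diff_chain_at[of "\<lambda>t. of_real r * cis t"] by (fastforce simp: o_def mult_ac)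
qed

text \<open>Up to the factor of \<open>mean\<close>, the energy is \<open>\<integral> u dv\<close>.
  The derivative \<open>v'\<close> has mean 0 and is at least -1, so
  \<open>\<bar>v'\<bar> \<le> v' + 2\<close> has mean at most 2, whence the bound
  \<open>2 * M\<close>.\<close>

lemma conformal_energy:
  assumes G: "G holomorphic_on ball 0 1" and r: "0 < r" "r < 1"
    and mono: "\<And>z. z \<in> ball 0 1 \<Longrightarrow> -1 \<le> Re (z * deriv G z)"
    and M: "\<And>z. z \<in> circle \<Longrightarrow> \<bar>Re (G (of_real r * z))\<bar> \<le> M"
  defines "u \<equiv> \<lambda>z. complex_of_real (Re (G (of_real r * z)))"
    and "v \<equiv> \<lambda>z. complex_of_real (Im (G (of_real r * z)))"
  shows "continuous_on circle u" "continuous_on circle v"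
    "half_energy v m \<le> 2 * M"
    "half_energy u m \<le> 2 * M"
proof -
  have rb: "of_real r * z \<in> ball 0 1" if "z \<in> circle" for z using that r by (simp add: norm_mult)
  have Gc: "continuous_on circle (\<lambda>z. G (of_real r * z))"
    by (rule continuous_on_compose2[OF holomorphic_on_imp_continuous_on[OF G]]) (use rb in \<open>auto intro!: continuous_intros\<close>)
  have dGc: "continuous_on circle (\<lambda>z. of_real r * z * deriv G (of_real r * z))"
    using rb by (intro continuous_intros continuous_on_compose2[OF holomorphic_on_imp_continuous_on[OF holomorphic_deriv[OF G]]])
      (auto simp del: mem_ball)
  show uc: "continuous_on circle u" and vc: "continuous_on circle v"
    unfolding u_def v_def by (intro continuous_intros Gc)+
  have fcG: "fc (\<lambda>z. G (of_real r * z)) k = fc u k + \<i> * fc v k" for k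
  proof -
    have "fc (\<lambda>z. G (of_real r * z)) k = fc (\<lambda>z. u z + \<i> * v z) k"
      unfolding u_def v_def complex_eq[symmetric] ..
    then show ?thesis by (simp add: fc_add fc_mult_left uc vc continuous_intros)
  qed
  \<comment> \<open>Holomorphy leaves no negative frequencies in \<open>u + \<i> v\<close>; together
    with reality this links the coefficients of \<open>u\<close> and \<open>v\<close> by a factor of
    modulus 1 at every \<open>k \<noteq> 0\<close>.\<close>
  have neg: "fc u k = - \<i> * fc v k" if "k < 0" for k
  proof -
    have "fc u k + \<i> * fc v k = 0"
      using mean_holomorphic_powi[OF G r, of "nat (- k)"] that by (simp flip: fcG)
    then show ?thesis by (simp add: eq_neg_iff_add_eq_0)
  qed
  have cnju: "fc u (-k) = cnj (fc u k)" and cnjv: "fc v (-k) = cnj (fc v k)" for k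
    using fc_cnj[OF uc, of "-k"] fc_cnj[OF vc, of "-k"] by (simp_all add: u_def v_def)
  have pos: "fc u k = \<i> * fc v k" if "k > 0" for k
    using neg[of "-k"] cnju[of "-k"] cnjv[of k] that by simp
  have "cmod (fc u k) = cmod (fc v k)" if "k \<noteq> 0" for k
    using pos[of k] neg[of k] that by (cases "k > 0") (auto simp: norm_mult)
  then have same: "half_energy u m = half_energy v m" for m
    by (intro sum.cong refl) (metis abs_0 mult_zero_left of_int_0)
  define e where "e m = half_energy v m" for m :: nat
  have e_mono: "e m \<le> e m'" if "m \<le> m'" for m m'
    unfolding e_def using that by (intro sum_mono2) auto
  have e0: "0 \<le> e m" for m unfolding e_def by (intro sum_nonneg) auto
  define v' where "v' z = Re (of_real r * z * deriv G (of_real r * z))" for z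
  have v'c: "continuous_on circle v'" unfolding v'_def by (intro continuous_intros dGc)
  have dv: "((\<lambda>t. v (cis t)) has_vector_derivative complex_of_real (v' (cis t))) (at t)" for t
  proof -
    note has_vector_derivative_holomorphic_circle[OF G r, of t]
    from bounded_linear.has_vector_derivative[OF bounded_linear_of_real bounded_linear.has_vector_derivative[OF bounded_linear_Im this]]
    show ?thesis unfolding v_def v'_def by (simp add: algebra_simps)
  qed
  have v'0: "mean v' = 0"
  proof -
    have "mean (\<lambda>z. complex_of_real (v' z)) = 0" by (rule has_vector_derivative_mean_0[OF dv]) simp
    then show ?thesis by (simp add: mean_of_real v'c)
  qed
  have avg: "(\<Sum>m\<le>N. e m) \<le> 2 * M * real (Suc N)" for N
  proof -
    have "mean (\<lambda>z. fejer_deriv u N z * v z) = - of_real (\<Sum>m\<le>N. e m) / of_nat (Suc N)"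
    proof -
      have "\<i> * of_int k * fc u k * fc v (-k) = - of_real (\<bar>of_int k\<bar> * (cmod (fc v k))\<^sup>2)" for k
      proof -
        consider "k = 0" | "k > 0" | "k < 0" by linarith
        then show ?thesis
        proof cases
          case 2
          have "\<i> * of_int k * (\<i> * x) * y = (\<i> * \<i>) * (of_int k * (x * y))" for x y :: complex
            by (simp only: mult_ac)
          then show ?thesis using 2 unfolding of_real_mult complex_norm_square cnjv pos[OF 2] by simp
        next
          case 3
          have "\<i> * of_int k * (- \<i> * x) * y = (\<i> * \<i>) * (- of_int k * (x * y))" for x y :: complex
            by (simp add: mult_ac)
          then show ?thesis using 3 unfolding of_real_mult complex_norm_square cnjv neg[OF 3] by simp
        qed simp
      qed
      then show ?thesis unfolding mean_fejer_deriv_mult[OF vc] e_def by (simp add: sum_negf)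
    qed
    \<comment> \<open>Integration by parts moves the derivative to \<open>v\<close>, where its sign
      is under control, and leaves the Fejer sum of \<open>u\<close>, bounded by
      \<open>M\<close>.\<close>
    moreover have "mean (\<lambda>z. fejer_deriv u N z * v z) = - mean (\<lambda>z. fejer_sum u N z * of_real (v' z))"
    proof -
      have "mean (\<lambda>z. fejer_deriv u N z * v z + fejer_sum u N z * of_real (v' z)) = 0"
        by (rule has_vector_derivative_mean_0[of "\<lambda>t. fejer_sum u N (cis t) * v (cis t)"])
          (auto intro!: has_vector_derivative_mult[THEN has_vector_derivative_eq_rhs] has_vector_derivative_fejer_sum dv)
      then show ?thesis
        by (subst (asm) mean_add)
          (auto intro!: continuous_intros continuous_on_fejer_deriv continuous_on_fejer_sum vc v'c simp: add_eq_0_iff2)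
    qed
    ultimately have eq: "of_real (\<Sum>m\<le>N. e m) / of_nat (Suc N) = mean (\<lambda>z. fejer_sum u N z * of_real (v' z))" by simp
    have "(\<Sum>m\<le>N. e m) / real (Suc N) = cmod (of_real (\<Sum>m\<le>N. e m) / of_nat (Suc N))"
      using e0 by (simp add: norm_divide sum_nonneg del: of_nat_Suc of_real_sum)
    also have "\<dots> \<le> mean (\<lambda>z. cmod (fejer_sum u N z * of_real (v' z)))"
      unfolding eq by (intro norm_mean_le continuous_intros continuous_on_fejer_sum v'c)
    also have "\<dots> \<le> mean (\<lambda>z. M * (v' z + 2))"
    proof (intro mean_mono continuous_intros continuous_on_fejer_sum v'c)
      fix z assume z: "z \<in> circle"
      have "\<bar>v' z\<bar> \<le> v' z + 2" using mono[OF rb[OF z]] unfolding v'_def by (simp add: abs_if)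
      moreover have "cmod (fejer_sum u N z) \<le> M"
        by (rule norm_fejer_sum_le[OF uc z]) (use M in \<open>auto simp: u_def\<close>)
      moreover have "0 \<le> M" using M[of 1] by simp
      ultimately show "cmod (fejer_sum u N z * of_real (v' z)) \<le> M * (v' z + 2)"
        by (auto simp: norm_mult intro!: mult_mono)
    qed
    also have "\<dots> = 2 * M"
      using mean_mult_left[of "\<lambda>z. v' z + 2" M] by (simp add: mean_add v'c v'0 continuous_intros)
    finally show ?thesis by (simp add: divide_le_eq)
  qed
  \<comment> \<open>Only the averages of \<open>e\<close> are bounded so far. As \<open>e\<close>
    increases, \<open>e m\<close> is at most the average over a long block starting at
    \<open>m\<close>, and the \<open>m\<close> earlier terms become negligible.\<close>
  have "e m \<le> 2 * M" for m
  proof (rule field_le_epsilon)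
    fix d :: real assume d: "0 < d"
    obtain L :: nat where L: "real m * e m / d < real L" using reals_Archimedean2 by blast
    have "real (Suc L) * e m \<le> (\<Sum>j\<in>{m..m + L}. e j)"
      using sum_mono[of "{m..m + L}" "\<lambda>_. e m" e] e_mono by simp
    also have "\<dots> \<le> (\<Sum>j\<le>m + L. e j)" using e0 by (intro sum_mono2) auto
    also have "\<dots> \<le> 2 * M * real (Suc (m + L))" by (rule avg)
    finally have 1: "real (Suc L) * e m \<le> 2 * M * real (Suc (m + L))" .
    have M0: "0 \<le> M" using M[of 1] by simp
    have "real m * e m \<le> d * real (Suc L)" using L d by (simp add: field_simps)
    then have "real (Suc (m + L)) * e m \<le> 2 * M * real (Suc (m + L)) + d * real (Suc L)"
      using 1 by (simp add: algebra_simps)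
    also have "\<dots> \<le> real (Suc (m + L)) * (2 * M + d)" using d by (simp add: algebra_simps)
    finally show "e m \<le> 2 * M + d" by (subst (asm) mult_le_cancel_left_pos) auto
  qed
  then show "half_energy v m \<le> 2 * M"
    "half_energy u m \<le> 2 * M"
    unfolding same by (simp_all add: e_def)
qed

section \<open>Equicontinuity, uniform limits and flat arcs\<close>

text \<open>At \<open>z = cis t\<close>, the term \<open>v (cis (s n) * z) - v z + s n\<close> is
  the increment of the lift \<open>t + v (cis t)\<close> over the step \<open>s n\<close>; unlike
  the lift itself, it is a function on the circle.\<close>

lemma mean_lift_increment_le:
  fixes v :: "complex \<Rightarrow> real"
  assumes v: "continuous_on circle v"
  defines "s \<equiv> \<lambda>n. pi / 2 ^ n"
  shows "continuous_on circle (\<lambda>z. (v (cis (s n) * z) - v z + s n)\<^sup>2)"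
    "mean (\<lambda>z. (v (cis (s n) * z) - v z + s n)\<^sup>2) \<le> 2 * dyadic_increment (\<lambda>z. of_real (v z)) n + 2 * (s n)\<^sup>2"
proof -
  have vc: "continuous_on circle (\<lambda>z. v (cis (s n) * z))"
    using continuous_on_circle_rotate[OF v, of "cis (s n)"] by simp
  show Ic: "continuous_on circle (\<lambda>z. (v (cis (s n) * z) - v z + s n)\<^sup>2)"
    by (intro continuous_intros vc v)
  let ?d = "\<lambda>z. (cmod (of_real (v (cis (s n) * z)) - of_real (v z)))\<^sup>2"
  have c: "continuous_on circle ?d" by (intro continuous_intros vc v)
  have "mean (\<lambda>z. (v (cis (s n) * z) - v z + s n)\<^sup>2) \<le> mean (\<lambda>z. 2 * ?d z + 2 * (s n)\<^sup>2)"
  proof (intro mean_mono Ic)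
    show "continuous_on circle (\<lambda>z. 2 * ?d z + 2 * (s n)\<^sup>2)" by (intro continuous_intros c)
    fix z
    have "(v (cis (s n) * z) - v z + s n)\<^sup>2 \<le> 2 * (v (cis (s n) * z) - v z)\<^sup>2 + 2 * (s n)\<^sup>2"
      using sum_squares_bound[of "v (cis (s n) * z) - v z" "s n"] by (simp add: power2_sum)
    then show "(v (cis (s n) * z) - v z + s n)\<^sup>2 \<le> 2 * ?d z + 2 * (s n)\<^sup>2"
      by (simp flip: of_real_diff)
  qed
  also have "\<dots> = 2 * mean ?d + 2 * (s n)\<^sup>2"
    using mean_mult_left[OF c, of 2] by (subst mean_add) (intro continuous_intros c | simp)+
  finally show "mean (\<lambda>z. (v (cis (s n) * z) - v z + s n)\<^sup>2) \<le> 2 * dyadic_increment (\<lambda>z. of_real (v z)) n + 2 * (s n)\<^sup>2"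
    unfolding dyadic_increment_def s_def .
qed

text \<open>Courant--Lebesgue: an increase by \<open>\<eta>\<close> over an interval shorter than \<open>2\<^sup>-\<^sup>m\<close> contributes about
  \<open>\<eta>\<^sup>2\<close> to each of the first \<open>m\<close> dyadic terms.\<close>

lemma monotone_lift_modulus:
  fixes v :: "complex \<Rightarrow> real" and H :: "real \<Rightarrow> real"
  assumes v: "continuous_on circle v" and H: "\<And>t. H t = t + v (cis t)" and mono: "mono H"
    and E: "\<And>N. (\<Sum>n<N. 2 ^ n * dyadic_increment (\<lambda>z. of_real (v z)) n) \<le> E"
    and ab: "a \<le> b" "b - a \<le> pi / 2 ^ Suc m"
  shows "(H b - H a)\<^sup>2 \<le> (8 * E + 16 * pi\<^sup>2) / real (Suc m)"
proof -
  define s where "s n = pi / 2 ^ n" for n :: nat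
  have "(H b - H a)\<^sup>2 \<le> 8 * (2 ^ n * dyadic_increment (\<lambda>z. of_real (v z)) n) + 8 * pi\<^sup>2 * (1 / 2) ^ n" if n: "n \<le> m" for n
  proof -
    define I where "I = (\<lambda>z. (v (cis (s n) * z) - v z + s n)\<^sup>2)"
    have Ic: "continuous_on circle I" unfolding I_def s_def by (rule mean_lift_increment_le[OF v])
    have Icis: "I (cis t) = (H (t + s n) - H t)\<^sup>2" for t
      unfolding I_def H by (simp add: cis_mult add.commute algebra_simps)
    have s0: "0 < s n" by (simp add: s_def)
    have ba: "2 * (b - a) \<le> s n"
    proof -
      have "(2::real) ^ Suc n \<le> 2 ^ Suc m" using n by (intro power_increasing) auto
      then have "pi / 2 ^ Suc m \<le> pi / 2 ^ Suc n" by (intro divide_left_mono) auto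
      then show ?thesis using ab by (simp add: s_def)
    qed
    have "pi * 1 \<le> 2 * pi * 2 ^ n" by (intro mult_mono) auto
    then have s2: "s n \<le> 2 * pi" by (simp add: s_def divide_le_eq)
    \<comment> \<open>For \<open>t\<close> between \<open>b - s n\<close> and \<open>a\<close>, the
      interval from \<open>t\<close> to \<open>t + s n\<close> contains \<open>{a..b}\<close>, so
      the monotone \<open>H\<close> gains at least \<open>H b - H a\<close> there. Such
      \<open>t\<close> fill a length of at least \<open>s n / 2\<close>.\<close>
    have "(s n / 2) * (H b - H a)\<^sup>2 \<le> (a - (b - s n)) * (H b - H a)\<^sup>2"
      using ba by (intro mult_right_mono) auto
    also have "\<dots> = integral {b - s n..a} (\<lambda>t. (H b - H a)\<^sup>2)"
      using ba ab s0 by simp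
    also have "\<dots> \<le> integral {b - s n..a} (\<lambda>t. I (cis t))"
    proof (rule integral_le)
      fix t assume t: "t \<in> {b - s n..a}"
      have "H b - H a \<le> H (t + s n) - H t" "0 \<le> H b - H a"
        using t ab monoD[OF mono, of b "t + s n"] monoD[OF mono, of t a] monoD[OF mono, of a b] by auto
      then show "(H b - H a)\<^sup>2 \<le> I (cis t)" unfolding Icis by (intro power_mono) auto
    qed (auto intro: integrable_circle_cis Ic)
    also have "\<dots> \<le> integral {b - s n..b - s n + 2 * pi} (\<lambda>t. I (cis t))"
      using ba s2 ab by (intro integral_subset_le integrable_circle_cis Ic) (auto simp: I_def)
    also have "\<dots> = 2 * pi * mean I" using mean_shift[OF Ic, of "b - s n"] by simp
    also have "mean I \<le> 2 * dyadic_increment (\<lambda>z. of_real (v z)) n + 2 * (s n)\<^sup>2"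
      unfolding I_def s_def by (rule mean_lift_increment_le[OF v])
    finally have "(s n / 2) * (H b - H a)\<^sup>2 \<le> 2 * pi * (2 * dyadic_increment (\<lambda>z. of_real (v z)) n + 2 * (s n)\<^sup>2)"
      by (simp add: mult_left_mono)
    \<comment> \<open>The factor is \<open>2 / s n\<close>; it turns the right-hand side into a term
      of the weighted dyadic sum plus a summable remainder.\<close>
    then have "(2 * 2 ^ n / pi) * ((s n / 2) * (H b - H a)\<^sup>2) \<le>
        (2 * 2 ^ n / pi) * (2 * pi * (2 * dyadic_increment (\<lambda>z. of_real (v z)) n + 2 * (s n)\<^sup>2))"
      by (intro mult_left_mono) auto
    moreover have "(2 * 2 ^ n / pi) * ((s n / 2) * (H b - H a)\<^sup>2) = (H b - H a)\<^sup>2"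
      by (simp add: s_def)
    moreover have "(2 * 2 ^ n / pi) * (2 * pi * (2 * dyadic_increment (\<lambda>z. of_real (v z)) n + 2 * (s n)\<^sup>2)) =
        8 * (2 ^ n * dyadic_increment (\<lambda>z. of_real (v z)) n) + 8 * pi\<^sup>2 * (1 / 2) ^ n"
      by (simp add: s_def power_divide power2_eq_square field_simps)
    ultimately show ?thesis by simp
  qed
  then have "(\<Sum>n\<le>m. (H b - H a)\<^sup>2) \<le> (\<Sum>n\<le>m. 8 * (2 ^ n * dyadic_increment (\<lambda>z. of_real (v z)) n) + 8 * pi\<^sup>2 * (1 / 2) ^ n)"
    by (intro sum_mono) auto
  also have "\<dots> = 8 * (\<Sum>n<Suc m. 2 ^ n * dyadic_increment (\<lambda>z. of_real (v z)) n) + 8 * pi\<^sup>2 * (\<Sum>n<Suc m. (1 / 2) ^ n)"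
    unfolding lessThan_Suc_atMost by (simp add: sum.distrib sum_distrib_left)
  also have "\<dots> \<le> 8 * E + 8 * pi\<^sup>2 * 2"
  proof (intro add_mono mult_left_mono E)
    show "(\<Sum>n<Suc m. (1 / 2::real) ^ n) \<le> 2" by (subst geometric_sum) (auto simp: field_simps)
  qed auto
  finally show ?thesis by (simp add: field_simps)
qed

text \<open>Lower semicontinuity: each truncated energy involves finitely many coefficients, and
  these converge under uniform approximation.\<close>

lemma energy_le_uniform_limit:
  assumes xj: "\<And>j. continuous_on circle (x j)" and x: "continuous_on circle y"
    and lim: "\<And>e. 0 < e \<Longrightarrow> \<exists>j. \<forall>z\<in>circle. cmod (x j z - y z) < e"
    and E: "\<And>j. half_energy (x j) m \<le> E"
  shows "half_energy y m \<le> E"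
proof -
  have "\<exists>j. \<forall>z\<in>circle. cmod (x j z - y z) < 1 / real (Suc n) / 2" for n by (rule lim) simp
  then obtain J where J: "\<And>n z. z \<in> circle \<Longrightarrow> cmod (x (J n) z - y z) < 1 / real (Suc n) / 2" by metis
  have "(\<lambda>n. fc (x (J n)) k) \<longlonglongrightarrow> fc y k" for k
  proof (rule LIMSEQ_norm_0[of "\<lambda>n. fc (x (J n)) k - fc y k", THEN LIM_zero_cancel])
    fix n
    have "cmod (fc (\<lambda>z. x (J n) z - y z) k) \<le> 1 / real (Suc n) / 2"
      using J[of _ n] by (intro norm_fc_le continuous_intros xj x less_imp_le)
    also have "\<dots> < 1 / real (Suc n)" by (simp add: field_simps)
    finally show "cmod (fc (x (J n)) k - fc y k) < 1 / real (Suc n)" by (simp only: fc_diff[OF xj x])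
  qed
  then have "(\<lambda>n. \<Sum>k\<in>{-int m..int m}. \<bar>of_int k\<bar> * (cmod (fc (x (J n)) k))\<^sup>2) \<longlonglongrightarrow>
      half_energy y m"
    by (intro tendsto_intros)
  then show ?thesis by (rule LIMSEQ_le_const2) (use E in auto)
qed

text \<open>If \<open>f\<close> tended to \<open>c\<close> along an arc, the product of sufficiently many rotated copies of
  \<open>f - c\<close> would tend to \<open>0\<close> on whole circles, contradicting its value \<open>(-c)\<^sup>m\<close> at the centre.\<close>

lemma no_constant_arc:
  assumes f: "f holomorphic_on ball 0 1" and bdd: "bounded (f ` ball 0 1)" and f0: "f 0 = 0" and c: "c \<noteq> 0"
    and ab: "a < b"
    and arc: "\<And>e. 0 < e \<Longrightarrow> \<exists>r. 0 < r \<and> r < 1 \<and> (\<forall>t\<in>{a..b}. cmod (f (of_real r * cis t) - c) < e)"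
  shows False
proof -
  obtain B0 where B0: "\<And>z. z \<in> ball 0 1 \<Longrightarrow> cmod (f z) \<le> B0" using bdd unfolding bounded_iff by blast
  define B where "B = B0 + cmod c + 1"
  have B: "cmod (f z - c) \<le> B" if "z \<in> ball 0 1" for z
    using B0[OF that] norm_triangle_ineq4[of "f z" c] by (simp add: B_def)
  have B1: "1 \<le> B" using B0[of 0] f0 by (simp add: B_def)
  \<comment> \<open>With rotations by multiples of \<open>2 * pi / n\<close> and
    \<open>2 * pi / n \<le> b - a\<close>, every point of a circle has a rotated copy on the
    arc.\<close>
  obtain n :: nat where n: "2 * pi / (b - a) < real n" using reals_Archimedean2 by blast
  then have n0: "0 < n" using ab by (cases n) (auto simp: divide_less_0_iff)
  have n1: "2 * pi / real n \<le> b - a" using n n0 ab by (simp add: field_simps)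
  define \<omega> where "\<omega> l = cis (2 * pi * real l / real n)" for l :: nat
  define P where "P z = (\<Prod>l<n. f (\<omega> l * z) - c)" for z
  have rot: "\<omega> l * z \<in> ball 0 1" if "z \<in> ball 0 1" for l z using that by (simp add: norm_mult \<omega>_def)
  have hol: "P holomorphic_on ball 0 1"
    unfolding P_def
  proof (intro holomorphic_intros)
    fix l
    have "f \<circ> (\<lambda>z. \<omega> l * z) holomorphic_on ball 0 1"
      by (rule holomorphic_on_compose[OF _ holomorphic_on_subset[OF f]]) (use rot in \<open>auto intro!: holomorphic_intros simp del: mem_ball\<close>)
    then show "(\<lambda>z. f (\<omega> l * z)) holomorphic_on ball 0 1" by (simp add: o_def)
  qed
  have P0: "cmod (P 0) = cmod c ^ n" by (simp add: P_def f0 norm_power)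
  have small: "cmod c ^ n \<le> B ^ n * e" if e: "0 < e" for e
  proof -
    obtain r where r: "0 < r" "r < 1" "\<And>t. t \<in> {a..b} \<Longrightarrow> cmod (f (of_real r * cis t) - c) < e"
      using arc[OF e] by blast
    have "cmod (P 0) \<le> B ^ n * e"
    proof (rule maximum_modulus_frontier[of P "ball 0 r"])
      show "P holomorphic_on interior (ball 0 r)"
        using r by (intro holomorphic_on_subset[OF hol]) auto
      show "continuous_on (closure (ball 0 r)) P"
        using r by (intro continuous_on_subset[OF holomorphic_on_imp_continuous_on[OF hol]]) auto
      fix z :: complex assume "z \<in> frontier (ball 0 r)"
      then have z: "cmod z = r" using r by (simp add: frontier_ball)
      then have zb: "z \<in> ball 0 1" using r by simp
      define \<theta> where "\<theta> = Arg z"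
      have z': "z = of_real r * cis \<theta>" using z rcis_cmod_Arg[of z] by (simp add: \<theta>_def rcis_def)
      \<comment> \<open>The least number of rotation steps that brings the angle
        \<open>\<theta>\<close> to at least \<open>a\<close>; the overshoot is less than one
        step.\<close>
      define q where "q = \<lceil>(a - \<theta>) * real n / (2 * pi)\<rceil>"
      define l where "l = nat (q mod int n)"
      have l: "l < n" using n0 by (simp add: l_def nat_less_iff)
      have \<omega>l: "\<omega> l = cis (2 * pi * of_int q / real n)"
      proof -
        have "real_of_int q = real l + real n * of_int (q div int n)"
        proof -
          have "q = int l + int n * (q div int n)"
            using n0 mult_div_mod_eq[of "int n" q] by (simp add: l_def)
          then have "real_of_int q = real_of_int (int l + int n * (q div int n))" by (rule arg_cong)
          then show ?thesis by simp
        qed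
        then have "2 * pi * of_int q / real n = 2 * pi * real l / real n + 2 * pi * of_int (q div int n)"
          using n0 by (simp add: field_simps)
        then show ?thesis by (simp add: \<omega>_def flip: cis_mult)
      qed
      define t where "t = \<theta> + 2 * pi * of_int q / real n"
      have "(a - \<theta>) * real n / (2 * pi) \<le> of_int q" "of_int q < (a - \<theta>) * real n / (2 * pi) + 1"
        unfolding q_def by linarith+
      then have "a - \<theta> \<le> 2 * pi * of_int q / real n" "2 * pi * of_int q / real n < a - \<theta> + 2 * pi / real n"
        using n0 by (simp_all add: field_simps)
      then have t: "t \<in> {a..b}" using n1 by (simp add: t_def)
      have "\<omega> l * z = of_real r * cis t" by (simp add: \<omega>l z' t_def cis_mult mult_ac add_ac)
      then have fe: "cmod (f (\<omega> l * z) - c) < e" using r(3)[OF t] by simp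
      have "cmod (P z) = cmod (f (\<omega> l * z) - c) * (\<Prod>l\<in>{..<n} - {l}. cmod (f (\<omega> l * z) - c))"
        unfolding P_def prod_norm[symmetric] using l by (subst prod.remove[of _ l]) auto
      also have "\<dots> \<le> e * B ^ n"
      proof (rule mult_mono)
        have "(\<Prod>l\<in>{..<n} - {l}. cmod (f (\<omega> l * z) - c)) \<le> (\<Prod>l\<in>{..<n} - {l}. B)"
          using B[OF rot[OF zb]] by (intro prod_mono) auto
        also have "\<dots> \<le> B ^ n" using B1 l by (simp add: power_increasing)
        finally show "(\<Prod>l\<in>{..<n} - {l}. cmod (f (\<omega> l * z) - c)) \<le> B ^ n" .
      qed (use fe e in \<open>auto intro: prod_nonneg\<close>)
      finally show "cmod (P z) \<le> B ^ n * e" by (simp add: mult.commute)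
    qed (use r in auto)
    with P0 show ?thesis by simp
  qed
  have Bn: "0 < B ^ n" using B1 by simp
  have cn: "0 < cmod c ^ n" using c by simp
  \<comment> \<open>This choice of \<open>e\<close> makes the upper bound half of the positive lower
    bound.\<close>
  have "cmod c ^ n \<le> B ^ n * (cmod c ^ n / (2 * B ^ n))" using Bn cn by (intro small) simp
  also have "\<dots> = cmod c ^ n / 2" using B1 by simp
  finally show False using cn by simp
qed

lemma circle_param:
  assumes "z \<in> circle"
  shows "\<exists>t\<in>{0..<2*pi}. z = cis t"
  using assms Arg2pi_ge_0[of z] Arg2pi_lt_2pi[of z]
  by (intro bexI[of _ "Arg2pi z"]) (auto simp: complex_norm_eq_1_exp cis_conv_exp)

text \<open>A total increase of exactly one turn gives injectivity modulo \<open>2 * pi\<close> and,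
  by the intermediate value theorem, surjectivity; compactness makes the inverse continuous.\<close>

lemma lift_homeomorphism:
  assumes H: "continuous_on {0..2*pi} H" "strict_mono_on {0..2*pi} H" "H (2*pi) = H 0 + 2 * pi"
  shows "\<exists>h h'. homeomorphism circle circle h h' \<and> (\<forall>t\<in>{0..2*pi}. h (cis t) = cis (H t))"
proof -
  have "continuous_on {0..2*pi} (\<lambda>t. cis (H t))" by (intro continuous_intros H)
  moreover have "cis (H (2*pi)) = cis (H 0)" by (simp add: H(3) flip: cis_mult)
  ultimately obtain h where h: "continuous_on circle h" "\<And>t. t \<in> {0..2*pi} \<Longrightarrow> h (cis t) = cis (H t)"
    using circle_extension[of "\<lambda>t. cis (H t)"] by blast
  have "inj_on h circle"
  proof (rule inj_onI)
    fix z w assume zw: "z \<in> circle" "w \<in> circle" "h z = h w"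
    obtain s t where st: "s \<in> {0..<2*pi}" "z = cis s" "t \<in> {0..<2*pi}" "w = cis t" using circle_param zw(1,2) by metis
    have Hst: "H s \<in> {H 0..<H 0 + 2 * pi}" "H t \<in> {H 0..<H 0 + 2 * pi}"
      using st(1,3) strict_mono_on_leD[OF H(2), of 0] strict_mono_onD[OF H(2), of _ "2*pi"]
      unfolding H(3)[symmetric] by simp_all
    have "cis (H s) = cis (H t)" using h(2)[of s] h(2)[of t] st zw(3) by simp
    then have "H s = H t" using inj_onD[OF cis_inj_on _ Hst] by blast
    then have "s = t" using strict_mono_on_eqD[OF H(2), of s t] st by auto
    with st show "z = w" by simp
  qed
  moreover have "h ` circle = circle"
  proof (intro equalityI subsetI)
    fix w assume "w \<in> h ` circle"
    then obtain z where "z \<in> circle" "w = h z" by blast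
    moreover obtain t where "t \<in> {0..<2*pi}" "z = cis t" using circle_param calculation(1) by blast
    ultimately show "w \<in> circle" using h(2)[of t] by simp
  next
    fix w :: complex assume w: "w \<in> circle"
    have "cis (- H 0) * w \<in> circle" using w by (simp add: norm_mult)
    then obtain t where t: "t \<in> {0..<2*pi}" "cis (- H 0) * w = cis t" using circle_param by blast
    have w': "w = cis (H 0 + t)"
    proof -
      have "w = cis (H 0) * (cis (- H 0) * w)" by (simp add: mult.assoc[symmetric] cis_mult)
      then show ?thesis by (simp add: t cis_mult)
    qed
    obtain s where s: "0 \<le> s" "s \<le> 2*pi" "H s = H 0 + t"
      using IVT'[of H 0 "H 0 + t" "2*pi"] t(1) H by auto
    then have "w = h (cis s)" using h(2)[of s] w' by simp
    then show "w \<in> h ` circle" by auto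
  qed
  ultimately obtain h' where "homeomorphism circle circle h h'"
    using homeomorphism_compact[of circle h circle] h(1) by auto
  with h(2) show ?thesis by blast
qed

subsection \<open>Sufficiency of bounded variation\<close>

text \<open>Repeated points are dropped, as \<open>bounded_variation_T\<close> speaks of strictly
  increasing partitions.\<close>

lemma variation_sum_partition:
  assumes "variation_sum f a b s"
  shows "\<exists>n t. t 0 = a \<and> t n = b \<and> (\<forall>i<n. t i < t (Suc i)) \<and> s = (\<Sum>i<n. \<bar>f (t (Suc i)) - f (t i)\<bar>)"
  using assms
proof (induction rule: variation_sum.induct)
  case empty
  show ?case by (rule exI[of _ 0], rule exI[of _ "\<lambda>_. a"]) simp
next
  case (snoc b s c)
  then obtain n t where t: "t 0 = a" "t n = b" "\<forall>i<n. t i < t (Suc i)" "s = (\<Sum>i<n. \<bar>f (t (Suc i)) - f (t i)\<bar>)"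
    by blast
  show ?case
  proof (cases "b = c")
    case True
    with t show ?thesis by (intro exI[of _ n] exI[of _ t]) simp
  next
    case False
    define t' where "t' = t(Suc n := c)"
    have "t' i = t i" if "i \<le> n" for i using that by (simp add: t'_def)
    moreover have "t' (Suc n) = c" by (simp add: t'_def)
    moreover have "(\<Sum>i<n. \<bar>f (t' (Suc i)) - f (t' i)\<bar>) = (\<Sum>i<n. \<bar>f (t (Suc i)) - f (t i)\<bar>)"
      by (intro sum.cong refl) (simp add: t'_def)
    ultimately show ?thesis using t False snoc.hyps
      by (intro exI[of _ "Suc n"] exI[of _ t']) (auto simp: less_Suc_eq)
  qed
qed

text \<open>From \<open>sin y = 2 * sin (y / 2) * cos (y / 2)\<close> and the mean value theorem:
  both cosines are at least \<open>cos (pi / 4)\<close>, whose square is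
  \<open>1 / 2\<close>.\<close>

lemma sin_ge_half:
  assumes "0 \<le> y" "y \<le> pi / 2"
  shows "y / 2 \<le> sin y"
proof (cases "y = 0")
  case False
  then have y: "0 < y / 2" using assms by simp
  obtain z where z: "0 < z" "z < y / 2" "sin (y / 2) - sin 0 = (y / 2 - 0) * cos z"
    using MVT2[OF y, of sin cos] by (auto intro: DERIV_sin)
  have c: "cos (pi / 4) \<le> cos z" "cos (pi / 4) \<le> cos (y / 2)"
    using z assms by (auto intro!: cos_monotone_0_pi_le)
  have c0: "0 \<le> cos (pi / 4)" by (simp add: cos_45)
  have "y / 2 = 2 * (y / 2 * cos (pi / 4)) * cos (pi / 4)" by (simp add: cos_45)
  also have "\<dots> \<le> 2 * (y / 2 * cos z) * cos (y / 2)"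
    using c c0 y by (intro mult_mono) auto
  also have "\<dots> = sin y" using z(3) sin_double[of "y / 2"] by simp
  finally show ?thesis .
qed simp

lemma circular_distance_le:
  assumes "0 \<le> s" "s \<le> t" "t \<le> 2 * pi"
  shows "min (t - s) (2 * pi - (t - s)) \<le> 2 * cmod (cis t - cis s)"
proof -
  define d where "d = t - s"
  have d: "0 \<le> d" "d \<le> 2 * pi" using assms by (auto simp: d_def)
  have s0: "0 \<le> sin (d / 2)" using d by (intro sin_ge_zero) auto
  have "min d (2 * pi - d) \<le> 4 * sin (d / 2)"
  proof (cases "d \<le> pi")
    case True
    then show ?thesis using sin_ge_half[of "d / 2"] d by (simp add: min_def)
  next
    case False
    then show ?thesis using sin_ge_half[of "pi - d / 2"] d by (simp add: min_def)
  qed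
  then show ?thesis using s0 by (simp add: norm_cis_diff d_def)
qed

definition total_variation :: "(real \<Rightarrow> real) \<Rightarrow> real \<Rightarrow> real \<Rightarrow> real" where
  "total_variation f a b = Sup {s. variation_sum f a b s}"

context
  fixes f :: "real \<Rightarrow> real" and T B :: real
  assumes f: "continuous_on UNIV f" and B: "\<And>s. variation_sum f 0 T s \<Longrightarrow> s \<le> B"
begin

lemma variation_sum_le_bound:
  assumes s: "variation_sum f a b s" and "0 \<le> a" "b \<le> T"
  shows "s \<le> B"
proof -
  have "variation_sum f 0 T (\<bar>f a - f 0\<bar> + s + \<bar>f T - f b\<bar>)"
    by (rule variation_sum_concat[OF variation_sum_single[OF assms(3)] variation_sum_concat[OF s variation_sum_single[OF assms(2)]]])
  from B[OF this] show ?thesis by simp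
qed

lemma variation_sum_le_total_variation:
  assumes "variation_sum f a b s" "0 \<le> a" "b \<le> T"
  shows "s \<le> total_variation f a b"
  unfolding total_variation_def
  by (rule cSup_upper) (use assms variation_sum_le_bound in \<open>auto intro!: bdd_aboveI\<close>)

lemma total_variation_le:
  assumes "a \<le> b" "\<And>s. variation_sum f a b s \<Longrightarrow> s \<le> C"
  shows "total_variation f a b \<le> C"
  unfolding total_variation_def
  by (rule cSup_least) (use assms variation_sum_single[OF assms(1)] in auto)

lemma total_variation_approx:
  assumes "a \<le> b" "0 < e"
  shows "\<exists>s. variation_sum f a b s \<and> total_variation f a b - e < s"
proof (rule ccontr)
  assume "\<not> ?thesis"
  then have "total_variation f a b \<le> total_variation f a b - e"
    by (intro total_variation_le assms) (meson not_le)
  with assms show False by simp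
qed

lemma total_variation_concat:
  assumes "variation_sum f a b s" "0 \<le> a" "b \<le> T"
  shows "total_variation f 0 a + s \<le> total_variation f 0 b"
proof -
  have "total_variation f 0 a \<le> total_variation f 0 b - s"
  proof (rule total_variation_le[OF assms(2)])
    fix s' assume "variation_sum f 0 a s'"
    from variation_sum_le_total_variation[OF variation_sum_concat[OF assms(1) this]] assms
    show "s' \<le> total_variation f 0 b - s" by simp
  qed
  then show ?thesis by simp
qed

lemma total_variation_increment:
  assumes "0 \<le> a" "a \<le> b" "b \<le> T"
  shows "\<bar>f b - f a\<bar> \<le> total_variation f 0 b - total_variation f 0 a"
  using total_variation_concat[OF variation_sum_single[OF assms(2)]] assms by simp

text \<open>To the left of \<open>a\<close>, an almost optimal partition of \<open>{0..a}\<close> is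
  shortened; to the right, an almost optimal partition of \<open>{a..T}\<close> is shortened at its
  left end and compared with the variation up to \<open>T\<close>.\<close>

lemma continuous_on_total_variation: "continuous_on {0..T} (\<lambda>t. total_variation f 0 t)"
proof -
  let ?V = "\<lambda>t. total_variation f 0 t"
  have mono: "?V a \<le> ?V b" if "0 \<le> a" "a \<le> b" "b \<le> T" for a b
    using total_variation_increment[OF that] by simp
  have "\<exists>d>0. \<forall>t\<in>{0..T}. dist t a < d \<longrightarrow> dist (?V t) (?V a) < e" if a: "a \<in> {0..T}" and e: "0 < e" for a e
  proof -
    have e4: "0 < e / 4" using e by simp
    obtain s where s: "variation_sum f 0 a s" "?V a - e / 4 < s"
      using total_variation_approx[of 0 a "e / 4"] a e by auto
    obtain d1 where d1: "d1 > 0" "\<And>t. a - d1 < t \<and> t \<le> a \<and> 0 \<le> t \<Longrightarrow> \<exists>s'\<ge>s - e / 4. variation_sum f 0 t s'"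
      using variation_sum_left_limit[OF s(1) f e4] by blast
    obtain s2 where s2: "variation_sum f a T s2" "total_variation f a T - e / 4 < s2"
      using total_variation_approx[of a T "e / 4"] a e by auto
    obtain d2 where d2: "d2 > 0" "\<And>t. a \<le> t \<and> t < a + d2 \<and> t \<le> T \<Longrightarrow> \<exists>s'\<ge>s2 - e / 4. variation_sum f t T s'"
      using variation_sum_right_limit[OF s2(1) f e4] by blast
    show ?thesis
    proof (rule exI[of _ "min d1 d2"], intro conjI ballI impI)
      fix t assume t: "t \<in> {0..T}" "dist t a < min d1 d2"
      show "dist (?V t) (?V a) < e"
      proof (cases "t \<le> a")
        case True
        then obtain s' where "s' \<ge> s - e / 4" "variation_sum f 0 t s'" using d1(2)[of t] t by (auto simp: dist_real_def)
        then have "?V t \<ge> ?V a - e / 2" using variation_sum_le_total_variation[of 0 t s'] s t by auto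
        then show ?thesis using mono[of t a] True t a e by (auto simp: dist_real_def)
      next
        case False
        then obtain s' where s': "s' \<ge> s2 - e / 4" "variation_sum f t T s'" using d2(2)[of t] t by (auto simp: dist_real_def)
        have "?V t + s' \<le> ?V T" using total_variation_concat[OF s'(2)] t by simp
        also have "?V T \<le> ?V a + total_variation f a T"
        proof (rule total_variation_le)
          fix r assume "variation_sum f 0 T r"
          then obtain r1 r2 where "variation_sum f 0 a r1" "variation_sum f a T r2" "r \<le> r1 + r2"
            using variation_sum_split[of f 0 T r a] a by auto
          with a variation_sum_le_total_variation[of 0 a r1] variation_sum_le_total_variation[of a T r2]
          show "r \<le> ?V a + total_variation f a T" by simp
        qed (use a in auto)
        finally have "?V t \<le> ?V a + e / 2" using s' s2 by simp
        then show ?thesis using mono[of a t] False t a e by (auto simp: dist_real_def)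
      qed
    qed (use d1 d2 in auto)
  qed
  then show ?thesis unfolding continuous_on_iff by blast
qed

end

text \<open>The new angle \<open>\<Phi>\<close> is the variation of \<open>f\<close> plus the old
  angle, normalised to one turn. The variation makes \<open>f\<close> Lipschitz in
  \<open>\<Phi>\<close>; the added \<open>t\<close> makes \<open>\<Phi>\<close> strictly
  increasing.\<close>

lemma bounded_variation_reparametrization:
  fixes f :: "complex \<Rightarrow> real"
  assumes f: "continuous_on circle f" and bv: "bounded_variation_T f"
  shows "\<exists>h h' L. homeomorphism circle circle h h' \<and>
    (\<forall>z\<in>circle. \<forall>w\<in>circle. \<bar>f (h z) - f (h w)\<bar> \<le> L * cmod (z - w))"
proof -
  let ?f = "\<lambda>t. f (cis t)"
  have fc: "continuous_on UNIV ?f" by (rule continuous_on_circle_cis[OF f])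
  obtain B where B: "\<And>n t. (\<forall>i<n. t i < t (Suc i)) \<and> t n = t 0 + 2 * pi \<Longrightarrow>
        (\<Sum>i<n. \<bar>f (cis (t (Suc i))) - f (cis (t i))\<bar>) \<le> B"
    using bv unfolding bounded_variation_T_def by blast
  have vB: "s \<le> B" if "variation_sum ?f 0 (2 * pi) s" for s
    using variation_sum_partition[OF that] B by fastforce
  define V where "V t = total_variation ?f 0 t" for t
  have V: "\<bar>?f b - ?f a\<bar> \<le> V b - V a" if "0 \<le> a" "a \<le> b" "b \<le> 2 * pi" for a b
    unfolding V_def by (rule total_variation_increment[OF fc vB that])
  have Vc: "continuous_on {0..2*pi} V"
    unfolding V_def by (rule continuous_on_total_variation[OF fc vB])
  have V0: "V 0 \<le> V (2*pi)" using V[of 0 "2*pi"] by simp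
  define \<mu> where "\<mu> = 2 * pi / (2 * pi + (V (2*pi) - V 0))"
  have \<mu>: "0 < \<mu>" unfolding \<mu>_def using V0 by (intro divide_pos_pos add_pos_nonneg) auto
  define \<Phi> where "\<Phi> t = \<mu> * (t + (V t - V 0))" for t
  have \<Phi>c: "continuous_on {0..2*pi} \<Phi>" unfolding \<Phi>_def by (intro continuous_intros Vc)
  have \<Phi>0: "\<Phi> 0 = 0" by (simp add: \<Phi>_def)
  have \<Phi>1: "\<Phi> (2*pi) = 2 * pi"
  proof -
    have "0 < 2 * pi + (V (2*pi) - V 0)" using V0 pi_gt_zero by linarith
    then show ?thesis unfolding \<Phi>_def \<mu>_def by simp
  qed
  have \<Phi>V: "\<mu> * \<bar>?f b - ?f a\<bar> \<le> \<Phi> b - \<Phi> a" if "0 \<le> a" "a \<le> b" "b \<le> 2 * pi" for a b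
  proof -
    have "\<mu> * \<bar>?f b - ?f a\<bar> \<le> \<mu> * ((b - a) + (V b - V a))"
      using V[OF that] that \<mu> by (intro mult_left_mono) auto
    then show ?thesis by (simp add: \<Phi>_def algebra_simps)
  qed
  have \<Phi>m: "strict_mono_on {0..2*pi} \<Phi>"
  proof (rule strict_mono_onI)
    fix a b assume ab: "a \<in> {0..2*pi}" "b \<in> {0..2*pi}" "a < b"
    have "V a \<le> V b" using V[of a b] ab by simp
    then have "a + (V a - V 0) < b + (V b - V 0)" using ab by simp
    then show "\<Phi> a < \<Phi> b" unfolding \<Phi>_def using \<mu> by simp
  qed
  obtain k k' where k: "homeomorphism circle circle k k'" "\<And>t. t \<in> {0..2*pi} \<Longrightarrow> k (cis t) = cis (\<Phi> t)"
    using lift_homeomorphism[OF \<Phi>c \<Phi>m] \<Phi>0 \<Phi>1 by auto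
  have param: "\<exists>t\<in>{0..2*pi}. k' z = cis t \<and> z = cis (\<Phi> t)" if z: "z \<in> circle" for z
  proof -
    have k'z: "k' z \<in> circle" "k (k' z) = z" using k(1) z by (auto simp: homeomorphism_def)
    obtain t where t: "k' z = cis t" "t \<in> {0..2*pi}" using circle_param[OF k'z(1)] by auto
    then show ?thesis using k(2)[OF t(2)] k'z(2) by (intro bexI[of _ t]) auto
  qed
  have key: "\<bar>f (cis b) - f (cis a)\<bar> \<le> 2 / \<mu> * cmod (cis (\<Phi> b) - cis (\<Phi> a))"
    if ab: "0 \<le> a" "a \<le> b" "b \<le> 2 * pi" for a b
  proof -
    have "\<mu> * \<bar>?f b - ?f a\<bar> \<le> \<Phi> b - \<Phi> a" by (rule \<Phi>V[OF ab])
    \<comment> \<open>The shorter arc between the points may pass through the base point. The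
      increment is then estimated along the complementary arc, using
      \<open>f (cis (2 * pi)) = f (cis 0)\<close>.\<close>
    moreover have "\<mu> * \<bar>?f b - ?f a\<bar> \<le> 2 * pi - (\<Phi> b - \<Phi> a)"
    proof -
      have "\<mu> * \<bar>?f b - ?f a\<bar> \<le> \<mu> * (\<bar>?f (2*pi) - ?f b\<bar> + \<bar>?f a - ?f 0\<bar>)"
        using \<mu> by (intro mult_left_mono) auto
      also have "\<dots> \<le> (\<Phi> (2*pi) - \<Phi> b) + (\<Phi> a - \<Phi> 0)"
        using \<Phi>V[of b "2*pi"] \<Phi>V[of 0 a] ab unfolding distrib_left by linarith
      finally show ?thesis by (simp add: \<Phi>0 \<Phi>1)
    qed
    moreover have "min (\<Phi> b - \<Phi> a) (2 * pi - (\<Phi> b - \<Phi> a)) \<le> 2 * cmod (cis (\<Phi> b) - cis (\<Phi> a))"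
    proof (rule circular_distance_le)
      show "0 \<le> \<Phi> a" "\<Phi> a \<le> \<Phi> b" "\<Phi> b \<le> 2 * pi"
        using strict_mono_on_leD[OF \<Phi>m, of 0 a] strict_mono_on_leD[OF \<Phi>m, of a b] strict_mono_on_leD[OF \<Phi>m, of b "2*pi"] ab \<Phi>0 \<Phi>1
        by auto
    qed
    ultimately have "\<mu> * \<bar>?f b - ?f a\<bar> \<le> 2 * cmod (cis (\<Phi> b) - cis (\<Phi> a))" by linarith
    then show ?thesis using \<mu> by (simp add: field_simps)
  qed
  have "\<bar>f (k' z) - f (k' w)\<bar> \<le> 2 / \<mu> * cmod (z - w)" if zw: "z \<in> circle" "w \<in> circle" for z w
  proof -
    obtain a b where a: "a \<in> {0..2*pi}" "k' z = cis a" "z = cis (\<Phi> a)"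
      and b: "b \<in> {0..2*pi}" "k' w = cis b" "w = cis (\<Phi> b)" using param zw by meson
    show ?thesis
    proof (cases "a \<le> b")
      case True
      then show ?thesis using key[of a b] a b by (simp add: abs_minus_commute norm_minus_commute)
    next
      case False
      then show ?thesis using key[of b a] a b by simp
    qed
  qed
  moreover have "homeomorphism circle circle k' k" using k(1) by (rule homeomorphism_symD)
  ultimately show ?thesis by blast
qed

section \<open>The limit homeomorphism for a Lipschitz function and a continuous one\<close>

lemma holomorphic_circle_lift_mono:
  assumes G: "G holomorphic_on ball 0 1" and r: "0 < r" "r < 1"
    and re: "\<And>z. z \<in> ball 0 1 \<Longrightarrow> -1 \<le> Re (z * deriv G z)"
  shows "mono (\<lambda>t. t + Im (G (of_real r * cis t)))"
proof -
  have nonneg: "\<exists>y. ((\<lambda>t. t + Im (G (of_real r * cis t))) has_real_derivative y) (at t) \<and> 0 \<le> y" for t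
  proof -
    have "((\<lambda>t. Im (G (of_real r * cis t))) has_real_derivative Re (of_real r * cis t * deriv G (of_real r * cis t))) (at t)"
    using bounded_linear.has_vector_derivative[OF bounded_linear_Im has_vector_derivative_holomorphic_circle[OF G r, of t]]
    by (simp add: has_real_derivative_iff_has_vector_derivative)
    then have "((\<lambda>t. t + Im (G (of_real r * cis t))) has_real_derivative 1 + Re (of_real r * cis t * deriv G (of_real r * cis t))) (at t)"
    by (intro derivative_intros)
  moreover have "of_real r * cis t \<in> ball 0 1" using r by (simp add: norm_mult)
    ultimately show ?thesis
      using re[of "of_real r * cis t"] by (intro exI[of _ "1 + Re (of_real r * cis t * deriv G (of_real r * cis t))"]) auto
  qed
  show ?thesis
  proof (rule monoI)
    fix a b :: real assume "a \<le> b"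
    then show "a + Im (G (of_real r * cis a)) \<le> b + Im (G (of_real r * cis b))"
      by (rule DERIV_nonneg_imp_nondecreasing) (rule nonneg)
  qed
qed

text \<open>On the circles of radius \<open>r j\<close>, \<open>u j\<close> is within
  \<open>\<epsilon> j\<close> of \<open>g\<close> along the approximate boundary map
  \<open>hj j\<close>, and \<open>f\<close> along \<open>hj j\<close> inherits the increments of its
  lift. Both have energies bounded in \<open>j\<close>, and these bounds pass to the uniform
  limit.\<close>

lemma lipschitz_pair_W_half:
  fixes f g :: "complex \<Rightarrow> real"
  assumes g: "continuous_on circle g"
    and lip: "\<And>z w. z \<in> circle \<Longrightarrow> w \<in> circle \<Longrightarrow> \<bar>f z - f w\<bar> \<le> L * cmod (z - w)"
  shows "\<exists>h h'. homeomorphism circle circle h h' \<and> f \<circ> h \<in> W_half \<and> g \<circ> h \<in> W_half"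
proof -
  have L0: "0 \<le> L"
    using lip[of 1 "-1"] order_trans[OF abs_ge_zero[of "f 1 - f (-1)"]] by (simp add: zero_le_mult_iff)
  have fcont: "continuous_on circle f"
    by (rule lipschitz_on_continuous_on[of L]) (use lip L0 in \<open>auto simp: lipschitz_on_def dist_norm\<close>)
  obtain G where G: "G holomorphic_on ball 0 1" "bounded ((\<lambda>z. z * exp (G z)) ` ball 0 1)"
     "\<And>z. z \<in> ball 0 1 \<Longrightarrow> -1 \<le> Re (z * deriv G z)"
     "\<And>e. e > 0 \<Longrightarrow> \<exists>r<1. \<forall>z. r < cmod z \<and> cmod z < 1 \<longrightarrow> \<bar>Re (G z) - g (sgn (z * exp (G z)))\<bar> < e"
    using star_domain_conformal_log[OF g] by blast
  have "bounded (g ` circle)"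
    by (intro compact_imp_bounded compact_continuous_image g) simp
  then obtain Bg where Bg: "\<And>z. z \<in> circle \<Longrightarrow> \<bar>g z\<bar> \<le> Bg"
    unfolding bounded_pos real_norm_def by blast
  define \<epsilon> where "\<epsilon> j = 1 / real (Suc j)" for j
  have \<epsilon>: "0 < \<epsilon> j" "\<epsilon> j \<le> 1" for j by (auto simp: \<epsilon>_def)
  have \<epsilon>_lim: "\<epsilon> \<longlonglongrightarrow> 0" unfolding \<epsilon>_def[abs_def] by real_asymp
  have "\<exists>r. 1 - \<epsilon> j < r \<and> 0 < r \<and> r < 1 \<and> (\<forall>z. cmod z = r \<longrightarrow> \<bar>Re (G z) - g (sgn (z * exp (G z)))\<bar> < \<epsilon> j)" for j
  proof -
    obtain \<rho> where \<rho>: "\<rho> < 1" "\<And>z. \<rho> < cmod z \<and> cmod z < 1 \<Longrightarrow> \<bar>Re (G z) - g (sgn (z * exp (G z)))\<bar> < \<epsilon> j"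
      using G(4)[OF \<epsilon>(1)] by blast
    \<comment> \<open>The midpoint with 1 lies beyond both the radius \<open>\<rho>\<close> and
      \<open>1 - \<epsilon> j\<close>; the latter makes \<open>r j\<close> tend to 1.\<close>
    define r where "r = (max \<rho> (1 - \<epsilon> j) + 1) / 2"
    have mid: "x < (x + 1) / 2 \<and> (x + 1) / 2 < 1" if "x < 1" for x :: real using that by simp
    have "max \<rho> (1 - \<epsilon> j) < 1" using \<rho>(1) \<epsilon>(1)[of j] by simp
    then have r: "max \<rho> (1 - \<epsilon> j) < r" "r < 1" using mid unfolding r_def by blast+
    have "0 \<le> max \<rho> (1 - \<epsilon> j)" using \<epsilon>(2)[of j] by simp
    then have "0 < r" using r by linarith
    with r \<rho>(2) show ?thesis by (intro exI[of _ r]) auto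
  qed
  then obtain r where r: "\<And>j. 1 - \<epsilon> j < r j" "\<And>j. 0 < r j" "\<And>j. r j < 1"
    "\<And>j z. cmod z = r j \<Longrightarrow> \<bar>Re (G z) - g (sgn (z * exp (G z)))\<bar> < \<epsilon> j" by metis
  define u where "u j z = Re (G (of_real (r j) * z))" for j z
  \<comment> \<open>Whole turns are subtracted so that the lifts start in
    \<open>{0..2 * pi}\<close>, as the uniform bound for Arzela-Ascoli requires. Neither
    \<open>cis (v j z)\<close> nor the increments of \<open>v j\<close> change.\<close>
  define k where "k j = \<lfloor>Im (G (of_real (r j))) / (2 * pi)\<rfloor>" for j
  define v where "v j z = Im (G (of_real (r j) * z)) - 2 * pi * of_int (k j)" for j z
  define H where "H j t = t + v j (cis t)" for j t
  define hj where "hj j z = z * cis (v j z)" for j z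
  have hj_cis: "hj j (cis t) = cis (H j t)" for j t by (simp add: hj_def H_def cis_mult)
  have hj_circle: "hj j z \<in> circle" if "z \<in> circle" for j z using that by (simp add: hj_def norm_mult)
  \<comment> \<open>The polar form of the conformal map: \<open>hj j z\<close> is its direction,
    which turns the boundary condition on \<open>G\<close> into closeness of \<open>u j\<close> to
    \<open>g \<circ> hj j\<close>.\<close>
  have zexp: "of_real (r j) * z * exp (G (of_real (r j) * z)) = of_real (r j * exp (u j z)) * hj j z" for j z
  proof -
    have "cis (v j z) = cis (Im (G (of_real (r j) * z)))"
      unfolding v_def by (simp flip: cis_divide)
    then show ?thesis by (simp add: hj_def u_def exp_eq_polar mult_ac)
  qed
  have ug: "\<bar>u j z - g (hj j z)\<bar> < \<epsilon> j" if z: "z \<in> circle" for j z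
  proof -
    have "sgn (of_real (r j) * z * exp (G (of_real (r j) * z))) = hj j z"
      using r(2)[of j] hj_circle[OF z, of j] unfolding zexp sgn_mult sgn_of_real by (simp add: sgn_eq)
    then show ?thesis using r(4)[of "of_real (r j) * z" j] z r(2)[of j] by (simp add: u_def norm_mult)
  qed
  have uB: "\<bar>Re (G (of_real (r j) * z))\<bar> \<le> Bg + 1" if z: "z \<in> circle" for j z
    using ug[OF z, of j] Bg[OF hj_circle[OF z, of j]] \<epsilon>(2)[of j] by (simp add: u_def)
  note energy = conformal_energy[OF G(1) r(2,3) G(3) uB]
  have vc: "continuous_on circle (v j)" for j
  proof -
    have "continuous_on circle (\<lambda>z. Im (G (of_real (r j) * z)))"
      using continuous_on_Re[OF energy(2)] by simp
    then show ?thesis unfolding v_def by (rule continuous_on_diff[OF _ continuous_on_const])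
  qed
  have uc: "continuous_on circle (\<lambda>z. complex_of_real (u j z))" for j
    unfolding u_def by (rule energy(1))
  define E where "E = (8 + 2 * pi\<^sup>2) * (2 * (Bg + 1))"
  have dy: "(\<Sum>n<N. 2 ^ n * dyadic_increment (\<lambda>z. of_real (v j z)) n) \<le> E" for j N
  proof -
    have "dyadic_increment (\<lambda>z. of_real (v j z)) n = dyadic_increment (\<lambda>z. complex_of_real (Im (G (of_real (r j) * z)))) n" for n
      unfolding dyadic_increment_def v_def by simp
    then show ?thesis using dyadic_increment_le[OF energy(2,3), of j N] by (simp add: E_def)
  qed
  have Hmono: "mono (H j)" for j
    using holomorphic_circle_lift_mono[OF G(1) r(2,3) G(3), of j] by (auto simp: mono_def H_def v_def)
  have Hper: "H j (t + 2 * pi) = H j t + 2 * pi" for j t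
    by (simp add: H_def flip: cis_mult)
  have H0: "0 \<le> H j 0" "H j 0 \<le> 2 * pi" for j
  proof -
    define w where "w = Im (G (of_real (r j)))"
    show "0 \<le> H j 0" "H j 0 \<le> 2 * pi"
      using floor_2pi_bounds[of w] by (simp_all add: H_def v_def k_def w_def[symmetric] algebra_simps)
  qed
  have Hmod: "(H j b - H j a)\<^sup>2 \<le> (8 * E + 16 * pi\<^sup>2) / real (Suc m)" if "a \<le> b" "b - a \<le> pi / 2 ^ Suc m" for j a b m
    by (rule monotone_lift_modulus[where H = "H j" and v = "v j", OF vc _ Hmono dy that]) (rule H_def)
  have equicont: "\<exists>d>0. \<forall>j. \<forall>x y. \<bar>x - y\<bar> < d \<longrightarrow> \<bar>H j x - H j y\<bar> < e" if e: "0 < e" for e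
  proof -
    obtain m :: nat where m: "(8 * E + 16 * pi\<^sup>2) / e\<^sup>2 < real m" using reals_Archimedean2 by blast
    have "0 < e\<^sup>2" using e by simp
    then have "8 * E + 16 * pi\<^sup>2 < real m * e\<^sup>2" using m by (simp only: pos_divide_less_eq)
    also have "\<dots> \<le> real (Suc m) * e\<^sup>2" by (intro mult_right_mono) auto
    finally have "8 * E + 16 * pi\<^sup>2 < e\<^sup>2 * real (Suc m)" by (simp only: mult.commute)
    then have m': "(8 * E + 16 * pi\<^sup>2) / real (Suc m) < e\<^sup>2"
      using pos_divide_less_eq[OF of_nat_0_less_iff[THEN iffD2, OF zero_less_Suc[of m]], of "8 * E + 16 * pi\<^sup>2" "e\<^sup>2"] by blast
    define d where "d = pi / 2 ^ Suc m"
    have d: "0 < d" by (simp add: d_def)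
    have *: "\<bar>H j b - H j a\<bar> < e" if ab: "a \<le> b" "b - a \<le> d" for j a b
    proof -
      have "(H j b - H j a)\<^sup>2 < e\<^sup>2" using Hmod[OF ab[unfolded d_def], of j] m' by (rule order_le_less_trans)
      then have "\<bar>H j b - H j a\<bar>\<^sup>2 < e\<^sup>2" by (simp only: power2_abs)
      then show ?thesis using e by (intro power2_less_imp_less[of _ e]) linarith+
    qed
    have "\<bar>H j x - H j y\<bar> < e" if xy: "\<bar>x - y\<bar> < d" for j x y
    proof (cases "x \<le> y")
      case True
      moreover have "y - x \<le> d" using xy by linarith
      ultimately show ?thesis using *[of x y j] by linarith
    next
      case False
      then have "y \<le> x" "x - y \<le> d" using xy by linarith+
      then show ?thesis using *[of y x j] by linarith
    qed
    with d show ?thesis by blast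
  qed
  obtain \<eta> \<kappa> where \<eta>: "continuous_on {0..2*pi} \<eta>" and \<kappa>: "strict_mono (\<kappa> :: nat \<Rightarrow> nat)"
    and lim: "\<And>e. 0 < e \<Longrightarrow> \<exists>N. \<forall>n x. n \<ge> N \<and> x \<in> {0..2*pi} \<longrightarrow> norm (H (\<kappa> n) x - \<eta> x) < e"
  proof (rule Arzela_Ascoli[of "{0..2*pi}" H "4 * pi"])
    fix n x assume x: "x \<in> {0..2*pi}"
    have "H n 0 \<le> H n x" "H n x \<le> H n (0 + 2 * pi)" using x by (auto intro!: monoD[OF Hmono])
    then show "norm (H n x) \<le> 4 * pi" using H0[of n] unfolding Hper by simp
  next
    fix x e :: real assume "0 < e"
    then show "\<exists>d>0. \<forall>n y. y \<in> {0..2*pi} \<and> norm (x - y) < d \<longrightarrow> norm (H n x - H n y) < e"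
      using equicont[of e] unfolding real_norm_def by blast
  qed auto
  have \<kappa>_ge: "n \<le> \<kappa> n" for n using \<kappa> by (rule seq_suble)
  have limD: "\<exists>j. \<epsilon> j < e \<and> (\<forall>x\<in>{0..2*pi}. \<bar>H j x - \<eta> x\<bar> < e)" if e: "0 < e" for e
  proof -
    obtain N1 where N1: "\<And>n x. n \<ge> N1 \<Longrightarrow> x \<in> {0..2*pi} \<Longrightarrow> \<bar>H (\<kappa> n) x - \<eta> x\<bar> < e"
      using lim[OF e] by auto
    obtain N2 where N2: "\<And>n. n \<ge> N2 \<Longrightarrow> \<epsilon> n < e"
      using order_tendstoD(2)[OF \<epsilon>_lim e] unfolding eventually_sequentially by blast
    show ?thesis
      using N1[of "max N1 N2"] N2[of "\<kappa> (max N1 N2)"] \<kappa>_ge[of "max N1 N2"]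
      by (intro exI[of _ "\<kappa> (max N1 N2)"]) auto
  qed
  have \<eta>_mono: "\<eta> a \<le> \<eta> b" if ab: "0 \<le> a" "a \<le> b" "b \<le> 2*pi" for a b
  proof (rule field_le_epsilon)
    fix e :: real assume "0 < e"
    then have "0 < e / 2" by simp
    then obtain j where j: "\<And>x. x \<in> {0..2*pi} \<Longrightarrow> \<bar>H j x - \<eta> x\<bar> < e / 2" using limD by blast
    have "\<bar>H j a - \<eta> a\<bar> < e / 2" "\<bar>H j b - \<eta> b\<bar> < e / 2" using j ab by simp_all
    then show "\<eta> a \<le> \<eta> b + e" using monoD[OF Hmono ab(2), of j] by linarith
  qed
  have \<eta>_per: "\<eta> (2*pi) = \<eta> 0 + 2 * pi"
  proof (rule ccontr)
    assume "\<eta> (2*pi) \<noteq> \<eta> 0 + 2 * pi"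
    define A where "A = \<bar>\<eta> (2*pi) - \<eta> 0 - 2 * pi\<bar> / 2"
    have "0 < A" using \<open>\<eta> (2*pi) \<noteq> \<eta> 0 + 2 * pi\<close> by (simp add: A_def)
    then obtain j where j: "\<And>x. x \<in> {0..2*pi} \<Longrightarrow> \<bar>H j x - \<eta> x\<bar> < A" using limD by blast
    have "H j (2*pi) = H j 0 + 2 * pi" using Hper[of j 0] by simp
    moreover have "\<bar>H j 0 - \<eta> 0\<bar> < A" "\<bar>H j (2*pi) - \<eta> (2*pi)\<bar> < A" using j by simp_all
    ultimately have "\<bar>\<eta> (2*pi) - \<eta> 0 - 2 * pi\<bar> < 2 * A" by linarith
    then show False by (simp add: A_def)
  qed
  have \<eta>_strict: "strict_mono_on {0..2*pi} \<eta>"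
  proof (rule strict_mono_onI, rule ccontr)
    fix a b assume ab: "a \<in> {0..2*pi}" "b \<in> {0..2*pi}" "a < b" and "\<not> \<eta> a < \<eta> b"
    then have flat: "\<eta> t = \<eta> a" if "t \<in> {a..b}" for t
      using \<eta>_mono[of a t] \<eta>_mono[of t b] that by auto
    \<comment> \<open>The boundary point in direction \<open>\<eta> a\<close>, which the conformal
      map would approach along the whole arc from \<open>a\<close> to \<open>b\<close>.\<close>
    define c where "c = of_real (exp (g (cis (\<eta> a)))) * cis (\<eta> a)"
    show False
    proof (rule no_constant_arc[of "\<lambda>z. z * exp (G z)" c a b])
      show "(\<lambda>z. z * exp (G z)) holomorphic_on ball 0 1" by (intro holomorphic_intros G)
      show "c \<noteq> 0" by (simp add: c_def)
      fix e :: real assume e: "0 < e"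
      \<comment> \<open>The conformal map as a jointly continuous function of radius, logarithmic
        stretching and angle; closeness of these three numbers then suffices.\<close>
      define \<Psi> where "\<Psi> p = of_real (fst p * exp (fst (snd p))) * cis (snd (snd p))" for p :: "real \<times> real \<times> real"
      have "continuous_on UNIV \<Psi>" unfolding \<Psi>_def by (intro continuous_intros)
      then have "isCont \<Psi> (1, g (cis (\<eta> a)), \<eta> a)" by (simp add: continuous_on_eq_continuous_at)
      then obtain d where d: "d > 0" "\<And>p. dist p (1, g (cis (\<eta> a)), \<eta> a) < d \<Longrightarrow> dist (\<Psi> p) c < e"
        using e unfolding continuous_at_eps_delta by (force simp: \<Psi>_def c_def)
      have "isCont (\<lambda>t. g (cis t)) (\<eta> a)"
        using continuous_on_circle_cis[OF g, of UNIV] by (simp add: continuous_on_eq_continuous_at)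
      moreover have d4: "0 < d / 4" using d by simp
      ultimately obtain d' where d': "d' > 0" "\<And>t. \<bar>t - \<eta> a\<bar> < d' \<Longrightarrow> \<bar>g (cis t) - g (cis (\<eta> a))\<bar> < d / 4"
        unfolding continuous_at_eps_delta dist_real_def by blast
      obtain j where j: "\<epsilon> j < min d' (d / 4)" "\<And>x. x \<in> {0..2*pi} \<Longrightarrow> \<bar>H j x - \<eta> x\<bar> < min d' (d / 4)"
        using limD[of "min d' (d / 4)"] d'(1) d4 unfolding min_less_iff_conj by blast
      show "\<exists>r. 0 < r \<and> r < 1 \<and> (\<forall>t\<in>{a..b}. cmod (of_real r * cis t * exp (G (of_real r * cis t)) - c) < e)"
      proof (intro exI[of _ "r j"] conjI ballI)
        fix t assume t: "t \<in> {a..b}"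
        have Ht: "\<bar>H j t - \<eta> a\<bar> < min d' (d / 4)" using j(2)[of t] flat[OF t] t ab by auto
        have gt: "\<bar>g (cis (H j t)) - g (cis (\<eta> a))\<bar> < d / 4" using d'(2) Ht by simp
        have ut: "\<bar>u j (cis t) - g (cis (\<eta> a))\<bar> < d / 2"
        proof -
          have "\<bar>u j (cis t) - g (cis (H j t))\<bar> < \<epsilon> j" using ug[of "cis t" j] by (simp add: hj_cis)
          with gt j(1) show ?thesis unfolding min_less_iff_conj by linarith
        qed
        have rt: "\<bar>r j - 1\<bar> < d / 4" using r(1,3)[of j] j(1) by linarith
        have "dist (r j, u j (cis t), H j t) (1, g (cis (\<eta> a)), \<eta> a) \<le> \<bar>r j - 1\<bar> + (\<bar>u j (cis t) - g (cis (\<eta> a))\<bar> + \<bar>H j t - \<eta> a\<bar>)"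
          unfolding dist_Pair_Pair dist_real_def
          by (rule order_trans[OF sqrt_sum_squares_le_sum_abs]) (simp add: order_trans[OF sqrt_sum_squares_le_sum_abs])
        also have "\<dots> < d" using Ht ut rt by linarith
        finally have "dist (\<Psi> (r j, u j (cis t), H j t)) c < e" by (rule d(2))
        then show "cmod (of_real (r j) * cis t * exp (G (of_real (r j) * cis t)) - c) < e"
          unfolding zexp hj_cis by (simp add: \<Psi>_def dist_norm)
      qed (use r in auto)
    qed (use G(2) ab in auto)
  qed
  obtain h h' where hom: "homeomorphism circle circle h h'" and h: "\<And>t. t \<in> {0..2*pi} \<Longrightarrow> h (cis t) = cis (\<eta> t)"
    using lift_homeomorphism[OF \<eta> \<eta>_strict \<eta>_per] by blast
  have hc: "continuous_on circle h" "h ` circle \<subseteq> circle" using hom by (auto simp: homeomorphism_def)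
  have hlim: "\<exists>j. \<epsilon> j < e \<and> (\<forall>z\<in>circle. cmod (hj j z - h z) < e)" if e: "0 < e" for e
  proof -
    obtain j where j: "\<epsilon> j < e" "\<And>x. x \<in> {0..2*pi} \<Longrightarrow> \<bar>H j x - \<eta> x\<bar> < e" using limD[OF e] by blast
    have "cmod (hj j z - h z) < e" if z: "z \<in> circle" for z
    proof -
      obtain t where t: "t \<in> {0..<2*pi}" "z = cis t" using circle_param[OF z] by blast
      then have "cmod (hj j z - h z) \<le> \<bar>H j t - \<eta> t\<bar>"
        using norm_cis_diff_le[of "H j t" "\<eta> t"] by (simp add: hj_cis h)
      also have "\<dots> < e" using j(2)[of t] t by simp
      finally show ?thesis .
    qed
    with j(1) show ?thesis by blast
  qed
  have c: "continuous_on circle (f \<circ> h)" "continuous_on circle (g \<circ> h)"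
    by (rule continuous_on_compose[OF hc(1)], rule continuous_on_subset[OF _ hc(2)], rule fcont g)+
  have hjc: "continuous_on circle (hj j)" for j unfolding hj_def by (intro continuous_intros vc)
  have "g \<circ> h \<in> W_half"
    unfolding W_half_iff[OF c(2)]
  proof (rule exI[of _ "2 * (Bg + 1)"], rule allI, rule energy_le_uniform_limit[where x = "\<lambda>j z. of_real (u j z)"])
    fix e :: real assume e: "0 < e"
    then have e2: "0 < e / 2" by simp
    have "uniformly_continuous_on circle g" by (rule compact_uniformly_continuous[OF g]) simp
    then obtain d where d: "0 < d" "\<And>w z. w \<in> circle \<Longrightarrow> z \<in> circle \<Longrightarrow> cmod (w - z) < d \<Longrightarrow> \<bar>g w - g z\<bar> < e / 2"
      using e2 unfolding uniformly_continuous_on_def dist_norm real_norm_def by meson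
    obtain j where j: "\<epsilon> j < min d (e / 2)" "\<And>z. z \<in> circle \<Longrightarrow> cmod (hj j z - h z) < min d (e / 2)"
      using hlim[of "min d (e / 2)"] d(1) e2 unfolding min_less_iff_conj by blast
    have "cmod (of_real (u j z) - of_real ((g \<circ> h) z)) < e" if z: "z \<in> circle" for z
    proof -
      have "h z \<in> circle" using hc(2) z by blast
      then have "\<bar>g (hj j z) - g (h z)\<bar> < e / 2" using d(2)[OF hj_circle[OF z]] j(2)[OF z] by simp
      then have "\<bar>u j z - g (h z)\<bar> < e" using ug[OF z, of j] j(1) by linarith
      then show ?thesis by (simp flip: of_real_diff)
    qed
    then show "\<exists>j. \<forall>z\<in>circle. cmod (of_real (u j z) - of_real ((g \<circ> h) z)) < e" by blast
  qed (use uc c(2) energy(4) in \<open>auto simp: u_def intro!: continuous_intros\<close>)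
  moreover have "f \<circ> h \<in> W_half"
    unfolding W_half_iff[OF c(1)]
  \<comment> \<open>Increments of \<open>f \<circ> hj j\<close> are at most \<open>L\<close> times
    those of the lift. The term \<open>2 * E\<close> comes from \<open>v j\<close>, and
    \<open>4 * pi\<^sup>2\<close> is twice the sum of \<open>2 ^ n * (pi / 2 ^ n)\<^sup>2\<close>
    over all \<open>n\<close>.\<close>
  proof (rule exI[of _ "L\<^sup>2 * (2 * E + 4 * pi\<^sup>2)"], rule allI, rule energy_le_uniform_limit[where x = "\<lambda>j z. of_real (f (hj j z))"])
    show yc: "continuous_on circle (\<lambda>z. complex_of_real (f (hj j z)))" for j
      by (intro continuous_on_of_real continuous_on_compose2[OF fcont hjc]) (use hj_circle in blast)
    show "continuous_on circle (\<lambda>z. complex_of_real ((f \<circ> h) z))" by (intro continuous_on_of_real c)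
    fix e :: real assume e: "0 < e"
    then have "0 < e / (L + 1)" using L0 by simp
    then obtain j where j: "\<And>z. z \<in> circle \<Longrightarrow> cmod (hj j z - h z) < e / (L + 1)"
      using hlim by blast
    have "cmod (of_real (f (hj j z)) - of_real ((f \<circ> h) z)) < e" if z: "z \<in> circle" for z
    proof -
      have "h z \<in> circle" using hc(2) z by blast
      then have "\<bar>f (hj j z) - f (h z)\<bar> \<le> L * cmod (hj j z - h z)" by (intro lip hj_circle z)
      also have "\<dots> \<le> L * (e / (L + 1))" using j[OF z] L0 by (intro mult_left_mono) auto
      also have "\<dots> < e" using L0 e by (simp add: field_simps)
      finally show ?thesis by (simp flip: of_real_diff)
    qed
    then show "\<exists>j. \<forall>z\<in>circle. cmod (of_real (f (hj j z)) - of_real ((f \<circ> h) z)) < e" by blast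
  next
    fix m j
    show "half_energy (\<lambda>z. of_real (f (hj j z))) m \<le> L\<^sup>2 * (2 * E + 4 * pi\<^sup>2)"
    proof (rule energy_le_dyadic_increment)
      show "continuous_on circle (\<lambda>z. complex_of_real (f (hj j z)))"
        by (intro continuous_on_of_real continuous_on_compose2[OF fcont hjc]) (use hj_circle in blast)
      fix N
      have step: "dyadic_increment (\<lambda>z. of_real (f (hj j z))) n \<le>
          L\<^sup>2 * (2 * dyadic_increment (\<lambda>z. of_real (v j z)) n + 2 * (pi / 2 ^ n)\<^sup>2)" for n
      proof -
        define s where "s = pi / 2 ^ n"
        note inc = mean_lift_increment_le[OF vc, of j n, folded s_def]
        have c2: "continuous_on circle (\<lambda>z. complex_of_real (f (hj j z)))"
          by (intro continuous_on_of_real continuous_on_compose2[OF fcont hjc]) (use hj_circle in blast)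
        have "dyadic_increment (\<lambda>z. of_real (f (hj j z))) n \<le>
            mean (\<lambda>z. L\<^sup>2 * (v j (cis s * z) - v j z + s)\<^sup>2)"
          unfolding dyadic_increment_def s_def[symmetric]
        proof (rule mean_mono)
          show "continuous_on circle (\<lambda>z. (cmod (of_real (f (hj j (cis s * z))) - of_real (f (hj j z))))\<^sup>2)"
            by (intro continuous_on_power continuous_on_norm continuous_on_increment[OF c2])
          show "continuous_on circle (\<lambda>z. L\<^sup>2 * (v j (cis s * z) - v j z + s)\<^sup>2)"
            by (intro continuous_on_mult continuous_on_const inc)
          fix z :: complex assume z: "z \<in> circle"
          obtain t where t: "z = cis t" using circle_param[OF z] by blast
          define \<delta> where "\<delta> = v j (cis s * z) - v j z"
          have "H j (t + s) - H j t = \<delta> + s" by (simp add: H_def \<delta>_def t cis_mult add.commute)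
          then have "cmod (hj j (cis s * z) - hj j z) \<le> \<bar>\<delta> + s\<bar>"
            using norm_cis_diff_le[of "H j (t + s)" "H j t"] by (simp add: t cis_mult hj_cis add.commute)
          moreover have "cis s * z \<in> circle" using z by (simp add: norm_mult)
          ultimately have "\<bar>f (hj j (cis s * z)) - f (hj j z)\<bar> \<le> L * \<bar>\<delta> + s\<bar>"
            using lip[OF hj_circle hj_circle[OF z], of "cis s * z" j j] L0 by (meson mult_left_mono order_trans)
          then have "\<bar>f (hj j (cis s * z)) - f (hj j z)\<bar>\<^sup>2 \<le> (L * \<bar>\<delta> + s\<bar>)\<^sup>2" by (intro power_mono) auto
          also have "\<dots> = L\<^sup>2 * (\<delta> + s)\<^sup>2" by (simp add: power_mult_distrib)
          finally show "(cmod (of_real (f (hj j (cis s * z))) - of_real (f (hj j z))))\<^sup>2 \<le> L\<^sup>2 * (v j (cis s * z) - v j z + s)\<^sup>2"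
            by (simp add: \<delta>_def flip: of_real_diff)
        qed
        also have "\<dots> = L\<^sup>2 * mean (\<lambda>z. (v j (cis s * z) - v j z + s)\<^sup>2)" by (rule mean_mult_left[OF inc(1)])
        also have "\<dots> \<le> L\<^sup>2 * (2 * dyadic_increment (\<lambda>z. of_real (v j z)) n + 2 * s\<^sup>2)"
          by (intro mult_left_mono inc) simp
        finally show ?thesis by (simp add: s_def)
      qed
      have "(\<Sum>n<N. 2 ^ n * dyadic_increment (\<lambda>z. of_real (f (hj j z))) n) \<le>
          (\<Sum>n<N. 2 ^ n * (L\<^sup>2 * (2 * dyadic_increment (\<lambda>z. of_real (v j z)) n + 2 * (pi / 2 ^ n)\<^sup>2)))"
        by (intro sum_mono mult_left_mono step) auto
      also have "\<dots> = (\<Sum>n<N. L\<^sup>2 * (2 * (2 ^ n * dyadic_increment (\<lambda>z. of_real (v j z)) n) + 2 * pi\<^sup>2 * (1 / 2) ^ n))"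
        by (intro sum.cong refl) (simp add: power2_eq_square power_divide field_simps)
      also have "\<dots> = L\<^sup>2 * (2 * (\<Sum>n<N. 2 ^ n * dyadic_increment (\<lambda>z. of_real (v j z)) n) + 2 * pi\<^sup>2 * (\<Sum>n<N. (1 / 2) ^ n))"
        by (simp only: sum_distrib_left[symmetric] sum.distrib)
      also have "\<dots> \<le> L\<^sup>2 * (2 * E + 2 * pi\<^sup>2 * 2)"
      proof (intro mult_left_mono add_mono dy)
        show "(\<Sum>n<N. (1 / 2::real) ^ n) \<le> 2" by (subst geometric_sum) (auto simp: field_simps)
      qed auto
      finally show "(\<Sum>n<N. 2 ^ n * dyadic_increment (\<lambda>z. of_real (f (hj j z))) n) \<le> L\<^sup>2 * (2 * E + 4 * pi\<^sup>2)" by simp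
    qed simp
  qed
  ultimately show ?thesis using hom by blast
qed

theorem theorem4:
  fixes f :: "complex \<Rightarrow> real"
  assumes "f \<in> C_T"
  shows "(\<forall>g \<in> C_T. \<exists>h h'. homeomorphism circle circle h h' \<and>
            f \<circ> h \<in> W_half \<and> g \<circ> h \<in> W_half)
         \<longleftrightarrow> bounded_variation_T f"
proof
  assume "\<forall>g \<in> C_T. \<exists>h h'. homeomorphism circle circle h h' \<and> f \<circ> h \<in> W_half \<and> g \<circ> h \<in> W_half"
  then show "bounded_variation_T f"
    using assms by (intro bounded_variation_T_necessary) auto
next
  assume bv: "bounded_variation_T f"
  show "\<forall>g \<in> C_T. \<exists>h h'. homeomorphism circle circle h h' \<and> f \<circ> h \<in> W_half \<and> g \<circ> h \<in> W_half"
  proof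
    fix g :: "complex \<Rightarrow> real" assume "g \<in> C_T"
    then have g: "continuous_on circle g" by simp
    obtain k k' L where k: "homeomorphism circle circle k k'"
      and lip: "\<And>z w. z \<in> circle \<Longrightarrow> w \<in> circle \<Longrightarrow> \<bar>(f \<circ> k) z - (f \<circ> k) w\<bar> \<le> L * cmod (z - w)"
      using bounded_variation_reparametrization[OF _ bv] assms unfolding o_def mem_Collect_eq by blast
    \<comment> \<open>The change of variable that makes \<open>f\<close> Lipschitz acts on
      \<open>g\<close> as well, so the Lipschitz case is applied to the pair
      \<open>f \<circ> k\<close>, \<open>g \<circ> k\<close>.\<close>
    have "continuous_on circle (g \<circ> k)"
      using k g by (intro continuous_on_compose) (auto simp: homeomorphism_def)
    from lipschitz_pair_W_half[OF this lip]
    obtain h h' where h: "homeomorphism circle circle h h'" "(f \<circ> k) \<circ> h \<in> W_half" "(g \<circ> k) \<circ> h \<in> W_half"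
      by blast
    have "homeomorphism circle circle (k \<circ> h) (h' \<circ> k')"
      by (rule homeomorphism_compose[OF h(1) k])
    then show "\<exists>h h'. homeomorphism circle circle h h' \<and> f \<circ> h \<in> W_half \<and> g \<circ> h \<in> W_half"
      using h(2,3) by (auto simp: o_assoc)
  qed
qed

end
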